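(* Let $N\ge3$, $1<p<\infty$, $B$ the open unit ball of $\mathbb{R}^N$, and assume (A), (F') and (F''). Then there exists a positive, radially symmetric, radially increasing weak solution $u\in W^{1,p}(B)$ of $$-\Delta_p u+|u|^{p-2}u=a(|x|)f(u)\ \text{in } B,\qquad u>0\ \text{in } B,\qquad \frac{\partial u}{\partial\nu}=0\ \text{on }\partial B.$$
   Context: $\Delta_p u=\operatorname{div}(|\nabla u|^{p-2}\nabla u)$; weak solution means $\int_B |\nabla u|^{p-2}\nabla u\cdot\nabla v+|u|^{p-2}uv\,dx=\int_B a(|x|)f(u)v\,dx$ for all $v\in W^{1,p}(B)$. $F(t)=\int_0^t f(s)\,ds$. (A): $a\in L^1(B)$ (viewed as a function of $r=|x|$) is non-constant, radially increasing, and $a(r)>0$ for a.e. $r\in[0,1]$. (F'): $f\in C^1([0,+\infty))$, $f(t)=o(t^{p-1})$ as $t\to0$, $f'(t)t-(p-1)f(t)>0$ for all $t>0$, and there is $\gamma>p$ with $f(t)t\ge\gamma F(t)$ for all $t>0$. (F''): $t\mapsto f(t)/t^{p-1}$ is strictly increasing on $(0,+\infty)$. *)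

theory Defs
  imports "HOL-Analysis.Analysis"
begin

definition partial_deriv :: "'n::euclidean_space \<Rightarrow> ('n \<Rightarrow> real) \<Rightarrow> 'n \<Rightarrow> real" where
  "partial_deriv i \<phi> x = frechet_derivative \<phi> (at x) i"

fun Ck_fun :: "nat \<Rightarrow> ('n::euclidean_space \<Rightarrow> real) \<Rightarrow> bool" where
  "Ck_fun 0 \<phi> = continuous_on UNIV \<phi>"
| "Ck_fun (Suc k) \<phi> = (\<phi> differentiable_on UNIV \<and> continuous_on UNIV \<phi> \<and>
      (\<forall>i\<in>Basis. Ck_fun k (partial_deriv i \<phi>)))"

definition smooth_fun :: "('n::euclidean_space \<Rightarrow> real) \<Rightarrow> bool" where
  "smooth_fun \<phi> \<longleftrightarrow> (\<forall>k. Ck_fun k \<phi>)"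

definition test_fun :: "'n::euclidean_space set \<Rightarrow> ('n \<Rightarrow> real) \<Rightarrow> bool" where
  "test_fun U \<phi> \<longleftrightarrow> smooth_fun \<phi> \<and> compact (closure {x. \<phi> x \<noteq> 0})
      \<and> closure {x. \<phi> x \<noteq> 0} \<subseteq> U"

definition sobolev_W1p_grad ::
  "real \<Rightarrow> 'n::euclidean_space set \<Rightarrow> ('n \<Rightarrow> real) \<Rightarrow> ('n \<Rightarrow> 'n) \<Rightarrow> bool" where
  "sobolev_W1p_grad p U u g \<longleftrightarrow>
     set_borel_measurable lebesgue U u \<and>
     set_integrable lebesgue U (\<lambda>x. \<bar>u x\<bar> powr p) \<and>
     set_borel_measurable lebesgue U g \<and>
     set_integrable lebesgue U (\<lambda>x. norm (g x) powr p) \<and>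
     (\<forall>\<phi>. test_fun U \<phi> \<longrightarrow> (\<forall>i\<in>Basis.
        (LINT x:U|lebesgue. u x * partial_deriv i \<phi> x)
          = - (LINT x:U|lebesgue. (g x \<bullet> i) * \<phi> x)))"

definition in_W1p :: "real \<Rightarrow> 'n::euclidean_space set \<Rightarrow> ('n \<Rightarrow> real) \<Rightarrow> bool" where
  "in_W1p p U u \<longleftrightarrow> (\<exists>g. sobolev_W1p_grad p U u g)"

text \<open>Weak solution of  -Delta_p u + |u|^{p-2}u = a(|x|) f(u)  in U with homogeneous
  Neumann boundary condition: test functions range over all of W^{1,p}(U).\<close>
definition weak_solution_neumann ::
  "real \<Rightarrow> 'n::euclidean_space set \<Rightarrow> (real \<Rightarrow> real) \<Rightarrow> (real \<Rightarrow> real) \<Rightarrow> ('n \<Rightarrow> real) \<Rightarrow> bool" where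
  "weak_solution_neumann p U a f u \<longleftrightarrow>
     (\<exists>g. sobolev_W1p_grad p U u g \<and>
       (\<forall>v h. sobolev_W1p_grad p U v h \<longrightarrow>
          set_integrable lebesgue U (\<lambda>x. a (norm x) * f (u x) * v x) \<and>
          (LINT x:U|lebesgue. norm (g x) powr (p - 2) * (g x \<bullet> h x)
                              + \<bar>u x\<bar> powr (p - 2) * u x * v x)
          = (LINT x:U|lebesgue. a (norm x) * f (u x) * v x)))"

end

theory Submission
  imports Defs "HOL-Probability.Helly_Selection" "HOL-Computational_Algebra.Polynomial"
begin

text \<open>Write \<open>n = N - 1\<close>. For a radial function the equation reads \<open>w' = r^n (u^(p-1) - a f(u))\<close> with
  \<open>w = r^n u'^(p-1)\<close> and \<open>w(0) = w(1) = 0\<close>. Replace \<open>w\<close> by its positive part in the equation for \<open>u'\<close>: then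
  \<open>u\<close> increases, and \<open>w \<le> r^(n+1) u^(p-1)\<close> gives \<open>d \<le> u \<le> e d\<close> for the initial value \<open>d\<close>. Hence
  \<open>w(1) > 0\<close> for small \<open>d\<close> and \<open>w(1) < 0\<close> for large \<open>d\<close>, because \<open>f(t)/t^(p-1)\<close> increases from 0 to
  infinity. The initial value problem may lack uniqueness, so the intermediate value theorem is applied
  to its Euler scheme, where \<open>w(1)\<close> depends continuously on \<open>d\<close>, and Helly's theorem gives the limit.
  There \<open>w \<ge> 0\<close>: as \<open>a\<close> and \<open>u\<close> increase, \<open>w'\<close> changes sign at most once, from plus to minus, and
  \<open>w(1) = 0\<close>.

  The weight \<open>a\<close> is only integrable while the test functions \<open>v\<close> range over all of the Sobolev space. Testing
  with dilations of bump functions shows that \<open>v\<close> is absolutely continuous along almost every ray; the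
  weak formulation is then an integration by parts on rays, in polar coordinates.\<close>

section \<open>The radial equation\<close>

text \<open>Uniqueness can fail because for p > 2 the exponent \<open>1 / (p - 1)\<close> is below
  1, so the right-hand side is not Lipschitz at \<open>w = 0\<close>, where every solution starts.
  On a grid \<open>w(1)\<close> is a finite composition of continuous maps of \<open>d\<close>. The
  bounds \<open>d\<close> and \<open>e d\<close> do not depend on the mesh, so one interval of
  initial values serves all meshes and Helly's theorem applies to the monotone step functions.

  For the test functions the obstacle is that both the weight and \<open>v\<close> may be unbounded.
  Since \<open>a\<close> increases, it is bounded near the origin, and so it is integrable on (0,1)
  even without the factor \<open>r^n\<close>. On a ray the mass of the weight below \<open>l\<close>
  is then O(\<open>l^n\<close>), which is exactly what can be integrated against the derivative of
  \<open>v\<close>, for which only \<open>l^n |h|\<close> is known to be integrable. No trace on the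
  sphere enters: \<open>w(1) = 0\<close> says that \<open>u^(p-1) - a f(u)\<close> has mean zero
  with respect to \<open>r^n dr\<close>, and this removes both the reference value of
  \<open>v\<close> and the boundary term on every ray.\<close>

abbreviation cell :: "nat \<Rightarrow> nat \<Rightarrow> real set" where
  "cell m j \<equiv> {real j / real m..<real (Suc j) / real m}"

abbreviation cell_index :: "nat \<Rightarrow> real \<Rightarrow> nat" where
  "cell_index m s \<equiv> nat \<lfloor>real m * s\<rfloor>"

lemma cell_index_eq:
  fixes m j :: nat and s :: real
  assumes "m > 0" "s \<in> cell m j"
  shows "cell_index m s = j"
proof -
  have "real j \<le> m * s" "m * s < real j + 1"
    using assms by (auto simp: field_simps)
  then have "\<lfloor>real m * s\<rfloor> = int j" by linarith
  then show ?thesis by simp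
qed

lemma measurable_cell_index [measurable]:
  fixes c :: "nat \<Rightarrow> real" and m :: nat
  shows "(\<lambda>s::real. c (cell_index m s)) \<in> borel_measurable borel"
proof -
  have "(\<lambda>s. cell_index m s) \<in> measurable borel (count_space UNIV)"
    by measurable
  then show ?thesis by measurable
qed

text \<open>Bridge between the recursion and the limit: the sums produced by the Euler scheme become
  integrals of step functions against \<open>\<beta>\<close>, to which dominated convergence
  applies.\<close>

lemma step_integral:
  fixes \<beta> :: "real \<Rightarrow> real" and c :: "nat \<Rightarrow> real" and m k :: nat
  assumes m: "m > 0" and \<beta>: "\<And>r. set_integrable lborel {0..<r} \<beta>"
  shows "set_integrable lborel {0..<real k / real m} (\<lambda>s. c (cell_index m s) * \<beta> s)
    \<and> (LBINT s:{0..<real k / real m}. c (cell_index m s) * \<beta> s)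
       = (\<Sum>j<k. c j * (LBINT s:cell m j. \<beta> s))"
proof (induction k)
  case 0
  then show ?case by (simp add: set_integrable_def set_lebesgue_integral_def)
next
  case (Suc k)
  let ?C = "cell m k"
  have le: "real k / m \<le> real (Suc k) / m" by (simp add: divide_right_mono)
  have un: "{0..<real (Suc k) / m} = {0..<real k / real m} \<union> ?C"
    using le by (intro ivl_disj_un_two(3)[symmetric]) auto
  have \<beta>C: "set_integrable lborel ?C \<beta>"
    by (rule set_integrable_subset[OF \<beta>[of "real (Suc k) / m"]])
       (auto intro: order_trans[of 0 "real k / m"])
  have cong: "(\<lambda>s. indicator ?C s *\<^sub>R (c (cell_index m s) * \<beta> s)) = (\<lambda>s. c k * (indicator ?C s *\<^sub>R \<beta> s))"
    using cell_index_eq[OF m, of _ k] by (auto simp: indicator_def)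
  have iC: "set_integrable lborel ?C (\<lambda>s. c (cell_index m s) * \<beta> s)"
    unfolding set_integrable_def cong
    by (rule integrable_mult_right) (use \<beta>C in \<open>simp add: set_integrable_def\<close>)
  have vC: "(LBINT s:?C. c (cell_index m s) * \<beta> s) = c k * (LBINT s:?C. \<beta> s)"
    unfolding set_lebesgue_integral_def cong by (rule integral_mult_right_zero)
  show ?case
    unfolding un
    by (subst set_integral_Un) (use Suc iC vC in \<open>auto intro!: set_integrable_Un\<close>)
qed

lemma set_integral_mono_set:
  fixes f :: "real \<Rightarrow> real"
  assumes "set_integrable lborel B f" "A \<in> sets borel" "A \<subseteq> B" "\<And>x. x \<in> B \<Longrightarrow> 0 \<le> f x"
  shows "(LBINT x:A. f x) \<le> (LBINT x:B. f x)"
  using assms set_integrable_subset[OF assms(1), of A] unfolding set_lebesgue_integral_def set_integrable_def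
  by (intro integral_mono) (auto split: split_indicator)

lemma continuous_on_indefinite:
  fixes h :: "real \<Rightarrow> real"
  assumes h: "integrable lborel h"
  shows "continuous_on UNIV (\<lambda>s. LBINT t:{0..<s}. h t)"
  unfolding continuous_on_sequentially
proof (intro allI impI ballI, clarify)
  fix x :: "nat \<Rightarrow> real" and a assume x: "x \<longlonglongrightarrow> a"
  show "((\<lambda>s. LBINT t:{0..<s}. h t) \<circ> x) \<longlonglongrightarrow> (LBINT t:{0..<a}. h t)"
    unfolding set_lebesgue_integral_def comp_def
  proof (rule integral_dominated_convergence[where w="\<lambda>t. \<bar>h t\<bar>"])
    \<comment> \<open>Off the single point \<open>t = a\<close> the indicators are eventually
      constant in \<open>i\<close>.\<close>
    show "AE t in lborel. (\<lambda>i. indicator {0..<x i} t *\<^sub>R h t) \<longlonglongrightarrow> indicator {0..<a} t *\<^sub>R h t"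
      using AE_lborel_singleton[of a]
    proof eventually_elim
      case (elim t)
      then consider "t < a" | "a < t" by fastforce
      then have "\<forall>\<^sub>F i in sequentially. indicator {0..<x i} t *\<^sub>R h t = indicator {0..<a} t *\<^sub>R h t"
      proof cases
        case 1
        from order_tendstoD(1)[OF x 1] show ?thesis
          by eventually_elim (use 1 in \<open>auto simp: indicator_def\<close>)
      next
        case 2
        from order_tendstoD(2)[OF x 2] show ?thesis
          by eventually_elim (use 2 in \<open>auto simp: indicator_def\<close>)
      qed
      then show ?case by (rule tendsto_eventually)
    qed
  qed (use h in \<open>auto simp: indicator_def\<close>)
qed

text \<open>At \<open>s = 0\<close> only nonnegativity is asked, because integrands with the factor
  \<open>s ^ n\<close> may vanish there.\<close>

lemma set_integral_pos_unit:
  fixes h :: "real \<Rightarrow> real"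
  assumes int: "set_integrable lborel {0..<1} h" and pos: "\<And>s. 0 < s \<Longrightarrow> s < 1 \<Longrightarrow> 0 < h s"
    and nonneg: "\<And>s. 0 \<le> s \<Longrightarrow> s < 1 \<Longrightarrow> 0 \<le> h s"
  shows "0 < (LBINT s:{0..<1}. h s)"
proof -
  have nn: "AE s in lborel. 0 \<le> indicator {0..<1} s *\<^sub>R h s"
    using nonneg by (intro AE_I2) (simp add: indicator_def)
  have "(LBINT s:{0..<1}. h s) \<noteq> 0"
  proof
    assume "(LBINT s:{0..<1}. h s) = 0"
    then have "AE s in lborel. indicator {0..<1} s *\<^sub>R h s = 0"
      using integral_nonneg_eq_0_iff_AE[OF _ nn] int
      unfolding set_lebesgue_integral_def set_integrable_def by blast
    then have "AE s in lborel. s \<notin> {0<..<1::real}"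
    proof eventually_elim
      case (elim s)
      then show ?case using pos[of s] by (cases "0 < s \<and> s < 1") (simp_all add: indicator_def)
    qed
    then have "{0<..<1::real} \<in> null_sets lborel"
      using AE_iff_null_sets[of "{0<..<1::real}" lborel] by simp
    then show False by (simp add: null_sets_def)
  qed
  moreover have "0 \<le> (LBINT s:{0..<1}. h s)"
    unfolding set_lebesgue_integral_def by (rule integral_nonneg_AE[OF nn])
  ultimately show ?thesis by simp
qed

section \<open>Data of the radial problem; the Euler scheme and its mesh-independent bounds\<close>

locale radial_data =
  fixes p :: real and n :: nat and \<alpha> f :: "real \<Rightarrow> real"
  assumes p1: "1 < p"
    and \<alpha>_int: "integrable lborel \<alpha>"
    and \<alpha>_out: "\<And>s. s \<notin> {0<..<1} \<Longrightarrow> \<alpha> s = 0"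
    and \<alpha>_pos: "\<And>s. s \<in> {0<..<1} \<Longrightarrow> 0 < \<alpha> s"
    and \<alpha>_mono: "mono_on {0<..<1} \<alpha>"
    and f_cont: "continuous_on {0<..} f"
    and f_pos: "\<And>t. t > 0 \<Longrightarrow> 0 < f t"
    and g_mono: "\<And>s t. 0 < s \<Longrightarrow> s \<le> t \<Longrightarrow> f s / s powr (p - 1) \<le> f t / t powr (p - 1)"
    and g_small: "((\<lambda>t. f t / t powr (p - 1)) \<longlongrightarrow> 0) (at_right 0)"
    and g_large: "filterlim (\<lambda>t. f t / t powr (p - 1)) at_top at_top"
begin

lemma \<alpha>_meas [measurable]: "\<alpha> \<in> borel_measurable borel"
  using \<alpha>_int by auto

lemma \<alpha>_nonneg: "0 \<le> \<alpha> s"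
  using \<alpha>_pos[of s] \<alpha>_out[of s] by (cases "s \<in> {0<..<1}") auto

lemma f_mono: "0 < s \<Longrightarrow> s \<le> t \<Longrightarrow> f s \<le> f t"
proof -
  assume st: "0 < s" "s \<le> t"
  have "f s = (f s / s powr (p - 1)) * s powr (p - 1)" using st by simp
  also have "\<dots> \<le> (f t / t powr (p - 1)) * t powr (p - 1)"
    using st p1 f_pos[of t] g_mono[OF st] by (intro mult_mono powr_mono2) auto
  finally show ?thesis using st by simp
qed

lemma pow_int: "set_integrable lborel {0..<r} (\<lambda>s. s ^ n)" for r :: real
proof -
  have "set_integrable lborel {0..r} (\<lambda>s. s ^ n)"
    by (intro borel_integrable_atLeastAtMost' continuous_intros)
  then show ?thesis by (rule set_integrable_subset) auto
qed

lemma \<alpha>_pow_int: "integrable lborel (\<lambda>s. s ^ n * \<alpha> s)"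
proof (rule Bochner_Integration.integrable_bound[OF \<alpha>_int])
  show "AE s in lborel. norm (s ^ n * \<alpha> s) \<le> norm (\<alpha> s)"
  proof (intro AE_I2)
    fix s :: real
    show "norm (s ^ n * \<alpha> s) \<le> norm (\<alpha> s)"
    proof (cases "s \<in> {0<..<1}")
      case True
      then show ?thesis using power_le_one[of s n]
        by (auto simp: abs_mult intro!: mult_left_le_one_le)
    qed (simp add: \<alpha>_out)
  qed
qed measurable

lemma \<alpha>_pow_set_int: "A \<in> sets borel \<Longrightarrow> set_integrable lborel A (\<lambda>s. s ^ n * \<alpha> s)"
  unfolding set_integrable_def by (rule integrable_mult_indicator[OF _ \<alpha>_pow_int]) auto

text \<open>Euler scheme with step \<open>1/m\<close> for \<open>u' = (max 0 w / r^n)^(1/(p-1))\<close>,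
  \<open>w' = r^n (u^(p-1) - \<alpha> f(u))\<close>, \<open>u(0) = d\<close>, \<open>w(0) = 0\<close>. At \<open>r = 0\<close> the slope is 0, also for \<open>n > 0\<close>, where
  it is the junk value of \<open>0/0\<close>.\<close>

primrec eul :: "real \<Rightarrow> nat \<Rightarrow> nat \<Rightarrow> real \<times> real" where
  "eul d m 0 = (d, 0)"
| "eul d m (Suc k) =
    (fst (eul d m k) + (max 0 (snd (eul d m k)) / (real k / real m) ^ n) powr (1 / (p - 1)) / m,
     snd (eul d m k)
       + (fst (eul d m k) powr (p - 1) * (LBINT s:cell m k. s ^ n)
          - f (fst (eul d m k)) * (LBINT s:cell m k. s ^ n * \<alpha> s)))"

abbreviation "eu d m k \<equiv> fst (eul d m k)"
abbreviation "ew d m k \<equiv> snd (eul d m k)"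
abbreviation "sl d m k \<equiv> (max 0 (ew d m k) / (real k / real m) ^ n) powr (1 / (p - 1))"

lemma eu_mono: "j \<le> k \<Longrightarrow> eu d m j \<le> eu d m k"
  by (induction k) (auto simp: le_Suc_eq add_increasing2)

lemma eu_ge: "d \<le> eu d m k"
  using eu_mono[of 0 k d m] by simp

lemma eul_continuous: "continuous_on {0<..} (\<lambda>d. eu d m k) \<and> continuous_on {0<..} (\<lambda>d. ew d m k)"
proof (induction k)
  case 0
  then show ?case by (simp add: continuous_on_id)
next
  case (Suc k)
  have pos: "0 < eu d m k" if "0 < d" for d
    using eu_ge[of d m k] that by linarith
  have f: "continuous_on {0<..} (\<lambda>d. f (eu d m k))"
    by (rule continuous_on_compose2[OF f_cont]) (use Suc pos in auto)
  have u: "continuous_on {0<..} (\<lambda>d. eu d m k)" and w: "continuous_on {0<..} (\<lambda>d. ew d m k)"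
    using Suc by auto
  \<comment> \<open>The divisor does not depend on \<open>d\<close>, so the quotient is a multiple
    of a continuous function even at the first node, where the constant may be
    \<open>inverse 0 = 0\<close>.\<close>
  have q: "continuous_on {0<..} (\<lambda>d. max 0 (ew d m k) * inverse ((real k / real m) ^ n))"
    by (intro continuous_intros w)
  have "continuous_on {0<..} (\<lambda>d. sl d m k)"
    unfolding divide_inverse[of "max 0 _"]
    by (rule continuous_on_powr'[OF q continuous_on_const]) (use p1 in auto)
  moreover have "continuous_on {0<..} (\<lambda>d. eu d m k powr (p - 1))"
    by (rule continuous_on_powr'[OF u continuous_on_const]) (use pos p1 in \<open>auto intro: less_imp_le\<close>)
  ultimately show ?case
    using u w f by (auto intro!: continuous_intros simp del: of_nat_Suc simp: divide_inverse[of _ "real m"])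
qed

lemma eu_sum: "eu d m k = d + (\<Sum>j<k. sl d m j * (1 / m))"
  by (induction k) auto

lemma ew_sum: "ew d m k = (\<Sum>j<k. eu d m j powr (p - 1) * (LBINT s:cell m j. s ^ n))
     - (\<Sum>j<k. f (eu d m j) * (LBINT s:cell m j. s ^ n * \<alpha> s))"
  by (induction k) auto

lemma const_int: "set_integrable lborel {0..<r} (\<lambda>s. 1::real)" for r :: real
proof -
  have "set_integrable lborel {0..r} (\<lambda>s. 1::real)"
    by (intro borel_integrable_atLeastAtMost' continuous_intros)
  then show ?thesis by (rule set_integrable_subset) auto
qed

lemma eu_integral:
  assumes "m > 0"
  shows "eu d m k = d + (LBINT s:{0..<real k / real m}. sl d m (cell_index m s))"
proof -
  have c: "(LBINT s:cell m j. 1::real) = 1 / m" for j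
    using assms by (simp add: set_lebesgue_integral_def field_simps del: of_nat_Suc)
  show ?thesis
    using step_integral[where \<beta>="\<lambda>s. 1", OF assms const_int, of k "sl d m"] by (simp only: c mult_1_right eu_sum)
qed

lemma pow_cell_nonneg: "0 \<le> (LBINT s:cell m j. s ^ n)"
  unfolding set_lebesgue_integral_def
  by (rule integral_nonneg_AE) (auto simp: indicator_def intro!: AE_I2 zero_le_power intro: order_trans[of 0 "real j / m"])

lemma \<alpha>_cell_nonneg: "0 \<le> (LBINT s:cell m j. s ^ n * \<alpha> s)"
  unfolding set_lebesgue_integral_def
  by (rule integral_nonneg_AE) (auto simp: indicator_def intro!: AE_I2 mult_nonneg_nonneg zero_le_power \<alpha>_nonneg intro: order_trans[of 0 "real j / m"])

lemma ew_integral: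
  assumes m: "m > 0"
  shows "set_integrable lborel {0..<real k / real m} (\<lambda>s. s ^ n * (eu d m (cell_index m s) powr (p - 1) - \<alpha> s * f (eu d m (cell_index m s))))"
   "ew d m k = (LBINT s:{0..<real k / real m}. s ^ n * (eu d m (cell_index m s) powr (p - 1) - \<alpha> s * f (eu d m (cell_index m s))))"
proof -
  have eq: "s ^ n * (eu d m (cell_index m s) powr (p - 1) - \<alpha> s * f (eu d m (cell_index m s)))
      = eu d m (cell_index m s) powr (p - 1) * s ^ n - f (eu d m (cell_index m s)) * (s ^ n * \<alpha> s)" for s
    by (simp add: algebra_simps)
  note a = step_integral[where \<beta>="\<lambda>s. s ^ n", OF m pow_int, of k "\<lambda>j. eu d m j powr (p - 1)"]
  have b0: "set_integrable lborel {0..<r} (\<lambda>s. s ^ n * \<alpha> s)" for r by (rule \<alpha>_pow_set_int) simp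
  note b = step_integral[where \<beta>="\<lambda>s. s ^ n * \<alpha> s", OF m b0, of k "\<lambda>j. f (eu d m j)"]
  show "set_integrable lborel {0..<real k / real m} (\<lambda>s. s ^ n * (eu d m (cell_index m s) powr (p - 1) - \<alpha> s * f (eu d m (cell_index m s))))"
    unfolding eq using a b by (intro set_integral_diff) auto
  show "ew d m k = (LBINT s:{0..<real k / real m}. s ^ n * (eu d m (cell_index m s) powr (p - 1) - \<alpha> s * f (eu d m (cell_index m s))))"
    unfolding eq ew_sum using a b by (subst set_integral_diff) auto
qed

lemma pow_sum:
  assumes "m > 0"
  shows "(\<Sum>j<k. LBINT s:cell m j. s ^ n) = (LBINT s:{0..<real k / real m}. s ^ n)"
  using step_integral[where \<beta>="\<lambda>s. s ^ n", OF assms pow_int, of k "\<lambda>_. 1"] by simp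

lemma \<alpha>_sum:
  assumes "m > 0"
  shows "(\<Sum>j<k. LBINT s:cell m j. s ^ n * \<alpha> s) = (LBINT s:{0..<real k / real m}. s ^ n * \<alpha> s)"
proof -
  have b0: "set_integrable lborel {0..<r} (\<lambda>s. s ^ n * \<alpha> s)" for r by (rule \<alpha>_pow_set_int) simp
  show ?thesis using step_integral[where \<beta>="\<lambda>s. s ^ n * \<alpha> s", OF assms b0, of k "\<lambda>_. 1"] by simp
qed

lemma pow_integral_le_Suc:
  fixes r :: real
  assumes "0 \<le> r"
  shows "(LBINT s:{0..<r}. s ^ n) \<le> r ^ Suc n"
proof -
  have "(LBINT s:{0..<r}. s ^ n) \<le> (LBINT s:{0..<r}. r ^ n)"
  proof (rule set_integral_mono[OF pow_int])
    show "set_integrable lborel {0..<r} (\<lambda>s. r ^ n)"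
      using set_integrable_mult_right[of "r ^ n", OF const_int[of r]] by simp
    show "s ^ n \<le> r ^ n" if "s \<in> {0..<r}" for s
      using that by (intro power_mono) auto
  qed
  also have "\<dots> = r ^ Suc n" using assms by (simp add: set_lebesgue_integral_def)
  finally show ?thesis .
qed

lemma pow_integral_le:
  fixes r :: real
  assumes "0 \<le> r" "r \<le> 1"
  shows "(LBINT s:{0..<r}. s ^ n) \<le> r ^ n"
proof -
  have "r ^ Suc n \<le> r ^ n" using assms by (simp add: mult_left_le_one_le)
  with pow_integral_le_Suc[OF assms(1)] show ?thesis by linarith
qed

text \<open>The term with \<open>\<alpha>\<close> is dropped and \<open>u\<close> is replaced by its
  last value, which is its largest. The power \<open>n\<close> instead of \<open>n + 1\<close> is
  enough to bound the slope by \<open>u\<close>.\<close>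

lemma ew_le:
  assumes m: "m > 0" and k: "k \<le> m" and d: "d > 0"
  shows "ew d m k \<le> (real k / real m) ^ n * eu d m k powr (p - 1)"
proof -
  have pos: "0 < eu d m j" for j using eu_ge[of d m j] d by linarith
  have "ew d m k \<le> (\<Sum>j<k. eu d m j powr (p - 1) * (LBINT s:cell m j. s ^ n))"
    unfolding ew_sum using f_pos[OF pos] \<alpha>_cell_nonneg
    by (simp add: sum_nonneg less_imp_le del: of_nat_Suc)
  also have "\<dots> \<le> (\<Sum>j<k. eu d m k powr (p - 1) * (LBINT s:cell m j. s ^ n))"
    using pos p1 by (intro sum_mono mult_right_mono powr_mono2 eu_mono pow_cell_nonneg) (auto intro: less_imp_le)
  also have "\<dots> = eu d m k powr (p - 1) * (LBINT s:{0..<real k / real m}. s ^ n)"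
    using pow_sum[OF m, of k] by (simp add: sum_distrib_left[symmetric] del: of_nat_Suc)
  also have "\<dots> \<le> eu d m k powr (p - 1) * (real k / real m) ^ n"
    using m k by (intro mult_left_mono pow_integral_le) auto
  finally show ?thesis by (simp add: mult.commute)
qed

text \<open>The discrete form of \<open>u' \<le> u\<close>: the exponents \<open>p - 1\<close> and
  \<open>1 / (p - 1)\<close> cancel after division by \<open>r^n\<close>. This is the source of the
  factor \<open>exp 1\<close>.\<close>

lemma sl_le:
  assumes m: "m > 0" and k: "k \<le> m" and d: "d > 0"
  shows "sl d m k \<le> eu d m k"
proof -
  have pos: "0 < eu d m k" using eu_ge[of d m k] d by linarith
  define R where "R = (real k / real m) ^ n"
  have R: "R \<ge> 0" unfolding R_def by simp
  show ?thesis
  proof (cases "R = 0")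
    case True
    then show ?thesis using pos unfolding R_def[symmetric] by simp
  next
    case False
    then have R: "R > 0" using R by linarith
    have "max 0 (ew d m k) / R \<le> eu d m k powr (p - 1)"
      using ew_le[OF m k d] R pos unfolding R_def[symmetric] by (simp add: pos_divide_le_eq mult.commute)
    then have "(max 0 (ew d m k) / R) powr (1 / (p - 1)) \<le> (eu d m k powr (p - 1)) powr (1 / (p - 1))"
      using R p1 by (intro powr_mono2) simp_all
    also have "\<dots> = eu d m k" using p1 pos by (simp add: powr_powr)
    finally show ?thesis unfolding R_def .
  qed
qed

text \<open>Discrete Gronwall inequality: each step multiplies by at most \<open>1 + 1 / m\<close>,
  and \<open>(1 + 1 / m) ^ m \<le> exp 1\<close> for every mesh.\<close>

lemma eu_le:
  assumes m: "m > 0" and k: "k \<le> m" and d: "d > 0"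
  shows "eu d m k \<le> exp 1 * d"
proof -
  have "eu d m k \<le> (1 + 1 / m) ^ k * d" using k
  proof (induction k)
    case (Suc k)
    have "eu d m (Suc k) \<le> (1 + 1 / m) * eu d m k"
      using sl_le[OF m _ d, of k] Suc m by (simp add: field_simps)
    also have "\<dots> \<le> (1 + 1 / m) * ((1 + 1 / m) ^ k * d)"
      using Suc by (intro mult_left_mono) auto
    finally show ?case by simp
  qed simp
  also have "(1 + 1 / m) ^ k \<le> (1 + 1 / m) ^ m"
    using k by (intro power_increasing) auto
  also have "\<dots> \<le> exp (1 / m) ^ m"
    by (intro power_mono exp_ge_add_one_self) auto
  also have "\<dots> = exp 1" using m by (simp flip: exp_of_nat_mult)
  finally show ?thesis using d by simp
qed

section \<open>Shooting in the initial value\<close>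

definition "\<alpha>_mass = (LBINT s:{0..<1}. s ^ n * \<alpha> s)"
definition "pow_mass = (LBINT s:{0..<1::real}. s ^ n)"

lemma \<alpha>_mass_pos: "\<alpha>_mass > 0"
  unfolding \<alpha>_mass_def by (rule set_integral_pos_unit[OF \<alpha>_pow_set_int]) (auto intro!: mult_pos_pos \<alpha>_pos mult_nonneg_nonneg \<alpha>_nonneg)

lemma pow_mass_pos: "pow_mass > 0"
  unfolding pow_mass_def by (rule set_integral_pos_unit[OF pow_int]) auto

text \<open>All values of the scheme lie between \<open>d\<close> and \<open>exp 1 * d\<close>;
  inserting these in \<open>ew_sum\<close> gives bounds free of \<open>m\<close>, so that one
  bracket of initial values works for all meshes.\<close>

lemma shoot_bounds:
  assumes m: "m > 0" and d: "d > 0"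
  shows "d powr (p - 1) * pow_mass - f (exp 1 * d) * \<alpha>_mass \<le> ew d m m"
    and "ew d m m \<le> (exp 1 * d) powr (p - 1) * pow_mass - f d * \<alpha>_mass"
proof -
  have pos: "0 < eu d m j" for j using eu_ge[of d m j] d by linarith
  have B: "(\<Sum>j<m. c * (LBINT s:cell m j. s ^ n)) = c * pow_mass" for c
    using pow_sum[OF m, of m] m by (simp add: sum_distrib_left[symmetric] pow_mass_def del: of_nat_Suc)
  have A: "(\<Sum>j<m. c * (LBINT s:cell m j. s ^ n * \<alpha> s)) = c * \<alpha>_mass" for c
    using \<alpha>_sum[OF m, of m] m by (simp add: sum_distrib_left[symmetric] \<alpha>_mass_def del: of_nat_Suc)
  show "d powr (p - 1) * pow_mass - f (exp 1 * d) * \<alpha>_mass \<le> ew d m m"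
    unfolding ew_sum A[symmetric] B[symmetric] using d p1
    by (intro diff_mono sum_mono mult_right_mono powr_mono2 pow_cell_nonneg \<alpha>_cell_nonneg f_mono eu_ge eu_le m pos) auto
  show "ew d m m \<le> (exp 1 * d) powr (p - 1) * pow_mass - f d * \<alpha>_mass"
    unfolding ew_sum A[symmetric] B[symmetric] using d p1
    by (intro diff_mono sum_mono mult_right_mono powr_mono2 pow_cell_nonneg \<alpha>_cell_nonneg f_mono eu_ge eu_le m pos less_imp_le[OF pos]) auto
qed

lemma shooting:
  obtains d0 d1 where "0 < d0" "d0 \<le> d1" "\<And>m. m > 0 \<Longrightarrow> \<exists>d\<in>{d0..d1}. ew d m m = 0"
proof -
  have e: "exp (1::real) > 0" by simp
  have "\<forall>\<^sub>F t in at_right 0. f t / t powr (p - 1) < pow_mass / (\<alpha>_mass * exp 1 powr (p - 1))"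
    by (rule order_tendstoD(2)[OF g_small]) (use \<alpha>_mass_pos pow_mass_pos in auto)
  then obtain b where b: "b > 0" "\<And>t. 0 < t \<Longrightarrow> t < b \<Longrightarrow> f t / t powr (p - 1) < pow_mass / (\<alpha>_mass * exp 1 powr (p - 1))"
    by (auto simp: eventually_at_right_field)
  \<comment> \<open>The threshold in \<open>b\<close> is the positivity of the lower bound in
    \<open>shoot_bounds\<close>, solved for the quotient of \<open>f\<close> at
    \<open>exp 1 * d\<close>; the factor \<open>2 * exp 1\<close> keeps \<open>exp 1 * d0\<close>
    below \<open>b\<close>. The threshold for \<open>c\<close> comes in the same way from the upper
    bound, where the quotient is taken at \<open>d\<close> itself.\<close>
  define d0 where "d0 = b / (2 * exp 1)"
  have d0: "d0 > 0" "exp 1 * d0 < b" using b by (auto simp: d0_def)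
  have "\<forall>\<^sub>F t in at_top. exp 1 powr (p - 1) * pow_mass / \<alpha>_mass \<le> f t / t powr (p - 1)"
    using g_large by (auto simp: filterlim_at_top)
  then obtain c where c: "\<And>t. t \<ge> c \<Longrightarrow> exp 1 powr (p - 1) * pow_mass / \<alpha>_mass \<le> f t / t powr (p - 1)"
    by (auto simp: eventually_at_top_linorder)
  define d1 where "d1 = max c d0"
  have d1: "d1 \<ge> d0" "d1 > 0" using d0 by (auto simp: d1_def)
  have "f (exp 1 * d0) / (exp 1 * d0) powr (p - 1) < pow_mass / (\<alpha>_mass * exp 1 powr (p - 1))"
    using b(2)[of "exp 1 * d0"] d0 by simp
  then have lo: "0 < d0 powr (p - 1) * pow_mass - f (exp 1 * d0) * \<alpha>_mass"
    using \<alpha>_mass_pos pow_mass_pos d0 by (simp add: powr_mult field_simps)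
  have "exp 1 powr (p - 1) * pow_mass / \<alpha>_mass \<le> f d1 / d1 powr (p - 1)" by (rule c) (simp add: d1_def)
  then have hi: "(exp 1 * d1) powr (p - 1) * pow_mass - f d1 * \<alpha>_mass \<le> 0"
    using \<alpha>_mass_pos pow_mass_pos d1 by (simp add: powr_mult field_simps)
  have "\<exists>d\<in>{d0..d1}. ew d m m = 0" if m: "m > 0" for m
  proof -
    have "\<exists>x\<ge>d0. x \<le> d1 \<and> ew x m m = 0"
    proof (rule IVT2')
      show "ew d1 m m \<le> 0" using shoot_bounds(2)[OF m d1(2)] hi by linarith
      show "0 \<le> ew d0 m m" using shoot_bounds(1)[OF m d0(1)] lo by linarith
      show "d0 \<le> d1" by (rule d1)
      show "continuous_on {d0..d1} (\<lambda>d. ew d m m)"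
        using eul_continuous[of m m] d0 by (auto elim: continuous_on_subset)
    qed
    then show ?thesis by auto
  qed
  then show thesis using that d0 d1 by blast
qed


text \<open>The two integral equations are the radial equation in integrated form, already without
  the positive part. The bound \<open>C * r ^ Suc n\<close> makes \<open>w r / r ^ n\<close> vanish
  at the origin, so that the radial function is differentiable there.\<close>

lemma radial_profile:
  obtains u w :: "real \<Rightarrow> real" and C :: real where
    "\<And>r. r \<in> {0..1} \<Longrightarrow> 0 < u r" "mono_on {0..1} u" "continuous_on UNIV u"
    "\<And>r. r \<in> {0..1} \<Longrightarrow> w r = (LBINT s:{0..<r}. s ^ n * (u s powr (p - 1) - \<alpha> s * f (u s)))"
    "w 1 = 0" "continuous_on UNIV w"
    "\<And>r. r \<in> {0..1} \<Longrightarrow> 0 \<le> w r" "\<And>r. r \<in> {0..1} \<Longrightarrow> w r \<le> C * r ^ Suc n"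
    "\<And>r. r \<in> {0..1} \<Longrightarrow> u r = u 0 + (LBINT s:{0..<r}. (w s / s ^ n) powr (1 / (p - 1)))"
proof -
  obtain d0 d1 where d01: "0 < d0" "d0 \<le> d1" and ex: "\<And>m. m > 0 \<Longrightarrow> \<exists>d\<in>{d0..d1}. ew d m m = 0"
    using shooting by blast
  \<comment> \<open>The shift to \<open>Suc m\<close> keeps the number of cells positive.\<close>
  define D where "D m = (SOME d. d \<in> {d0..d1} \<and> ew d (Suc m) (Suc m) = 0)" for m
  have "\<exists>d. d \<in> {d0..d1} \<and> ew d (Suc m) (Suc m) = 0" for m
    using ex[of "Suc m"] by blast
  from someI_ex[OF this] have D: "D m \<in> {d0..d1}" "ew (D m) (Suc m) (Suc m) = 0" for m
    unfolding D_def by blast+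
  have Dpos: "D m > 0" for m using D(1)[of m] d01 by auto
  define ME where "ME = exp 1 * d1"
  have bnd: "eu (D m) (Suc m) k \<in> {d0..ME}" if "k \<le> Suc m" for m k
  proof -
    have "exp 1 * D m \<le> ME" unfolding ME_def using D(1)[of m] by (intro mult_left_mono) auto
    then show ?thesis
      using eu_le[OF _ that Dpos[of m]] eu_ge[of "D m" "Suc m" k] D(1)[of m] by auto
  qed
  have ME: "ME > 0" using d01 by (simp add: ME_def)
  \<comment> \<open>Helly's theorem needs bounded monotone functions on the whole line: the cap by
    \<open>Suc m\<close> freezes the scheme to the right of 1, and \<open>nat\<close> freezes it at
    the initial value to the left of 0.\<close>
  define S where "S m s = eu (D m) (Suc m) (min (cell_index (Suc m) s) (Suc m))" for m and s :: real
  have Sb: "S m s \<in> {d0..ME}" for m s unfolding S_def by (intro bnd) auto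
  have "\<exists>r. strict_mono (r::nat \<Rightarrow> nat) \<and> (\<exists>F. (\<forall>x. continuous (at_right x) F) \<and> mono F \<and> (\<forall>x. \<bar>F x\<bar> \<le> ME) \<and>
    (\<forall>x. continuous (at x) F \<longrightarrow> (\<lambda>n. S (r n) x) \<longlonglongrightarrow> F x))"
  proof (rule Helly_selection)
    show "\<bar>S m x\<bar> \<le> ME" for m x using Sb[of m x] d01 by auto
    show "mono (S m)" for m
      unfolding S_def
    proof (intro monoI eu_mono min.mono order_refl nat_mono floor_mono)
      fix x y :: real assume "x \<le> y"
      then show "real (Suc m) * x \<le> real (Suc m) * y" by (intro mult_left_mono) auto
    qed
    show "continuous (at_right x) (S m)" for m x
    proof -
      \<comment> \<open>The next grid point to the right of \<open>x\<close>. Cells are half-open,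
        so \<open>S m\<close> is constant from \<open>x\<close> up to \<open>b\<close>; this is the
        right continuity that Helly's theorem asks for.\<close>
      define b where "b = (of_int \<lfloor>real (Suc m) * x\<rfloor> + 1) / real (Suc m)"
      have "x < b" unfolding b_def by (simp add: field_simps del: of_nat_Suc) linarith
      have "S m y = S m x" if "x < y" "y < b" for y
      proof -
        have "real (Suc m) * x < real (Suc m) * y" using that by simp
        moreover have "real (Suc m) * y < of_int \<lfloor>real (Suc m) * x\<rfloor> + 1"
          using that unfolding b_def by (simp add: field_simps del: of_nat_Suc)
        ultimately have "\<lfloor>real (Suc m) * y\<rfloor> = \<lfloor>real (Suc m) * x\<rfloor>" by linarith
        then show ?thesis unfolding S_def by simp
      qed
      then have "\<forall>\<^sub>F y in at_right x. S m y = S m x"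
        unfolding eventually_at_right_field using \<open>x < b\<close> by blast
      then show ?thesis unfolding continuous_within by (rule tendsto_eventually)
    qed
  qed
  then obtain r F where r: "strict_mono (r::nat \<Rightarrow> nat)" and F: "mono F" "\<And>x. isCont F x \<Longrightarrow> (\<lambda>n. S (r n) x) \<longlonglongrightarrow> F x"
    by auto
  \<comment> \<open>Helly's theorem gives convergence only at continuity points of \<open>F\<close>.
    The exceptional set is countable, hence null, and the integrals below do not see it.\<close>
  define X where "X = {x. \<not> isCont F x}"
  have X: "countable X" unfolding X_def by (rule mono_ctble_discont[OF F(1)])
  have [measurable]: "F \<in> borel_measurable borel" by (rule borel_measurable_mono[OF F(1)])
  define K where "K m = Suc (r m)" for m
  define d where "d m = D (r m)" for m
  have K0: "K m > 0" for m by (simp add: K_def)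
  have Kinf: "filterlim (\<lambda>m. real (K m)) at_top sequentially"
  proof (rule filterlim_at_top_mono[OF filterlim_real_sequentially])
    show "\<forall>\<^sub>F m in sequentially. real m \<le> real (K m)"
      by (intro always_eventually allI) (simp only: K_def of_nat_le_iff le_SucI strict_mono_imp_increasing[OF r])
  qed
  define U where "U m s = eu (d m) (K m) (cell_index (K m) s)" for m and s :: real
  define W where "W m s = ew (d m) (K m) (cell_index (K m) s)" for m and s :: real
  define sg where "sg m s = sl (d m) (K m) (cell_index (K m) s)" for m and s :: real
  have jle: "cell_index (K m) s \<le> K m" if "s \<le> 1" for m and s :: real
  proof -
    have "real (K m) * s \<le> real (K m) * 1" using that by (intro mult_left_mono) auto
    then have "\<lfloor>real (K m) * s\<rfloor> \<le> int (K m)" by linarith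
    then show ?thesis by linarith
  qed
  have US: "U m s = S (r m) s" if "s \<le> 1" for m s
    using jle[OF that, of m] unfolding U_def S_def K_def d_def by (simp add: min_def)
  have Ub: "U m s \<in> {d0..ME}" if "s \<le> 1" for m s
    unfolding US[OF that] by (rule Sb)
  have [measurable]: "U m \<in> borel_measurable borel" "W m \<in> borel_measurable borel" "sg m \<in> borel_measurable borel" for m
    unfolding U_def W_def sg_def
    using measurable_cell_index[of "\<lambda>j. eu (d m) (K m) j" "K m"] measurable_cell_index[of "\<lambda>j. ew (d m) (K m) j" "K m"]
      measurable_cell_index[of "\<lambda>j. sl (d m) (K m) j" "K m"] by auto
  have UF: "(\<lambda>m. U m s) \<longlonglongrightarrow> F s" if "s \<le> 1" "s \<notin> X" for s
  proof -
    have "isCont F s" using that(2) by (simp add: X_def)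
    from F(2)[OF this] show ?thesis by (simp only: US[OF that(1)])
  qed
  have Fb: "F s \<in> {d0..ME}" if "s \<le> 1" "s \<notin> X" for s
    by (rule closed_sequentially[OF closed_real_atLeastAtMost Ub[OF that(1)] UF[OF that]])
  \<comment> \<open>Left of the origin the step functions equal the initial value.\<close>
  have "uncountable {-1<..<0::real}" by (simp add: uncountable_open_interval)
  then obtain x0 where x0: "x0 \<in> {-1<..<0::real}" "x0 \<notin> X"
    using X by (meson countable_subset subsetI)
  define dl where "dl = F x0"
  have dlim: "d \<longlonglongrightarrow> dl"
  proof -
    have "U m x0 = d m" for m
    proof -
      have "real (K m) * x0 \<le> 0" using x0 by (intro mult_nonneg_nonpos) auto
      then have "\<lfloor>real (K m) * x0\<rfloor> \<le> 0" by linarith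
      then show ?thesis unfolding U_def by simp
    qed
    moreover have "(\<lambda>m. U m x0) \<longlonglongrightarrow> dl" unfolding dl_def by (rule UF) (use x0 in auto)
    ultimately show ?thesis by simp
  qed
  let ?c = "\<lambda>m s. real (cell_index (K m) s) / real (K m)"
  have cell: "(\<lambda>m. ?c m s) \<longlonglongrightarrow> s" if "0 \<le> s" for s :: real
  proof (rule tendsto_sandwich[where f="\<lambda>m. s - 1 / real (K m)" and h="\<lambda>m. s"])
    have *: "real (cell_index (K m) s) = of_int \<lfloor>real (K m) * s\<rfloor>" for m using that by simp
    have "s - 1 / real (K m) \<le> ?c m s" for m
    proof -
      have "(real (K m) * s - 1) / real (K m) \<le> of_int \<lfloor>real (K m) * s\<rfloor> / real (K m)"
        by (rule divide_right_mono) linarith+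
      then show ?thesis unfolding * using K0[of m] by (simp add: diff_divide_distrib)
    qed
    then show "\<forall>\<^sub>F m in sequentially. s - 1 / real (K m) \<le> ?c m s" by simp
    have "?c m s \<le> s" for m
      unfolding * using K0[of m] of_int_floor_le[of "real (K m) * s"] by (simp add: pos_divide_le_eq mult.commute)
    then show "\<forall>\<^sub>F m in sequentially. ?c m s \<le> s" by simp
    have "(\<lambda>m. s - 1 / real (K m)) \<longlonglongrightarrow> s - 0"
      by (intro tendsto_diff tendsto_const tendsto_divide_0[OF tendsto_const] filterlim_at_top_imp_at_infinity Kinf)
    then show "(\<lambda>m. s - 1 / real (K m)) \<longlonglongrightarrow> s" by simp
  qed simp
  \<comment> \<open>One dominated convergence for both equations of the scheme: the upper limit is
    the grid point to the left of \<open>s\<close> and tends to \<open>s\<close>, while the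
    integrands converge off \<open>X\<close>. Assumptions are made on the open interval only, the
    point 0 being null.\<close>
  have celllim: "(\<lambda>m. LBINT t:{0..<?c m s}. h m t) \<longlonglongrightarrow> (LBINT t:{0..<s}. hh t)"
    if s: "0 \<le> s" "s \<le> 1" and [measurable]: "\<And>m. h m \<in> borel_measurable borel" "hh \<in> borel_measurable borel"
      and H: "integrable lborel H" and hH: "\<And>m t. 0 < t \<Longrightarrow> t < 1 \<Longrightarrow> \<bar>h m t\<bar> \<le> H t"
      and lim: "\<And>t. 0 < t \<Longrightarrow> t < 1 \<Longrightarrow> t \<notin> X \<Longrightarrow> (\<lambda>m. h m t) \<longlonglongrightarrow> hh t"
    for s and h :: "nat \<Rightarrow> real \<Rightarrow> real" and hh H
    unfolding set_lebesgue_integral_def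
  proof (rule integral_dominated_convergence[where w="\<lambda>t. \<bar>H t\<bar>"])
    show "integrable lborel (\<lambda>t. \<bar>H t\<bar>)" using H by simp
    have le: "?c m s \<le> 1" for m
      using jle[OF s(2), of m] K0[of m] by simp
    have nz: "AE t in lborel. t \<noteq> (0::real)" by (rule AE_lborel_singleton)
    show "AE t in lborel. norm (indicat_real {0..<?c m s} t *\<^sub>R h m t) \<le> \<bar>H t\<bar>" for m
      using nz
    proof eventually_elim
      case (elim t)
      then show ?case using hH[of t m] le[of m] by (auto simp: indicator_def)
    qed
    have "AE t in lborel. t \<notin> insert s X"
      using X by (intro AE_not_in countable_imp_null_set_lborel) auto
    then show "AE t in lborel. (\<lambda>m. indicat_real {0..<?c m s} t *\<^sub>R h m t)
        \<longlonglongrightarrow> indicat_real {0..<s} t *\<^sub>R hh t"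
      using nz
    proof eventually_elim
      case (elim t)
      consider "t < 0" | "0 < t" "t < s" | "s < t" using elim by fastforce
      then show ?case
      proof cases
        case 2
        have "\<forall>\<^sub>F m in sequentially. t < ?c m s"
          by (rule order_tendstoD(1)[OF cell[OF s(1)] 2(2)])
        then have "\<forall>\<^sub>F m in sequentially. h m t = indicat_real {0..<?c m s} t *\<^sub>R h m t"
          by eventually_elim (use 2 in auto)
        from tendsto_cong[OF this] lim[of t] 2 s elim show ?thesis by simp
      next
        case 3
        have "\<forall>\<^sub>F m in sequentially. ?c m s < t"
          by (rule order_tendstoD(2)[OF cell[OF s(1)] 3])
        then have "\<forall>\<^sub>F m in sequentially. indicat_real {0..<?c m s} t *\<^sub>R h m t = 0"
          by eventually_elim auto
        then show ?thesis using 3 by (simp add: tendsto_eventually)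
      qed auto
    qed
  qed measurable
  have [measurable]: "f \<circ> (\<lambda>t. max d0 (g t)) \<in> borel_measurable borel" if [measurable]: "g \<in> borel_measurable borel" for g :: "real \<Rightarrow> real"
  proof -
    have "continuous_on UNIV (\<lambda>t. f (max d0 t))"
      by (rule continuous_on_compose2[OF f_cont]) (use d01 in \<open>auto intro!: continuous_intros\<close>)
    then have [measurable]: "(\<lambda>t. f (max d0 t)) \<in> borel_measurable borel" by (rule borel_measurable_continuous_onI)
    have "(\<lambda>t. f (max d0 (g t))) \<in> borel_measurable borel" by measurable
    then show ?thesis by (simp add: comp_def)
  qed
  note fm = this[unfolded comp_def]
  \<comment> \<open>The assumptions on \<open>f\<close> concern positive arguments only. Evaluating
    it at \<open>max d0 (g t)\<close> gives a function measurable on the whole line and changes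
    nothing where \<open>g t \<ge> d0\<close>.\<close>
  define Q where "Q g t = t ^ n * (g t powr (p - 1) - \<alpha> t * f (max d0 (g t)))" for g and t :: real
  have Qm: "Q g \<in> borel_measurable borel" if [measurable]: "g \<in> borel_measurable borel" for g
    unfolding Q_def using fm[OF that] by measurable
  define H where "H t = indicator {0..1} t * ME powr (p - 1) + \<alpha> t * f ME" for t
  have H: "integrable lborel H" unfolding H_def
    by (intro Bochner_Integration.integrable_add integrable_mult_left \<alpha>_int) (simp add: integrable_indicator_iff)
  have QH: "\<bar>Q g t\<bar> \<le> H t" if t: "0 < t" "t < 1" and g: "g t \<in> {d0..ME}" for g t
  proof -
    have "\<bar>g t powr (p - 1) - \<alpha> t * f (max d0 (g t))\<bar> \<le> g t powr (p - 1) + \<alpha> t * f (g t)"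
      using g d01 \<alpha>_nonneg[of t] f_pos[of "g t"] by (auto simp: abs_if max_def)
    also have "\<dots> \<le> H t"
      unfolding H_def using t g d01 \<alpha>_nonneg[of t] p1
      by (auto intro!: add_mono mult_left_mono powr_mono2 f_mono)
    finally have "\<bar>g t powr (p - 1) - \<alpha> t * f (max d0 (g t))\<bar> \<le> H t" .
    moreover have "\<bar>Q g t\<bar> \<le> \<bar>g t powr (p - 1) - \<alpha> t * f (max d0 (g t))\<bar>"
      unfolding Q_def using t power_le_one[of t n] by (simp add: abs_mult mult_left_le_one_le)
    ultimately show ?thesis by linarith
  qed
  \<comment> \<open>Only the Helly limit \<open>F\<close> is available at this point;
    \<open>uF\<close> later identifies it with \<open>u\<close> off \<open>X\<close>, and
    \<open>w_eq\<close> restates the formula with \<open>u\<close>.\<close>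
  define w where "w s = (LBINT t:{0..<s}. indicator {0..<1} t * Q F t)" for s
  have W_eq: "W m s = (LBINT t:{0..<?c m s}. Q (U m) t)" if "s \<le> 1" for m s
  proof -
    have "W m s = (LBINT t:{0..<?c m s}. t ^ n * (U m t powr (p - 1) - \<alpha> t * f (U m t)))"
      unfolding W_def U_def by (rule ew_integral(2)[OF K0])
    also have "\<dots> = (LBINT t:{0..<?c m s}. Q (U m) t)"
    proof (rule set_lebesgue_integral_cong)
      have "?c m s \<le> 1"
        using jle[OF that, of m] K0[of m] by simp
      then show "\<forall>t. t \<in> {0..<?c m s} \<longrightarrow>
          t ^ n * (U m t powr (p - 1) - \<alpha> t * f (U m t)) = Q (U m) t"
        using Ub[of _ m] unfolding Q_def by (fastforce simp: max_def)
    qed simp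
    finally show ?thesis .
  qed
  have W_lim: "(\<lambda>m. W m s) \<longlonglongrightarrow> w s" if s: "0 \<le> s" "s \<le> 1" for s
    unfolding W_eq[OF s(2)] w_def
  proof (rule celllim[OF s _ _ H])
    fix t :: real assume t: "0 < t" "t < 1" "t \<notin> X"
    have UFt: "(\<lambda>m. U m t) \<longlonglongrightarrow> F t" by (rule UF) (use t in auto)
    have Ft: "F t \<in> {d0..ME}" by (rule Fb) (use t in auto)
    have "isCont f (F t)"
      using f_cont Ft d01 by (simp add: continuous_on_eq_continuous_at open_greaterThan)
    moreover have "(\<lambda>m. max d0 (U m t)) \<longlonglongrightarrow> max d0 (F t)" by (intro tendsto_max tendsto_const UFt)
    ultimately have "(\<lambda>m. f (max d0 (U m t))) \<longlonglongrightarrow> f (max d0 (F t))"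
      using Ft by (intro isCont_tendsto_compose[of "max d0 (F t)" f]) (auto simp: max_def)
    then have "(\<lambda>m. Q (U m) t) \<longlonglongrightarrow> Q F t"
      unfolding Q_def using Ft d01 by (auto intro!: tendsto_intros UFt)
    then show "(\<lambda>m. Q (U m) t) \<longlonglongrightarrow> indicator {0..<1} t * Q F t" using t by simp
  next
    show "\<bar>Q (U m) t\<bar> \<le> H t" if "0 < t" "t < 1" for m t
      using Ub[of t m] that by (intro QH) auto
  qed (use Qm in measurable)
  have w_int: "integrable lborel (\<lambda>t. indicator {0..<1} t * Q F t)"
  proof (rule Bochner_Integration.integrable_bound[OF H])
    have "AE t in lborel. t \<notin> insert 0 X"
      using X by (intro AE_not_in countable_imp_null_set_lborel) auto
    then show "AE t in lborel. norm (indicator {0..<1} t * Q F t) \<le> norm (H t)"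
    proof eventually_elim
      case (elim t)
      show ?case
      proof (cases "0 < t \<and> t < 1")
        case True
        then show ?thesis using QH[of t F] Fb[of t] elim by (simp add: indicator_def)
      qed (use elim in \<open>auto simp: indicator_def\<close>)
    qed
  qed (use Qm in measurable)
  have w_cont: "continuous_on UNIV w"
    unfolding w_def by (rule continuous_on_indefinite[OF w_int])
  then have [measurable]: "w \<in> borel_measurable borel" by (rule borel_measurable_continuous_onI)
  define ss where "ss t = indicator {0<..<1} t * (max 0 (w t) / t ^ n) powr (1 / (p - 1))" for t
  have [measurable]: "ss \<in> borel_measurable borel" unfolding ss_def by measurable
  have ss_lim: "(\<lambda>m. sg m t) \<longlonglongrightarrow> ss t" if t: "0 < t" "t < 1" for t
  proof -
    have "(\<lambda>m. (max 0 (W m t) / (real (nat \<lfloor>real (K m) * t\<rfloor>) / real (K m)) ^ n) powr (1 / (p - 1)))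
       \<longlonglongrightarrow> (max 0 (w t) / t ^ n) powr (1 / (p - 1))"
      using t p1 by (intro tendsto_powr' tendsto_divide tendsto_power tendsto_max tendsto_const W_lim cell) auto
    then show ?thesis unfolding sg_def W_def ss_def using t by simp
  qed
  have sg_bd: "0 \<le> sg m t" "sg m t \<le> ME" if "t \<le> 1" for m t
  proof -
    show "0 \<le> sg m t" unfolding sg_def by simp
    have "sg m t \<le> U m t"
      unfolding sg_def U_def by (rule sl_le[OF K0 jle[OF that]]) (simp add: d_def Dpos)
    then show "sg m t \<le> ME" using Ub[OF that, of m] by auto
  qed
  have ss_bd: "0 \<le> ss t" "ss t \<le> ME" for t
  proof -
    show "0 \<le> ss t" unfolding ss_def by simp
    show "ss t \<le> ME"
    proof (cases "0 < t \<and> t < 1")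
      case True
      then show ?thesis using sg_bd by (intro LIMSEQ_le_const2[OF ss_lim]) auto
    qed (use ME in \<open>auto simp: ss_def indicator_def\<close>)
  qed
  have ss_int: "integrable lborel ss"
  proof (rule Bochner_Integration.integrable_bound)
    show "integrable lborel (\<lambda>t. ME * indicator {0..1::real} t)" by (simp add: integrable_indicator_iff)
    show "AE t in lborel. norm (ss t) \<le> norm (ME * indicator {0..1::real} t)"
      using ss_bd ME by (intro AE_I2) (auto simp: ss_def indicator_def)
  qed measurable
  define u where "u s = dl + (LBINT t:{0..<s}. ss t)" for s
  \<comment> \<open>Unlike \<open>UF\<close> this holds at every point: \<open>W_lim\<close> has no
    exceptional set, so the slopes converge at every interior \<open>t\<close>. The limit
    \<open>u\<close> is therefore a continuous version of \<open>F\<close>.\<close>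
  have U_lim: "(\<lambda>m. U m s) \<longlonglongrightarrow> u s" if s: "0 \<le> s" "s \<le> 1" for s
  proof -
    have "U m s = d m + (LBINT t:{0..<?c m s}. sg m t)" for m
      unfolding U_def sg_def by (rule eu_integral[OF K0])
    moreover have "(\<lambda>m. LBINT t:{0..<?c m s}. sg m t) \<longlonglongrightarrow> (LBINT t:{0..<s}. ss t)"
    proof (rule celllim[OF s])
      show "integrable lborel (\<lambda>t. ME * indicator {0..1::real} t)" by (simp add: integrable_indicator_iff)
      show "\<bar>sg m t\<bar> \<le> ME * indicator {0..1} t" if "0 < t" "t < 1" for m t
        using sg_bd[of t m] that by simp
    qed (use ss_lim in auto)
    ultimately show ?thesis unfolding u_def using dlim by (auto intro!: tendsto_intros)
  qed
  have ub: "u s \<in> {d0..ME}" if s: "0 \<le> s" "s \<le> 1" for s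
    by (rule closed_sequentially[OF closed_real_atLeastAtMost Ub[OF s(2)] U_lim[OF s]])
  have uF: "F s = u s" if "0 \<le> s" "s \<le> 1" "s \<notin> X" for s
    using UF[OF that(2,3)] U_lim[OF that(1,2)] by (rule LIMSEQ_unique)
  have u_cont: "continuous_on UNIV u"
    unfolding u_def by (intro continuous_intros continuous_on_indefinite[OF ss_int])
  have u_mono: "mono u"
  proof (rule monoI)
    fix x y :: real assume "x \<le> y"
    then show "u x \<le> u y" unfolding u_def
      using ss_int ss_bd by (intro add_left_mono set_integral_mono_set)
        (auto simp: set_integrable_def intro!: integrable_mult_indicator[of _ lborel ss, simplified])
  qed
  define q where "q t = t ^ n * (u t powr (p - 1) - \<alpha> t * f (u t))" for t
  have w_eq: "w s = (LBINT t:{0..<s}. q t)" if s: "0 \<le> s" "s \<le> 1" for s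
    unfolding w_def set_lebesgue_integral_def
  proof (rule integral_discrete_difference[OF X])
    fix t assume "t \<notin> X"
    then show "indicator {0..<s} t *\<^sub>R (indicator {0..<1} t * Q F t) = indicator {0..<s} t *\<^sub>R q t"
      using uF[of t] ub[of t] s by (auto simp: indicator_def Q_def q_def max_def)
  qed auto
  have q_int: "set_integrable lborel {0..<1} q"
    unfolding set_integrable_def
  proof (rule integrable_discrete_difference[OF X, THEN iffD1, OF _ _ _ w_int])
    fix t assume "t \<notin> X"
    then show "indicator {0..<1} t * Q F t = indicator {0..<1} t *\<^sub>R q t"
      using uF[of t] ub[of t] by (auto simp: indicator_def Q_def q_def max_def)
  qed auto
  have q_int': "set_integrable lborel A q" if "A \<subseteq> {0..<1}" "A \<in> sets borel" for A
    by (rule set_integrable_subset[OF q_int]) (use that in auto)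
  have w1: "w 1 = 0"
  proof -
    have "cell_index (K m) 1 = K m" for m by simp
    then have "W m 1 = 0" for m using D(2)[of "r m"] unfolding W_def d_def by (simp only: K_def)
    with W_lim[of 1] show ?thesis by (simp add: LIMSEQ_const_iff)
  qed
  have upos: "u t > 0" if "0 \<le> t" "t \<le> 1" for t using ub[OF that] d01 by auto
  have w_ge: "0 \<le> w s" if s: "0 \<le> s" "s \<le> 1" for s
  proof (rule ccontr)
    \<comment> \<open>If \<open>w s < 0\<close>, then \<open>q\<close> is negative somewhere before
      \<open>s\<close>. The sign of \<open>q\<close> is that of the bracket in \<open>qe\<close>,
      which decreases because \<open>\<alpha>\<close>, \<open>u\<close> and the quotient of
      \<open>f\<close> increase. Hence \<open>q \<le> 0\<close> from \<open>s\<close> on and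
      \<open>w 1 \<le> w s < 0\<close>, against \<open>w 1 = 0\<close>.\<close>
    assume neg: "\<not> 0 \<le> w s"
    then have s1: "s < 1" using w1 s by (cases "s = 1") auto
    have qe: "q t = t ^ n * u t powr (p - 1) * (1 - \<alpha> t * (f (u t) / u t powr (p - 1)))" if "0 \<le> t" "t \<le> 1" for t
    proof -
      have *: "P \<noteq> 0 \<Longrightarrow> c * (P - x * y) = c * P * (1 - x * (y / P))" for P c x y :: real
        by (simp add: field_simps)
      show ?thesis unfolding q_def by (rule *) (use upos[OF that] in simp)
    qed
    have "\<exists>t. 0 < t \<and> t < s \<and> q t < 0"
    proof (rule ccontr)
      assume "\<nexists>t. 0 < t \<and> t < s \<and> q t < 0"
      then have nn: "0 \<le> q t" if "0 < t" "t < s" for t using that by (meson not_less)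
      have "AE t in lborel. 0 \<le> indicat_real {0..<s} t *\<^sub>R q t"
        using AE_lborel_singleton[of 0]
      proof eventually_elim
        case (elim t)
        then show ?case using nn[of t] by (cases "0 < t \<and> t < s") (auto simp: indicator_def)
      qed
      then have "0 \<le> w s" unfolding w_eq[OF s] set_lebesgue_integral_def
        by (rule integral_nonneg_AE)
      with neg show False by simp
    qed
    then obtain t0 where t0: "0 < t0" "t0 < s" "q t0 < 0" by blast
    have "0 < t0 ^ n * u t0 powr (p - 1)" using t0 s upos[of t0] by simp
    with t0 qe[of t0] s have b0: "1 < \<alpha> t0 * (f (u t0) / u t0 powr (p - 1))"
      by (simp add: mult_less_0_iff)
    have "q t \<le> 0" if t: "s \<le> t" "t < 1" for t
    proof -
      have "\<alpha> t0 * (f (u t0) / u t0 powr (p - 1)) \<le> \<alpha> t * (f (u t) / u t powr (p - 1))"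
      proof (rule mult_mono)
        show "\<alpha> t0 \<le> \<alpha> t" using \<alpha>_mono t0 s t by (auto simp: mono_on_def)
        show "f (u t0) / u t0 powr (p - 1) \<le> f (u t) / u t powr (p - 1)"
          using upos[of t0] monoD[OF u_mono, of t0 t] t t0 s by (intro g_mono) auto
        show "0 \<le> f (u t0) / u t0 powr (p - 1)"
          using f_pos[of "u t0"] upos[of t0] t0 s by simp
      qed (rule \<alpha>_nonneg)
      with b0 have "1 - \<alpha> t * (f (u t) / u t powr (p - 1)) \<le> 0" by linarith
      then show ?thesis using qe[of t] t s t0 by (simp add: mult_nonneg_nonpos)
    qed
    then have "0 \<le> (LBINT t:{s..<1}. - q t)"
      unfolding set_lebesgue_integral_def
      by (intro integral_nonneg_AE AE_I2) (simp add: indicator_def)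
    then have "(LBINT t:{s..<1}. q t) \<le> 0"
      by (simp add: set_lebesgue_integral_def)
    moreover have "w 1 = w s + (LBINT t:{s..<1}. q t)"
    proof -
      have "{0..<1} = {0..<s} \<union> {s..<1}" using s s1 by auto
      then show ?thesis unfolding w_eq[OF s] w_eq[of 1, simplified]
        using q_int'[of "{0..<s}"] q_int'[of "{s..<1}"] s s1 by (simp add: set_integral_Un)
    qed
    ultimately show False using w1 neg by simp
  qed
  have w_le: "w s \<le> ME powr (p - 1) * s ^ Suc n" if s: "0 \<le> s" "s \<le> 1" for s
  proof -
    have "w s \<le> (LBINT t:{0..<s}. ME powr (p - 1) * t ^ n)"
      unfolding w_eq[OF s]
    proof (rule set_integral_mono)
      show "set_integrable lborel {0..<s} q" by (rule q_int') (use s in auto)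
      show "set_integrable lborel {0..<s} (\<lambda>t. ME powr (p - 1) * t ^ n)"
        using pow_int[of s] by simp
      fix t assume t: "t \<in> {0..<s}"
      have "u t powr (p - 1) - \<alpha> t * f (u t) \<le> ME powr (p - 1)"
        using ub[of t] t s d01 p1 \<alpha>_nonneg[of t] f_pos[of "u t"] upos[of t]
        by (intro order_trans[OF _ powr_mono2[of "p - 1" "u t" ME]]) auto
      then show "q t \<le> ME powr (p - 1) * t ^ n"
        unfolding q_def mult.commute[of "ME powr _"] using t by (intro mult_left_mono) auto
    qed
    also have "\<dots> = ME powr (p - 1) * (LBINT t:{0..<s}. t ^ n)" by simp
    also have "\<dots> \<le> ME powr (p - 1) * s ^ Suc n"
      by (intro mult_left_mono pow_integral_le_Suc s) auto
    finally show ?thesis .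
  qed
  show thesis
  proof (rule that[of u w "ME powr (p - 1)"])
    show "mono_on {0..1} u" using u_mono by (auto simp: mono_on_def mono_def)
    fix r :: real assume r: "r \<in> {0..1}"
    show "w r = (LBINT s:{0..<r}. s ^ n * (u s powr (p - 1) - \<alpha> s * f (u s)))"
      using w_eq[of r] r by (simp add: q_def)
    have "u 0 = dl" unfolding u_def by (simp add: set_lebesgue_integral_def)
    moreover have "(LBINT t:{0..<r}. ss t) = (LBINT s:{0..<r}. (w s / s ^ n) powr (1 / (p - 1)))"
      unfolding set_lebesgue_integral_def
    proof (rule integral_discrete_difference[where X="{0}"])
      fix t :: real assume "t \<notin> {0}"
      then show "indicat_real {0..<r} t *\<^sub>R ss t = indicat_real {0..<r} t *\<^sub>R (w t / t ^ n) powr (1 / (p - 1))"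
        using w_ge[of t] r by (auto simp: indicator_def ss_def)
    qed auto
    ultimately show "u r = u 0 + (LBINT s:{0..<r}. (w s / s ^ n) powr (1 / (p - 1)))"
      unfolding u_def by simp
  qed (use upos w_ge w_le w1 u_cont w_cont in auto)
qed

end

section \<open>Test functions\<close>

lemma partial_deriv_eq: "(f has_derivative f') (at x) \<Longrightarrow> partial_deriv i f x = f' i"
  unfolding partial_deriv_def by (simp flip: frechet_derivative_at)

lemma has_derivative_partial:
  assumes "f differentiable_on UNIV"
  shows "(f has_derivative (\<lambda>h. frechet_derivative f (at x) h)) (at x)"
  using assms by (auto simp: differentiable_on_def frechet_derivative_works)

lemma Ck_fun_pred: "Ck_fun (Suc k) f \<Longrightarrow> Ck_fun k f"
  by (induction k arbitrary: f) auto

lemma Ck_fun_const: "Ck_fun k (\<lambda>x::'n::euclidean_space. c)"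
proof (induction k arbitrary: c)
  case (Suc k)
  have "partial_deriv i (\<lambda>x. c) = (\<lambda>x. 0)" for i :: 'n
    by (rule ext) (simp add: partial_deriv_eq[OF has_derivative_const])
  with Suc show ?case by simp
qed simp

lemma Ck_fun_add: "Ck_fun k f \<Longrightarrow> Ck_fun k g \<Longrightarrow> Ck_fun k (\<lambda>x. f x + g x)"
proof (induction k arbitrary: f g)
  case (Suc k)
  have "partial_deriv i (\<lambda>x. f x + g x) = (\<lambda>x. partial_deriv i f x + partial_deriv i g x)" for i
    by (rule ext, subst partial_deriv_eq[OF has_derivative_add[OF has_derivative_partial has_derivative_partial]])
       (use Suc in \<open>auto simp: partial_deriv_def\<close>)
  then show ?case using Suc by (auto intro: continuous_on_add)
qed (auto intro: continuous_on_add)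

lemma Ck_fun_mult: "Ck_fun k f \<Longrightarrow> Ck_fun k g \<Longrightarrow> Ck_fun k (\<lambda>x. f x * g x)"
proof (induction k arbitrary: f g)
  case (Suc k)
  have "partial_deriv i (\<lambda>x. f x * g x) = (\<lambda>x. f x * partial_deriv i g x + partial_deriv i f x * g x)" for i
    by (rule ext, subst partial_deriv_eq[OF has_derivative_mult[OF has_derivative_partial has_derivative_partial]])
       (use Suc in \<open>auto simp: partial_deriv_def\<close>)
  moreover have "Ck_fun k f" "Ck_fun k g" using Suc.prems by (auto intro: Ck_fun_pred)
  moreover have "(\<lambda>x. f x * g x) differentiable_on UNIV"
    using Suc.prems by (auto simp: differentiable_on_def)
  ultimately show ?case using Suc by (auto intro: continuous_on_mult Ck_fun_add)
qed (auto intro: continuous_on_mult)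

lemma Ck_fun_prod: "(\<And>i. i \<in> I \<Longrightarrow> Ck_fun k (f i)) \<Longrightarrow> Ck_fun k (\<lambda>x. \<Prod>i\<in>I. f i x)"
  by (induction I rule: infinite_finite_induct) (auto intro: Ck_fun_const Ck_fun_mult)

text \<open>The family \<open>q\<close> lists the successive derivatives of a function of one
  variable. A partial derivative only moves \<open>n\<close> to \<open>Suc n\<close> and adds a
  constant factor, so the induction on \<open>k\<close> closes when \<open>n\<close> is
  arbitrary.\<close>

lemma Ck_fun_profile:
  fixes q :: "nat \<Rightarrow> real \<Rightarrow> real" and v :: "'n::euclidean_space"
  assumes "\<And>n t. (q n has_real_derivative q (Suc n) t) (at t)"
  shows "Ck_fun k (\<lambda>x. q n (a + x \<bullet> v))"
proof (induction k arbitrary: n)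
  have d: "((\<lambda>x. q n (a + x \<bullet> v)) has_derivative (\<lambda>h. q (Suc n) (a + x \<bullet> v) * (h \<bullet> v))) (at x)" for n and x :: 'n
  proof -
    have "((\<lambda>x. a + x \<bullet> v) has_derivative (\<lambda>h. h \<bullet> v)) (at x)"
      by (auto intro!: derivative_eq_intros)
    from has_derivative_compose[OF this assms[unfolded has_field_derivative_def]]
    show ?thesis by (simp add: comp_def)
  qed
  then have dd: "(\<lambda>x. q n (a + x \<bullet> v)) differentiable_on UNIV" for n
    by (auto simp: differentiable_on_def differentiable_def)
  then have c: "continuous_on UNIV (\<lambda>x. q n (a + x \<bullet> v))" for n
    by (rule differentiable_imp_continuous_on)
  {
    case 0
    show ?case using c by simp
  next
    case (Suc k)
    have "partial_deriv i (\<lambda>x. q n (a + x \<bullet> v)) = (\<lambda>x. q (Suc n) (a + x \<bullet> v) * (i \<bullet> v))" for i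
      by (rule ext) (rule partial_deriv_eq[OF d])
    then show ?case using Suc c dd by (auto intro: Ck_fun_mult Ck_fun_const)
  }
qed

lemma Ck_fun_inner: "Ck_fun k (\<lambda>x. x \<bullet> v)"
proof -
  define q where "q n = (if n = 0 then \<lambda>t. t else if n = 1 then \<lambda>t. 1 else (\<lambda>t. 0::real))" for n :: nat
  have "Ck_fun k (\<lambda>x. q 0 (0 + x \<bullet> v))"
    by (rule Ck_fun_profile) (auto simp: q_def intro!: derivative_eq_intros)
  then show ?thesis by (simp add: q_def)
qed

lemma Ck_fun_scaleR: "Ck_fun k f \<Longrightarrow> Ck_fun k (\<lambda>x. f (c *\<^sub>R x))"
proof (induction k arbitrary: f)
  case 0
  then show ?case by (auto intro!: continuous_intros continuous_on_compose2[of UNIV f])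
next
  case (Suc k)
  have d: "((\<lambda>x. f (c *\<^sub>R x)) has_derivative (\<lambda>h. frechet_derivative f (at (c *\<^sub>R x)) (c *\<^sub>R h))) (at x)" for x
    by (rule has_derivative_compose[of "\<lambda>x. c *\<^sub>R x" "\<lambda>h. c *\<^sub>R h", OF _ has_derivative_partial])
       (use Suc in \<open>auto intro!: derivative_eq_intros\<close>)
  have "frechet_derivative f (at y) (c *\<^sub>R i) = c * frechet_derivative f (at y) i" for y i
    using linear_frechet_derivative[of f "at y"] Suc.prems by (auto simp: differentiable_on_def linear_cmul)
  then have "partial_deriv i (\<lambda>x. f (c *\<^sub>R x)) = (\<lambda>x. c * partial_deriv i f (c *\<^sub>R x))" for i
    using partial_deriv_eq[OF d] by (auto simp: partial_deriv_def)
  moreover have dd: "(\<lambda>x. f (c *\<^sub>R x)) differentiable_on UNIV"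
    using d by (auto simp: differentiable_on_def differentiable_def)
  ultimately show ?case using Suc differentiable_imp_continuous_on[OF dd]
    by (auto intro: Ck_fun_mult Ck_fun_const)
qed

lemma smooth_fun_differentiable: "smooth_fun f \<Longrightarrow> f differentiable_on UNIV"
  unfolding smooth_fun_def by (drule spec[of _ 1]) simp

lemma smooth_fun_continuous: "smooth_fun f \<Longrightarrow> continuous_on UNIV f"
  unfolding smooth_fun_def by (drule spec[of _ 0]) simp

lemma smooth_fun_partial_continuous:
  assumes "smooth_fun f" "i \<in> Basis"
  shows "continuous_on UNIV (partial_deriv i f)"
proof -
  have "Ck_fun (Suc 0) f" using assms(1) unfolding smooth_fun_def by blast
  with assms(2) show ?thesis by simp
qed

lemma smooth_fun_has_derivative:
  assumes "smooth_fun f"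
  shows "(f has_derivative (\<lambda>h. \<Sum>i\<in>Basis. (h \<bullet> i) * partial_deriv i f x)) (at x)"
proof -
  let ?D = "frechet_derivative f (at x)"
  have d: "(f has_derivative ?D) (at x)"
    by (rule has_derivative_partial[OF smooth_fun_differentiable[OF assms]])
  interpret linear ?D by (rule has_derivative_linear[OF d])
  have "?D h = (\<Sum>i\<in>Basis. (h \<bullet> i) * partial_deriv i f x)" for h
  proof -
    have "?D h = ?D (\<Sum>i\<in>Basis. (h \<bullet> i) *\<^sub>R i)" by (simp add: euclidean_representation)
    also have "\<dots> = (\<Sum>i\<in>Basis. (h \<bullet> i) * partial_deriv i f x)"
      unfolding partial_deriv_def by (simp add: sum scale)
    finally show ?thesis .
  qed
  then have "?D = (\<lambda>h. \<Sum>i\<in>Basis. (h \<bullet> i) * partial_deriv i f x)" by (rule ext)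
  with d show ?thesis by simp
qed

lemma test_fun_scaleR:
  assumes "test_fun U f" "c > 0" "\<And>x. x \<in> U \<Longrightarrow> c *\<^sub>R x \<in> V"
  shows "test_fun V (\<lambda>x. f ((1 / c) *\<^sub>R x))"
proof -
  have "{x. f ((1 / c) *\<^sub>R x) \<noteq> 0} = (*\<^sub>R) c ` {x. f x \<noteq> 0}"
  proof (intro equalityI subsetI)
    fix x assume "x \<in> {x. f ((1 / c) *\<^sub>R x) \<noteq> 0}"
    then show "x \<in> (*\<^sub>R) c ` {x. f x \<noteq> 0}"
      using assms(2) by (intro image_eqI[of _ _ "(1 / c) *\<^sub>R x"]) auto
  qed (use assms(2) in auto)
  then have "closure {x. f ((1 / c) *\<^sub>R x) \<noteq> 0} = (*\<^sub>R) c ` closure {x. f x \<noteq> 0}"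
    by (simp add: closure_scaleR)
  then show ?thesis
    using assms by (auto simp: test_fun_def smooth_fun_def intro: Ck_fun_scaleR compact_scaling)
qed

lemma test_fun_mult:
  assumes "test_fun U f" "smooth_fun g"
  shows "test_fun U (\<lambda>x. g x * f x)"
proof -
  have sub: "closure {x. g x * f x \<noteq> 0} \<subseteq> closure {x. f x \<noteq> 0}"
    by (rule closure_mono) auto
  moreover have "compact (closure {x. g x * f x \<noteq> 0})"
    using assms(1) sub by (auto simp: test_fun_def compact_eq_bounded_closed intro: bounded_subset)
  ultimately show ?thesis
    using assms by (auto simp: test_fun_def smooth_fun_def intro: Ck_fun_mult)
qed

lemma test_fun_outside: "test_fun U f \<Longrightarrow> x \<notin> U \<Longrightarrow> f x = 0"
  using closure_subset[of "{x. f x \<noteq> 0}"] by (auto simp: test_fun_def)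

lemma continuous_compact_support_bounded:
  fixes f :: "'n::euclidean_space \<Rightarrow> real"
  assumes "continuous_on UNIV f" "compact K" "\<And>x. x \<notin> K \<Longrightarrow> f x = 0"
  obtains C where "C \<ge> 0" "\<And>x. \<bar>f x\<bar> \<le> C"
proof -
  have "compact (f ` K)" using assms by (intro compact_continuous_image) (auto elim: continuous_on_subset)
  then obtain C where C: "\<And>x. x \<in> K \<Longrightarrow> \<bar>f x\<bar> \<le> C"
    using compact_imp_bounded[of "f ` K"] by (auto simp: bounded_iff)
  show thesis
  proof (rule that[of "max 0 C"])
    show "\<bar>f x\<bar> \<le> max 0 C" for x
      using C[of x] assms(3)[of x] by (cases "x \<in> K") auto
  qed simp
qed

lemma test_fun_bounded:
  assumes "test_fun U f"
  obtains C where "C \<ge> 0" "\<And>x. \<bar>f x\<bar> \<le> C"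
proof (rule continuous_compact_support_bounded[of f "closure {x. f x \<noteq> 0}"])
  show "f x = 0" if "x \<notin> closure {x. f x \<noteq> 0}" for x
    using that closure_subset[of "{x. f x \<noteq> 0}"] by auto
qed (use assms in \<open>auto simp: test_fun_def intro: smooth_fun_continuous\<close>)

lemma partial_deriv_outside:
  assumes "test_fun U f" "x \<notin> closure {x. f x \<noteq> 0}"
  shows "partial_deriv i f x = 0"
proof -
  have "(f has_derivative (\<lambda>h. 0)) (at x)"
  proof (rule has_derivative_transform_within_open[where f="\<lambda>x. 0" and s="- closure {x. f x \<noteq> 0}"])
    show "0 = f y" if "y \<in> - closure {x. f x \<noteq> 0}" for y
      using that closure_subset[of "{x. f x \<noteq> 0}"] by auto
  qed (use assms in auto)
  then show ?thesis by (rule partial_deriv_eq)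
qed

lemma test_fun_partial_bounded:
  assumes "test_fun U f" "i \<in> Basis"
  obtains C where "C \<ge> 0" "\<And>x. \<bar>partial_deriv i f x\<bar> \<le> C"
proof (rule continuous_compact_support_bounded[of "partial_deriv i f" "closure {x. f x \<noteq> 0}"])
  show "partial_deriv i f x = 0" if "x \<notin> closure {x. f x \<noteq> 0}" for x
    by (rule partial_deriv_outside[OF assms(1) that])
qed (use assms in \<open>auto simp: test_fun_def intro: smooth_fun_partial_continuous\<close>)

text \<open>The functions \<open>t \<mapsto> P(1/t) exp(-1/t)\<close>, extended by zero to \<open>t \<le> 0\<close>, are closed under
  differentiation: \<open>P\<close> is replaced by \<open>X\<^sup>2 (P - P')\<close>.\<close>

definition flat_exp :: "real poly \<Rightarrow> real \<Rightarrow> real" where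
  "flat_exp P t = (if t > 0 then poly P (1 / t) * exp (- (1 / t)) else 0)"

text \<open>The extra power strengthens the claim for the induction: splitting off the constant
  coefficient moves one factor \<open>y\<close> from the polynomial into
  \<open>y ^ k\<close>.\<close>

lemma poly_exp_decay: "((\<lambda>y. y ^ k * poly P y * exp (- y)) \<longlongrightarrow> (0::real)) at_top"
proof (induction P arbitrary: k)
  case (pCons a P)
  have "((\<lambda>y. a * (y ^ k / exp y) + y ^ Suc k * poly P y * exp (- y)) \<longlongrightarrow> a * 0 + 0) at_top"
    by (intro tendsto_add tendsto_mult tendsto_const tendsto_power_div_exp_0 pCons)
  then show ?case by (simp add: algebra_simps exp_minus divide_inverse)
qed simp

lemma flat_exp_derivative:
  "(flat_exp P has_real_derivative flat_exp ([:0, 0, 1:] * (P - pderiv P)) t) (at t)"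
proof -
  consider "t < 0" | "t = 0" | "t > 0" by linarith
  then show ?thesis
  proof cases
    case 1
    have "((\<lambda>_. 0) has_real_derivative 0) (at t)" by simp
    then have "(flat_exp P has_real_derivative 0) (at t)"
      by (rule has_field_derivative_transform_within_open[where S="{..<0}"]) (use 1 in \<open>auto simp: flat_exp_def\<close>)
    then show ?thesis using 1 by (simp add: flat_exp_def)
  next
    case 3
    have "((\<lambda>t. poly P (1 / t) * exp (- (1 / t))) has_real_derivative
        poly ([:0, 0, 1:] * (P - pderiv P)) (1 / t) * exp (- (1 / t))) (at t)"
      using 3 by (auto intro!: derivative_eq_intros simp: field_simps power2_eq_square)
    then have "(flat_exp P has_real_derivative poly ([:0, 0, 1:] * (P - pderiv P)) (1 / t) * exp (- (1 / t))) (at t)"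
      by (rule has_field_derivative_transform_within_open[where S="{0<..}"]) (use 3 in \<open>auto simp: flat_exp_def\<close>)
    then show ?thesis using 3 by (simp add: flat_exp_def)
  next
    case 2
    \<comment> \<open>With \<open>y = 1 / h\<close> the right difference quotient at 0 is
      \<open>y * poly P y * exp (- y)\<close>, the case \<open>k = 1\<close> of
      \<open>poly_exp_decay\<close>; the left one is 0.\<close>
    have "((\<lambda>h. flat_exp P h / h) \<longlongrightarrow> 0) (at_right 0)"
    proof (rule Lim_transform_eventually)
      show "((\<lambda>h. (1 / h) ^ 1 * poly P (1 / h) * exp (- (1 / h))) \<longlongrightarrow> 0) (at_right 0)"
        by (rule filterlim_compose[OF poly_exp_decay]) (use filterlim_inverse_at_top_right in \<open>simp add: inverse_eq_divide\<close>)
      show "\<forall>\<^sub>F h in at_right 0. (1 / h) ^ 1 * poly P (1 / h) * exp (- (1 / h)) = flat_exp P h / h"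
        by (auto simp: flat_exp_def eventually_at_filter)
    qed
    moreover have "((\<lambda>h. flat_exp P h / h) \<longlongrightarrow> 0) (at_left 0)"
      by (rule tendsto_eventually) (auto simp: flat_exp_def eventually_at_filter)
    ultimately have "((\<lambda>h. flat_exp P h / h) \<longlongrightarrow> 0) (at 0)"
      by (simp add: filterlim_at_split)
    then show ?thesis using 2 by (simp add: DERIV_def flat_exp_def)
  qed
qed

text \<open>The polynomials of the successive derivatives of \<open>flat_exp 1\<close>, in the form
  that \<open>Ck_fun_profile\<close> requires.\<close>

primrec flat_poly :: "nat \<Rightarrow> real poly" where
  "flat_poly 0 = 1"
| "flat_poly (Suc n) = [:0, 0, 1:] * (flat_poly n - pderiv (flat_poly n))"

text \<open>A factor equals \<open>exp (- 1 / ((k + 1) t))\<close> for \<open>t > 0\<close> and 0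
  otherwise. Growing \<open>k\<close> pushes it to 1 inside the box while the support stays in the
  closed box, so indicators of boxes are bounded limits of test functions without any
  convolution.\<close>

definition bump :: "'n::euclidean_space \<Rightarrow> 'n \<Rightarrow> nat \<Rightarrow> 'n \<Rightarrow> real" where
  "bump a b k x = (\<Prod>i\<in>Basis. flat_exp 1 (real (Suc k) * (x \<bullet> i - a \<bullet> i)) * flat_exp 1 (real (Suc k) * (b \<bullet> i - x \<bullet> i)))"

lemma smooth_bump: "smooth_fun (bump a b k)"
  unfolding smooth_fun_def
proof
  fix m
  have *: "Ck_fun m (\<lambda>x. flat_exp (flat_poly 0) (c + x \<bullet> v))" for c and v :: 'a
    by (rule Ck_fun_profile[of "\<lambda>n. flat_exp (flat_poly n)"]) (use flat_exp_derivative in auto)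
  have "Ck_fun m (\<lambda>x. flat_exp 1 (real (Suc k) * (x \<bullet> i - a \<bullet> i)))"
    "Ck_fun m (\<lambda>x. flat_exp 1 (real (Suc k) * (b \<bullet> i - x \<bullet> i)))" for i
    using *[of "- real (Suc k) * (a \<bullet> i)" "real (Suc k) *\<^sub>R i"]
      *[of "real (Suc k) * (b \<bullet> i)" "- (real (Suc k) *\<^sub>R i)"]
    by (simp_all add: algebra_simps)
  then show "Ck_fun m (bump a b k)"
    unfolding bump_def[abs_def] by (intro Ck_fun_prod Ck_fun_mult)
qed

lemma flat_exp_1_bounds: "0 \<le> flat_exp 1 t" "flat_exp 1 t \<le> 1"
  by (auto simp: flat_exp_def)

lemma bump_bounds: "0 \<le> bump a b k x" "bump a b k x \<le> 1"
  unfolding bump_def using flat_exp_1_bounds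
  by (auto intro!: prod_nonneg prod_le_1 mult_le_one mult_nonneg_nonneg)

lemma bump_outside: "x \<notin> box a b \<Longrightarrow> bump a b k x = 0"
  unfolding bump_def mem_box by (rule prod_zero) (auto simp: flat_exp_def zero_less_mult_iff)

lemma bump_tendsto: "(\<lambda>k. bump a b k x) \<longlonglongrightarrow> indicator (box a b) x"
proof (cases "x \<in> box a b")
  case True
  have *: "(\<lambda>k. flat_exp 1 (real (Suc k) * t)) \<longlonglongrightarrow> 1" if "t > 0" for t
  proof -
    have "(\<lambda>k. exp (- (inverse (real (Suc k)) * (1 / t)))) \<longlonglongrightarrow> exp (- (0 * (1 / t)))"
      by (intro tendsto_intros LIMSEQ_inverse_real_of_nat)
    then show ?thesis using that by (simp add: flat_exp_def divide_inverse mult.commute)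
  qed
  have "(\<lambda>k. bump a b k x) \<longlonglongrightarrow> (\<Prod>i\<in>(Basis::'a set). 1 * 1)"
    unfolding bump_def using True by (intro tendsto_prod tendsto_mult *) (auto simp: mem_box)
  with True show ?thesis by simp
next
  case False
  then show ?thesis by (simp add: bump_outside)
qed

lemma test_fun_bump:
  assumes "closure (box a b) \<subseteq> U"
  shows "test_fun U (bump a b k)"
proof -
  have sub: "closure {x. bump a b k x \<noteq> 0} \<subseteq> closure (box a b)"
    by (rule closure_mono) (use bump_outside[of _ a b k] in blast)
  moreover have "compact (closure {x. bump a b k x \<noteq> 0})"
    using bounded_subset[OF bounded_closure[OF bounded_box] sub] by (simp add: compact_eq_bounded_closed)
  ultimately show ?thesis using assms smooth_bump by (auto simp: test_fun_def)
qed

lemma integral_box_zero: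
  fixes g :: "'n::euclidean_space \<Rightarrow> real"
  assumes g: "integrable lborel g" and test: "\<And>\<phi>. test_fun U \<phi> \<Longrightarrow> (LBINT x. g x * \<phi> x) = 0"
    and ab: "closure (box a b) \<subseteq> U"
  shows "(LBINT x:box a b. g x) = 0"
proof -
  have "(\<lambda>k. LBINT x. g x * bump a b k x) \<longlonglongrightarrow> (LBINT x. g x * indicator (box a b) x)"
  proof (rule integral_dominated_convergence[where w="\<lambda>x. \<bar>g x\<bar>"])
    show "AE x in lborel. (\<lambda>k. g x * bump a b k x) \<longlonglongrightarrow> g x * indicator (box a b) x"
      by (intro AE_I2 tendsto_mult tendsto_const bump_tendsto)
    have "bump a b k \<in> borel_measurable borel" for k
      by (intro borel_measurable_continuous_onI smooth_fun_continuous smooth_bump)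
    then show "(\<lambda>x. g x * bump a b k x) \<in> borel_measurable lborel" for k using g by auto
    show "AE x in lborel. norm (g x * bump a b k x) \<le> \<bar>g x\<bar>" for k
      using bump_bounds[of a b k] by (intro AE_I2) (auto simp: abs_mult intro!: mult_left_le)
  qed (use g in auto)
  moreover have "(LBINT x. g x * bump a b k x) = 0" for k
    by (intro test test_fun_bump ab)
  ultimately show ?thesis
    by (simp add: LIMSEQ_const_iff set_lebesgue_integral_def mult.commute)
qed

text \<open>Boxes form an intersection-stable generator of the Borel sets. Hence the integral of
  \<open>g\<close> vanishes over every Borel part of \<open>box c d\<close>, in particular over the
  parts where \<open>g\<close> is positive or negative.\<close>

lemma fundamental_lemma_box:
  fixes g :: "'n::euclidean_space \<Rightarrow> real"
  assumes g: "integrable lborel g" and test: "\<And>\<phi>. test_fun U \<phi> \<Longrightarrow> (LBINT x. g x * \<phi> x) = 0"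
    and cd: "closure (box c d) \<subseteq> U"
  shows "AE x in lborel. x \<in> box c d \<longrightarrow> g x = 0"
proof -
  have [measurable]: "g \<in> borel_measurable borel" using g by auto
  have si: "set_integrable lborel A g" if "A \<in> sets borel" for A
    unfolding set_integrable_def using g that by (intro integrable_mult_indicator) auto
  let ?G = "range (\<lambda>(a, b). box a b :: 'n set)"
  have stable: "Int_stable ?G" by (auto simp: Int_stable_def box_Int_box)
  have subset_Pow: "?G \<subseteq> Pow UNIV" by simp
  have borel: "sets borel = sigma_sets UNIV ?G"
    using borel_eq_box[where 'a='n] by (metis sets_measure_of_conv top_greatest Pow_UNIV)
  \<comment> \<open>Intersecting with the fixed box keeps the generators inside \<open>U\<close>,
    and it makes the complement step work, because the integral over \<open>box c d\<close> itself
    is already known to be 0.\<close>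
  have zero: "(LBINT x:A \<inter> box c d. g x) = 0" if "A \<in> sets borel" for A
    using stable subset_Pow that[unfolded borel]
  proof (induction A rule: sigma_sets_induct_disjoint)
    case (basic A)
    then obtain a b where A: "A = box a b" by auto
    have "closure (A \<inter> box c d) \<subseteq> U" using cd closure_mono[of "A \<inter> box c d" "box c d"] by blast
    then show ?case unfolding A box_Int_box by (intro integral_box_zero[OF g test]) auto
  next
    case empty
    then show ?case by (simp add: set_lebesgue_integral_def)
  next
    case (compl A)
    then have A: "A \<in> sets borel" by (simp add: borel)
    have "(LBINT x:(A \<inter> box c d) \<union> ((UNIV - A) \<inter> box c d). g x)
        = (LBINT x:A \<inter> box c d. g x) + (LBINT x:(UNIV - A) \<inter> box c d. g x)"
      using A by (intro set_integral_Un si) auto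
    moreover have "(A \<inter> box c d) \<union> ((UNIV - A) \<inter> box c d) = box c d" by blast
    ultimately show ?case using compl integral_box_zero[OF g test cd] by simp
  next
    case (union A)
    then have A: "A i \<in> sets borel" for i by (auto simp: borel)
    have "(LBINT x:(\<Union>i. A i \<inter> box c d). g x) = (\<Sum>i. LBINT x:A i \<inter> box c d. g x)"
      using A union(1) by (intro lebesgue_integral_countable_add si) (auto simp: disjoint_family_on_def)
    then show ?case using union by simp
  qed
  have "AE x in lborel. indicator ({x. h x > 0} \<inter> box c d) x *\<^sub>R h x = 0"
    if h: "h = g \<or> h = (\<lambda>x. - g x)" for h
  proof -
    have [measurable]: "h \<in> borel_measurable borel" using h by auto
    have i: "integrable lborel (\<lambda>x. indicator ({x. h x > 0} \<inter> box c d) x *\<^sub>R h x)"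
      using h g by (intro integrable_mult_indicator) auto
    have "(LBINT x:{x. h x > 0} \<inter> box c d. h x) = 0"
      using h zero[of "{x. h x > 0}"] by (auto simp: set_lebesgue_integral_def)
    then show ?thesis
      using integral_nonneg_eq_0_iff_AE[OF i] unfolding set_lebesgue_integral_def
      by (auto simp: indicator_def)
  qed
  from this[of g] this[of "\<lambda>x. - g x"] show ?thesis
    by (auto elim!: eventually_elim2 simp: indicator_def split: if_splits) 
qed

text \<open>By Lindelof's theorem countably many admissible boxes cover the open set, so the
  exceptional null sets can be united.\<close>

lemma fundamental_lemma:
  fixes g :: "'n::euclidean_space \<Rightarrow> real"
  assumes g: "integrable lborel g" and test: "\<And>\<phi>. test_fun U \<phi> \<Longrightarrow> (LBINT x. g x * \<phi> x) = 0"
    and U: "open U"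
  shows "AE x in lborel. x \<in> U \<longrightarrow> g x = 0"
proof -
  define \<F> where "\<F> = {box c d | c d :: 'n. closure (box c d) \<subseteq> U}"
  obtain \<F>' where \<F>': "\<F>' \<subseteq> \<F>" "countable \<F>'" "\<Union>\<F>' = \<Union>\<F>"
    by (rule Lindelof[of \<F>]) (auto simp: \<F>_def)
  have cover: "U \<subseteq> \<Union>\<F>"
  proof
    fix x assume "x \<in> U"
    then obtain e where e: "e > 0" "cball x e \<subseteq> U" using U open_contains_cball by blast
    obtain a b where ab: "x \<in> box a b" "box a b \<subseteq> ball x e" using rational_boxes[OF e(1), of x] by blast
    have "closure (box a b) \<subseteq> cball x e"
      using ab(2) by (intro closure_minimal) (auto intro: order_trans[OF _ ball_subset_cball])
    with ab(1) e(2) show "x \<in> \<Union>\<F>" unfolding \<F>_def by blast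
  qed
  have "AE x in lborel. \<forall>B\<in>\<F>'. x \<in> B \<longrightarrow> g x = 0"
  proof (rule AE_ball_countable'[OF _ \<F>'(2)])
    fix B assume "B \<in> \<F>'"
    with \<F>'(1) obtain c d where "B = box c d" "closure (box c d) \<subseteq> U" by (auto simp: \<F>_def)
    then show "AE x in lborel. x \<in> B \<longrightarrow> g x = 0"
      using fundamental_lemma_box[OF g test] by simp
  qed
  then show ?thesis
    by eventually_elim (use cover \<F>'(3) in blast)
qed

section \<open>Dilations and rays\<close>

lemma integrable_pairI:
  fixes f :: "'a::euclidean_space \<Rightarrow> 'b::euclidean_space \<Rightarrow> real"
  assumes "case_prod f \<in> borel_measurable (lborel \<Otimes>\<^sub>M lborel)"
    and "(\<integral>\<^sup>+x. \<integral>\<^sup>+y. ennreal \<bar>f x y\<bar> \<partial>lborel \<partial>lborel) < \<infinity>"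
  shows "integrable (lborel \<Otimes>\<^sub>M lborel) (case_prod f)"
proof (rule integrableI_bounded)
  have "(\<integral>\<^sup>+z. ennreal (norm (case_prod f z)) \<partial>(lborel \<Otimes>\<^sub>M lborel)) = (\<integral>\<^sup>+x. \<integral>\<^sup>+y. ennreal \<bar>f x y\<bar> \<partial>lborel \<partial>lborel)"
    using assms(1) by (subst lborel.nn_integral_fst[symmetric]) auto
  then show "(\<integral>\<^sup>+z. ennreal (norm (case_prod f z)) \<partial>(lborel \<Otimes>\<^sub>M lborel)) < \<infinity>"
    using assms(2) by simp
qed (rule assms(1))

lemma nn_integral_scaleR:
  fixes G :: "'n::euclidean_space \<Rightarrow> ennreal"
  assumes [measurable]: "G \<in> borel_measurable borel" and c: "c > 0"
  shows "(\<integral>\<^sup>+x. G x \<partial>lborel) = ennreal (c ^ DIM('n)) * (\<integral>\<^sup>+x. G (c *\<^sub>R x) \<partial>lborel)"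
  using c by (subst lborel_affine[of c 0])
    (simp_all add: nn_integral_density nn_integral_distr nn_integral_cmult)

lemma integral_scaleR:
  fixes G :: "'n::euclidean_space \<Rightarrow> real"
  assumes [measurable]: "G \<in> borel_measurable borel" and c: "c > 0"
  shows "(LBINT x. G x) = c ^ DIM('n) * (LBINT x. G (c *\<^sub>R x))"
  using c by (subst lborel_affine[of c 0])
    (simp_all add: integral_density integral_distr)

lemma integrable_scaleR:
  fixes G :: "'n::euclidean_space \<Rightarrow> 'b::{banach, second_countable_topology}"
  assumes G: "integrable lborel G" and c: "c > 0"
  shows "integrable lborel (\<lambda>x. G (c *\<^sub>R x))"
proof -
  have [measurable]: "G \<in> borel_measurable borel" using G by auto
  have "(\<integral>\<^sup>+x. ennreal (norm (G x)) \<partial>lborel) < \<infinity>"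
    using G by (simp add: integrable_iff_bounded)
  then have "(\<integral>\<^sup>+x. ennreal (norm (G (c *\<^sub>R x))) \<partial>lborel) < \<infinity>"
    using c by (subst (asm) nn_integral_scaleR[OF _ c]) (auto simp: ennreal_mult_less_top)
  then show ?thesis by (intro integrableI_bounded) auto
qed

text \<open>The measure \<open>dl / l\<close> is invariant under scaling. With
  \<open>r = norm y\<close> the interval consists of the \<open>l\<close> for which \<open>y\<close>
  divided by \<open>l\<close> lies in the shell below, so each \<open>y\<close> is counted with the
  same mass.\<close>

lemma nn_integral_inverse_interval:
  fixes r :: real
  assumes r: "r > 0"
  shows "(\<integral>\<^sup>+l. ennreal (indicator {0<..} l * inverse l) * indicator {r<..<2 * r} l \<partial>lborel) = ennreal (ln 2)"
proof -
  let ?f = "\<lambda>l::real. indicator {0<..} l * inverse l"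
  have d: "((\<lambda>x. ln x) has_real_derivative ?f x) (at x)" if "r \<le> x" for x
    using that r by (auto intro!: derivative_eq_intros simp: divide_inverse)
  have "(\<integral>\<^sup>+l. ennreal (?f l) * indicator {r<..<2 * r} l \<partial>lborel) = (\<integral>\<^sup>+l. ennreal (?f l) * indicator {r..2 * r} l \<partial>lborel)"
  proof (rule nn_integral_cong_AE)
    show "AE l in lborel. ennreal (?f l) * indicator {r<..<2 * r} l = ennreal (?f l) * indicator {r..2 * r} l"
      using AE_lborel_singleton[of r] AE_lborel_singleton[of "2 * r"]
      by eventually_elim (auto simp: indicator_def)
  qed
  also have "\<dots> = ennreal (ln (2 * r) - ln r)"
    by (rule nn_integral_FTC_Icc) (use d r in auto)
  also have "ln (2 * r) - ln r = ln 2" using r by (simp add: ln_mult)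
  finally show ?thesis .
qed

definition shell :: "'n::euclidean_space set" where
  "shell = {x. 1 / 2 < norm x \<and> norm x < 1}"

lemma shell_sets [measurable]: "shell \<in> sets borel"
  unfolding shell_def by measurable

text \<open>Polar coordinates without a surface measure: each direction is represented by the points of
  the shell on it, and the ray through \<open>x\<close> is \<open>l \<mapsto> l x\<close>. The constant is the mass of the shell
  with respect to \<open>dr / r\<close>.\<close>

lemma nn_integral_shell_rays:
  fixes G :: "'n::euclidean_space \<Rightarrow> ennreal"
  assumes [measurable]: "G \<in> borel_measurable borel"
  shows "(\<integral>\<^sup>+x. indicator shell x * (\<integral>\<^sup>+l. ennreal (indicator {0<..} l * l ^ (DIM('n) - 1)) * G (l *\<^sub>R x) \<partial>lborel) \<partial>lborel)
      = ennreal (ln 2) * (\<integral>\<^sup>+y. G y \<partial>lborel)" (is "?L = _")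
proof -
  let ?N = "DIM('n)"
  have "?L = (\<integral>\<^sup>+x. \<integral>\<^sup>+l. indicator shell x * (ennreal (indicator {0<..} l * l ^ (?N - 1)) * G (l *\<^sub>R x)) \<partial>lborel \<partial>lborel)"
    by (intro nn_integral_cong, subst nn_integral_cmult) auto
  also have "\<dots> = (\<integral>\<^sup>+l. \<integral>\<^sup>+x. indicator shell x * (ennreal (indicator {0<..} l * l ^ (?N - 1)) * G (l *\<^sub>R x)) \<partial>lborel \<partial>lborel)"
    by (rule lborel_pair.Fubini'[symmetric]) measurable
  \<comment> \<open>Substitution \<open>y = l x\<close> for fixed \<open>l\<close>: the condition
    \<open>x \<in> shell\<close> becomes \<open>norm y < l < 2 * norm y\<close>, and the Jacobian
    leaves \<open>inverse l\<close> of the power \<open>l ^ (N - 1)\<close>.\<close>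
  also have "\<dots> = (\<integral>\<^sup>+l. \<integral>\<^sup>+y. ennreal (indicator {0<..} l * inverse l) * (indicator {norm y<..<2 * norm y} l * G y) \<partial>lborel \<partial>lborel)"
  proof (rule nn_integral_cong)
    fix l :: real
    show "(\<integral>\<^sup>+x. indicator shell x * (ennreal (indicator {0<..} l * l ^ (?N - 1)) * G (l *\<^sub>R x)) \<partial>lborel)
      = (\<integral>\<^sup>+y. ennreal (indicator {0<..} l * inverse l) * (indicator {norm y<..<2 * norm y} l * G y) \<partial>lborel)"
    proof (cases "l > 0")
      case True
      have "(\<integral>\<^sup>+y. ennreal (inverse l) * (indicator {norm y<..<2 * norm y} l * G y) \<partial>lborel)
        = ennreal (l ^ ?N) * (\<integral>\<^sup>+x. ennreal (inverse l) * (indicator {norm (l *\<^sub>R x)<..<2 * norm (l *\<^sub>R x)} l * G (l *\<^sub>R x)) \<partial>lborel)"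
        by (rule nn_integral_scaleR[OF _ True]) (simp add: indicator_def greaterThanLessThan_iff, measurable)
      also have "\<dots> = (\<integral>\<^sup>+x. ennreal (l ^ ?N) * (ennreal (inverse l) * (indicator {norm (l *\<^sub>R x)<..<2 * norm (l *\<^sub>R x)} l * G (l *\<^sub>R x))) \<partial>lborel)"
        by (rule nn_integral_cmult[symmetric]) (simp add: indicator_def greaterThanLessThan_iff, measurable)
      also have "\<dots> = (\<integral>\<^sup>+x. indicator shell x * (ennreal (l ^ (?N - 1)) * G (l *\<^sub>R x)) \<partial>lborel)"
      proof (rule nn_integral_cong)
        fix x :: 'n
        have "ennreal (l ^ ?N) * ennreal (inverse l) = ennreal (l ^ (?N - 1))"
          using True power_minus_mult[of ?N l] by (simp add: ennreal_mult[symmetric] field_simps)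
        moreover have "(indicator {norm (l *\<^sub>R x)<..<2 * norm (l *\<^sub>R x)} l :: ennreal) = indicator shell x"
          using True by (auto simp: indicator_def shell_def)
        moreover have "a * (b * (c * d)) = c * ((a * b) * d)" for a b c d :: ennreal
          by (simp only: mult_ac)
        ultimately show "ennreal (l ^ ?N) * (ennreal (inverse l) * (indicator {norm (l *\<^sub>R x)<..<2 * norm (l *\<^sub>R x)} l * G (l *\<^sub>R x)))
          = indicator shell x * (ennreal (l ^ (?N - 1)) * G (l *\<^sub>R x))"
          by simp
      qed
      finally show ?thesis using True by simp
    qed simp
  qed
  also have "\<dots> = (\<integral>\<^sup>+y. \<integral>\<^sup>+l. ennreal (indicator {0<..} l * inverse l) * (indicator {norm y<..<2 * norm y} l * G y) \<partial>lborel \<partial>lborel)"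
    by (rule lborel_pair.Fubini') (simp add: indicator_def greaterThanLessThan_iff, measurable)
  also have "\<dots> = (\<integral>\<^sup>+y. ennreal (ln 2) * G y \<partial>lborel)"
  proof (rule nn_integral_cong_AE)
    show "AE y in lborel. (\<integral>\<^sup>+l. ennreal (indicator {0<..} l * inverse l) * (indicator {norm y<..<2 * norm y} l * G y) \<partial>lborel) = ennreal (ln 2) * G y"
      using AE_lborel_singleton[of 0]
    proof eventually_elim
      case (elim y)
      have "(\<integral>\<^sup>+l. ennreal (indicator {0<..} l * inverse l) * (indicator {norm y<..<2 * norm y} l * G y) \<partial>lborel)
        = (\<integral>\<^sup>+l. ennreal (indicator {0<..} l * inverse l) * indicator {norm y<..<2 * norm y} l * G y \<partial>lborel)"
        by (simp add: mult.assoc)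
      also have "\<dots> = (\<integral>\<^sup>+l. ennreal (indicator {0<..} l * inverse l) * indicator {norm y<..<2 * norm y} l \<partial>lborel) * G y"
        by (rule nn_integral_multc) measurable
      finally show ?case using elim by (simp add: nn_integral_inverse_interval)
    qed
  qed
  also have "\<dots> = ennreal (ln 2) * (\<integral>\<^sup>+y. G y \<partial>lborel)" by (rule nn_integral_cmult) measurable
  finally show ?thesis .
qed

lemma AE_integrable_rays:
  fixes G :: "'n::euclidean_space \<Rightarrow> real"
  assumes G: "integrable lborel G"
  shows "AE x in lborel. x \<in> shell \<longrightarrow> integrable lborel (\<lambda>l. indicator {0<..} l * l ^ (DIM('n) - 1) * G (l *\<^sub>R x))"
proof -
  have [measurable]: "G \<in> borel_measurable borel" using G by auto
  have "(\<integral>\<^sup>+y. ennreal \<bar>G y\<bar> \<partial>lborel) < \<infinity>" using G by (simp add: integrable_iff_bounded)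
  then have fin: "(\<integral>\<^sup>+x. indicator (shell :: 'n set) x * (\<integral>\<^sup>+l. ennreal (indicator {0<..} l * l ^ (DIM('n) - 1)) * ennreal \<bar>G (l *\<^sub>R x)\<bar> \<partial>lborel) \<partial>lborel) \<noteq> \<infinity>"
    using nn_integral_shell_rays[of "\<lambda>y. ennreal \<bar>G y\<bar>"] by (simp add: ennreal_mult_eq_top_iff)
  have "AE x in lborel. indicator (shell :: 'n set) x * (\<integral>\<^sup>+l. ennreal (indicator {0<..} l * l ^ (DIM('n) - 1)) * ennreal \<bar>G (l *\<^sub>R x)\<bar> \<partial>lborel) \<noteq> \<infinity>"
    by (rule nn_integral_PInf_AE[OF _ fin]) measurable
  then show ?thesis
  proof eventually_elim
    case (elim x)
    show ?case
    proof
      assume x: "x \<in> shell"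
      have *: "ennreal (norm (indicator {0<..} l * l ^ (DIM('n) - 1) * G (l *\<^sub>R x))) = ennreal (indicator {0<..} l * l ^ (DIM('n) - 1)) * ennreal \<bar>G (l *\<^sub>R x)\<bar>" for l
        by (subst ennreal_mult[symmetric]) (auto simp: abs_mult indicator_def)
      show "integrable lborel (\<lambda>l. indicator {0<..} l * l ^ (DIM('n) - 1) * G (l *\<^sub>R x))"
        by (rule integrableI_bounded, measurable, unfold *) (use elim x in \<open>simp add: less_top\<close>)
    qed
  qed
qed

lemma enn2real_inj: "enn2real a = enn2real b \<Longrightarrow> a \<noteq> \<infinity> \<Longrightarrow> b \<noteq> \<infinity> \<Longrightarrow> a = b"
  by (cases a; cases b) simp_all

text \<open>The polar formula is stated for nonnegative functions, so positive and negative parts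
  are compared: on almost every ray both are finite and equal, hence they are equal in
  total.\<close>

lemma integral_zero_if_rays_zero:
  fixes G :: "'n::euclidean_space \<Rightarrow> real"
  assumes G: "integrable lborel G"
    and rays: "AE x in lborel. x \<in> shell \<longrightarrow> (LBINT l. indicator {0<..} l * l ^ (DIM('n) - 1) * G (l *\<^sub>R x)) = 0"
  shows "(LBINT y. G y) = 0"
proof -
  have [measurable]: "G \<in> borel_measurable borel" using G by auto
  have "(\<integral>\<^sup>+x. indicator shell x * (\<integral>\<^sup>+l. ennreal (indicator {0<..} l * l ^ (DIM('n) - 1)) * ennreal (G (l *\<^sub>R x)) \<partial>lborel) \<partial>lborel)
      = (\<integral>\<^sup>+x. indicator (shell :: 'n set) x * (\<integral>\<^sup>+l. ennreal (indicator {0<..} l * l ^ (DIM('n) - 1)) * ennreal (- G (l *\<^sub>R x)) \<partial>lborel) \<partial>lborel)"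
  proof (rule nn_integral_cong_AE)
    show "AE x in lborel. indicator (shell :: 'n set) x * (\<integral>\<^sup>+l. ennreal (indicator {0<..} l * l ^ (DIM('n) - 1)) * ennreal (G (l *\<^sub>R x)) \<partial>lborel)
      = indicator shell x * (\<integral>\<^sup>+l. ennreal (indicator {0<..} l * l ^ (DIM('n) - 1)) * ennreal (- G (l *\<^sub>R x)) \<partial>lborel)"
      using rays AE_integrable_rays[OF G]
    proof eventually_elim
      case (elim x)
      show ?case
      proof (cases "x \<in> shell")
        case True
        let ?R = "\<lambda>l. indicator {0<..} l * l ^ (DIM('n) - 1) * G (l *\<^sub>R x)"
        have pn: "ennreal (indicator {0<..} l * l ^ (DIM('n) - 1)) * ennreal (G (l *\<^sub>R x)) = ennreal (?R l)"
          "ennreal (indicator {0<..} l * l ^ (DIM('n) - 1)) * ennreal (- G (l *\<^sub>R x)) = ennreal (- ?R l)" for l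
        proof -
          have "0 \<le> indicator {0<..} l * l ^ (DIM('n) - 1)" by (auto simp: indicator_def)
          from ennreal_mult'[OF this, of "G (l *\<^sub>R x)"] ennreal_mult'[OF this, of "- G (l *\<^sub>R x)"]
          show "ennreal (indicator {0<..} l * l ^ (DIM('n) - 1)) * ennreal (G (l *\<^sub>R x)) = ennreal (?R l)"
            "ennreal (indicator {0<..} l * l ^ (DIM('n) - 1)) * ennreal (- G (l *\<^sub>R x)) = ennreal (- ?R l)"
            by (simp_all only: mult_minus_right)
        qed
        have i: "integrable lborel ?R" using elim True by blast
        have "enn2real (\<integral>\<^sup>+l. ennreal (?R l) \<partial>lborel) = enn2real (\<integral>\<^sup>+l. ennreal (- ?R l) \<partial>lborel)"
          using elim True real_lebesgue_integral_def[OF i] by simp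
        moreover have "(\<integral>\<^sup>+l. ennreal (?R l) \<partial>lborel) \<noteq> \<infinity>" "(\<integral>\<^sup>+l. ennreal (- ?R l) \<partial>lborel) \<noteq> \<infinity>"
          using real_integrable_def[of lborel ?R] i by auto
        ultimately have "(\<integral>\<^sup>+l. ennreal (?R l) \<partial>lborel) = (\<integral>\<^sup>+l. ennreal (- ?R l) \<partial>lborel)"
          by (intro enn2real_inj)
        then show ?thesis unfolding pn by simp
      qed simp
    qed
  qed
  then have "ennreal (ln 2) * (\<integral>\<^sup>+y. ennreal (G y) \<partial>lborel) = ennreal (ln 2) * (\<integral>\<^sup>+y. ennreal (- G y) \<partial>lborel)"
    using nn_integral_shell_rays[of "\<lambda>y. ennreal (G y)"] nn_integral_shell_rays[of "\<lambda>y. ennreal (- G y)"] by simp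
  then have "(\<integral>\<^sup>+y. ennreal (G y) \<partial>lborel) = (\<integral>\<^sup>+y. ennreal (- G y) \<partial>lborel)"
    unfolding ennreal_mult_cancel_left by simp
  then show ?thesis using real_lebesgue_integral_def[OF G] by simp
qed

section \<open>Weak derivatives along dilations\<close>

lemma smooth_fun_inner: "smooth_fun (\<lambda>x. x \<bullet> v)"
  unfolding smooth_fun_def by (intro allI Ck_fun_inner)

lemma integrable_mult_bounded:
  fixes f \<phi> :: "'n::euclidean_space \<Rightarrow> real"
  assumes "integrable lborel f" "\<phi> \<in> borel_measurable borel" "\<And>x. \<bar>\<phi> x\<bar> \<le> C"
  shows "integrable lborel (\<lambda>x. f x * \<phi> x)"
proof (rule Bochner_Integration.integrable_bound)
  show "integrable lborel (\<lambda>x. C * f x)" using assms(1) by simp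
  show "AE x in lborel. norm (f x * \<phi> x) \<le> norm (C * f x)"
  proof (intro AE_I2)
    fix x
    have "\<bar>f x\<bar> * \<bar>\<phi> x\<bar> \<le> \<bar>f x\<bar> * \<bar>C\<bar>" using assms(3)[of x] by (intro mult_left_mono) auto
    then show "norm (f x * \<phi> x) \<le> norm (C * f x)" by (simp add: abs_mult mult.commute)
  qed
qed (use assms in auto)

text \<open>Substituting \<open>y = l x\<close> moves the dilation from \<open>v (l x)\<close> to
  the test function, which becomes \<open>\<phi> (y / l) / l ^ N\<close>. Its derivative in
  \<open>l\<close> is \<open>- 1 / l ^ (N + 1)\<close> times the divergence of the vector field
  \<open>y \<phi> (y / l)\<close>, and a divergence is what a weak gradient can be paired
  with.\<close>

lemma dilation_derivative:
  fixes \<phi> :: "'n::euclidean_space \<Rightarrow> real"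
  assumes \<phi>: "smooth_fun \<phi>" and l: "l > 0"
  shows "((\<lambda>l. \<phi> ((1 / l) *\<^sub>R y) / l ^ N) has_real_derivative
      - (real N * \<phi> ((1 / l) *\<^sub>R y) / l ^ (N + 1)
        + (\<Sum>i\<in>Basis. (y \<bullet> i) * partial_deriv i \<phi> ((1 / l) *\<^sub>R y)) / l ^ (N + 2))) (at l)"
proof -
  have 1: "((\<lambda>l. (1 / l) *\<^sub>R y) has_derivative (\<lambda>k. (- (1 / l ^ 2) * k) *\<^sub>R y)) (at l)"
    using l by (auto intro!: derivative_eq_intros simp: power2_eq_square field_simps)
  have "((\<lambda>l. \<phi> ((1 / l) *\<^sub>R y)) has_derivative
      (\<lambda>k. \<Sum>i\<in>Basis. (((- (1 / l ^ 2) * k) *\<^sub>R y) \<bullet> i) * partial_deriv i \<phi> ((1 / l) *\<^sub>R y))) (at l)"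
    by (rule has_derivative_compose[OF 1 smooth_fun_has_derivative[OF \<phi>]])
  moreover have "(\<lambda>k. \<Sum>i\<in>Basis. (((- (1 / l ^ 2) * k) *\<^sub>R y) \<bullet> i) * partial_deriv i \<phi> ((1 / l) *\<^sub>R y))
     = (*) (- (1 / l ^ 2) * (\<Sum>i\<in>Basis. (y \<bullet> i) * partial_deriv i \<phi> ((1 / l) *\<^sub>R y)))"
    by (rule ext) (simp add: sum_distrib_left sum_distrib_right mult_ac)
  ultimately have 2: "((\<lambda>l. \<phi> ((1 / l) *\<^sub>R y)) has_real_derivative
      - (1 / l ^ 2) * (\<Sum>i\<in>Basis. (y \<bullet> i) * partial_deriv i \<phi> ((1 / l) *\<^sub>R y))) (at l)"
    by (simp add: has_field_derivative_def)
  have 3: "((\<lambda>l. inverse (l ^ N)) has_real_derivative - (real N / l ^ (N + 1))) (at l)"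
    by (rule DERIV_cong[OF DERIV_inverse'[OF DERIV_pow]])
       (use l in \<open>cases N; simp add: field_simps\<close>)+
  show ?thesis
    unfolding divide_inverse[of "\<phi> _"]
    by (rule DERIV_cong[OF DERIV_mult[OF 2 3]]) (use l in \<open>simp add: field_simps power2_eq_square\<close>)
qed

text \<open>A function with its weak gradient, both Borel, in L^1 and extended by zero, so that
  dilations and rays can leave the ball without case distinctions.\<close>

locale weak_pair =
  fixes v :: "'n::euclidean_space \<Rightarrow> real" and h :: "'n \<Rightarrow> 'n"
  assumes v_int: "integrable lborel v" and h_int: "integrable lborel h"
    and v_out: "\<And>x. x \<notin> ball 0 1 \<Longrightarrow> v x = 0" and h_out: "\<And>x. x \<notin> ball 0 1 \<Longrightarrow> h x = 0"
    and weak: "\<And>\<phi> i. test_fun (ball 0 1) \<phi> \<Longrightarrow> i \<in> Basis \<Longrightarrow>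
      (LBINT x. v x * partial_deriv i \<phi> x) = - (LBINT x. (h x \<bullet> i) * \<phi> x)"
begin

lemma v_meas [measurable]: "v \<in> borel_measurable borel" using v_int by auto
lemma h_meas [measurable]: "h \<in> borel_measurable borel" using h_int by auto

text \<open>The weak gradient is tested with the components \<open>\<xi> i\<close> of the field
  \<open>y \<phi> (y / l)\<close> and the results are added. The radius \<open>1 / t\<close> keeps
  the dilated supports in the unit ball for all \<open>l \<le> t\<close>.\<close>

lemma weak_dilation:
  assumes \<phi>: "test_fun (ball 0 (1 / t)) \<phi>" and l: "0 < l" "l \<le> t"
  shows "(LBINT y. v y * - (real DIM('n) * \<phi> ((1 / l) *\<^sub>R y) / l ^ (DIM('n) + 1)
        + (\<Sum>i\<in>Basis. (y \<bullet> i) * partial_deriv i \<phi> ((1 / l) *\<^sub>R y)) / l ^ (DIM('n) + 2)))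
    = (LBINT x. (h (l *\<^sub>R x) \<bullet> x) * \<phi> x)" (is "?L = ?R")
proof -
  let ?N = "DIM('n)"
  define \<xi> where "\<xi> i y = (y \<bullet> i) * \<phi> ((1 / l) *\<^sub>R y)" for i y
  have s\<phi>: "smooth_fun \<phi>" using \<phi> by (simp add: test_fun_def)
  have [measurable]: "\<phi> \<in> borel_measurable borel"
    by (intro borel_measurable_continuous_onI smooth_fun_continuous s\<phi>)
  have "l *\<^sub>R x \<in> ball 0 1" if "x \<in> ball 0 (1 / t)" for x :: 'n
  proof -
    have "t * norm x < 1" using that l by (simp add: field_simps)
    moreover have "l * norm x \<le> t * norm x" using l by (intro mult_right_mono) auto
    ultimately show ?thesis using l by simp
  qed
  then have t\<xi>: "test_fun (ball 0 1) (\<xi> i)" for i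
    unfolding \<xi>_def by (intro test_fun_mult test_fun_scaleR[OF \<phi>] smooth_fun_inner l(1)) auto
  have d\<xi>: "partial_deriv i (\<xi> i) y = \<phi> ((1 / l) *\<^sub>R y) + (y \<bullet> i) * partial_deriv i \<phi> ((1 / l) *\<^sub>R y) / l"
    if i: "i \<in> Basis" for i y
  proof -
    have 1: "((\<lambda>y::'n. (1 / l) *\<^sub>R y) has_derivative (\<lambda>k. (1 / l) *\<^sub>R k)) (at y)"
      by (auto intro!: derivative_eq_intros)
    have 2: "((\<lambda>y::'n. y \<bullet> i) has_derivative (\<lambda>k. k \<bullet> i)) (at y)"
      by (auto intro!: derivative_eq_intros)
    note d = has_derivative_mult[OF 2 has_derivative_compose[OF 1 smooth_fun_has_derivative[OF s\<phi>]]]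
    have "(\<Sum>j\<in>Basis. ((1 / l) *\<^sub>R i \<bullet> j) * partial_deriv j \<phi> ((1 / l) *\<^sub>R y)) = partial_deriv i \<phi> ((1 / l) *\<^sub>R y) / l"
      using i by (simp add: inner_Basis if_distrib if_distribR sum.delta cong: if_cong)
    then show ?thesis
      unfolding \<xi>_def[abs_def] partial_deriv_eq[OF d] using i by (simp add: inner_Basis)
  qed
  have iv: "integrable lborel (\<lambda>y. v y * partial_deriv i (\<xi> i) y)" if i: "i \<in> Basis" for i
  proof -
    obtain C where "\<And>x. \<bar>partial_deriv i (\<xi> i) x\<bar> \<le> C" using test_fun_partial_bounded[OF t\<xi> i] by metis
    then show ?thesis
      using t\<xi>[of i] i by (intro integrable_mult_bounded[OF v_int] borel_measurable_continuous_onI smooth_fun_partial_continuous)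
        (auto simp: test_fun_def)
  qed
  have ih: "integrable lborel (\<lambda>y. (h y \<bullet> i) * \<xi> i y)" for i
  proof -
    obtain C where "\<And>x. \<bar>\<xi> i x\<bar> \<le> C" using test_fun_bounded[OF t\<xi>] by metis
    then show ?thesis
      using t\<xi>[of i] h_int by (intro integrable_mult_bounded borel_measurable_continuous_onI smooth_fun_continuous integrable_inner_left)
        (auto simp: test_fun_def)
  qed
  have sum_d: "(\<Sum>i\<in>Basis. partial_deriv i (\<xi> i) y)
      = real ?N * \<phi> ((1 / l) *\<^sub>R y) + (\<Sum>i\<in>Basis. (y \<bullet> i) * partial_deriv i \<phi> ((1 / l) *\<^sub>R y)) / l" for y
    by (simp add: d\<xi> sum.distrib sum_divide_distrib)
  have "?L = (LBINT y. - (1 / l ^ (?N + 1)) * (\<Sum>i\<in>Basis. v y * partial_deriv i (\<xi> i) y))"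
    unfolding sum_distrib_left[symmetric] sum_d using l
    by (intro Bochner_Integration.integral_cong refl) (simp add: field_simps)
  also have "\<dots> = - (1 / l ^ (?N + 1)) * (\<Sum>i\<in>Basis. LBINT y. v y * partial_deriv i (\<xi> i) y)"
    using iv by (simp add: Bochner_Integration.integral_sum)
  also have "\<dots> = (1 / l ^ (?N + 1)) * (\<Sum>i\<in>Basis. LBINT y. (h y \<bullet> i) * \<xi> i y)"
    using weak[OF t\<xi>] by (simp add: sum_negf)
  also have "\<dots> = (1 / l ^ (?N + 1)) * (LBINT y. (\<Sum>i\<in>Basis. (h y \<bullet> i) * \<xi> i y))"
    using ih by (simp add: Bochner_Integration.integral_sum)
  also have "(\<lambda>y. (\<Sum>i\<in>Basis. (h y \<bullet> i) * \<xi> i y)) = (\<lambda>y. (h y \<bullet> y) * \<phi> ((1 / l) *\<^sub>R y))"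
  proof
    fix y
    have "(\<Sum>i\<in>Basis. (h y \<bullet> i) * \<xi> i y) = (\<Sum>i\<in>Basis. (h y \<bullet> i) * (y \<bullet> i)) * \<phi> ((1 / l) *\<^sub>R y)"
      by (simp add: \<xi>_def sum_distrib_right mult.assoc)
    then show "(\<Sum>i\<in>Basis. (h y \<bullet> i) * \<xi> i y) = (h y \<bullet> y) * \<phi> ((1 / l) *\<^sub>R y)"
      by (simp only: euclidean_inner[of "h y" y, symmetric])
  qed
  also have "(LBINT y. (h y \<bullet> y) * \<phi> ((1 / l) *\<^sub>R y))
      = l ^ ?N * (LBINT x. (h (l *\<^sub>R x) \<bullet> (l *\<^sub>R x)) * \<phi> ((1 / l) *\<^sub>R (l *\<^sub>R x)))"
    by (rule integral_scaleR) (use l in measurable)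
  also have "(LBINT x. (h (l *\<^sub>R x) \<bullet> (l *\<^sub>R x)) * \<phi> ((1 / l) *\<^sub>R (l *\<^sub>R x))) = l * ?R"
    using l by (simp add: mult.assoc)
  finally show ?thesis using l by simp
qed

text \<open>Licence for Fubini: by scaling, the L^1 norm of \<open>h (l x)\<close> is
  \<open>l\<close> to the power \<open>- N\<close> times that of \<open>h\<close>, which is bounded
  for \<open>l \<ge> s > 0\<close>.\<close>

lemma pair_h_integrable:
  fixes \<theta> :: "'n \<Rightarrow> real"
  assumes [measurable]: "\<theta> \<in> borel_measurable borel" and b: "\<And>x. \<bar>\<theta> x\<bar> \<le> C" "\<And>x. x \<notin> ball 0 R \<Longrightarrow> \<theta> x = 0"
    and s: "0 < s" and R: "R > 0"
  shows "integrable (lborel \<Otimes>\<^sub>M lborel) (\<lambda>(l, x). indicator {s..t} l * ((h (l *\<^sub>R x) \<bullet> x) * \<theta> x))"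
proof (rule integrable_pairI)
  let ?N = "DIM('n)"
  have C: "C \<ge> 0" using b(1)[of 0] by linarith
  obtain K where K: "(\<integral>\<^sup>+x. ennreal (norm (h x)) \<partial>lborel) = ennreal K" "K \<ge> 0"
    using h_int by (auto simp: integrable_iff_bounded less_top_ennreal)
  have "(\<integral>\<^sup>+x. ennreal \<bar>indicator {s..t} l * ((h (l *\<^sub>R x) \<bullet> x) * \<theta> x)\<bar> \<partial>lborel)
      \<le> ennreal (R * C * (1 / s ^ ?N) * K) * indicator {s..t} l" for l
  proof (cases "l \<in> {s..t}")
    case True
    then have l: "l > 0" using s by simp
    have "(\<integral>\<^sup>+x. ennreal \<bar>indicator {s..t} l * ((h (l *\<^sub>R x) \<bullet> x) * \<theta> x)\<bar> \<partial>lborel)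
      \<le> (\<integral>\<^sup>+x. ennreal (R * C) * ennreal (norm (h (l *\<^sub>R x))) \<partial>lborel)"
    proof (rule nn_integral_mono)
      fix x
      have "\<bar>(h (l *\<^sub>R x) \<bullet> x) * \<theta> x\<bar> \<le> R * C * norm (h (l *\<^sub>R x))"
      proof (cases "x \<in> ball 0 R")
        case True
        have "\<bar>h (l *\<^sub>R x) \<bullet> x\<bar> \<le> norm (h (l *\<^sub>R x)) * norm x" by (rule Cauchy_Schwarz_ineq2)
        also have "\<dots> \<le> norm (h (l *\<^sub>R x)) * R" using True by (intro mult_left_mono) auto
        finally have "\<bar>h (l *\<^sub>R x) \<bullet> x\<bar> * \<bar>\<theta> x\<bar> \<le> (norm (h (l *\<^sub>R x)) * R) * C"
          using b(1)[of x] R by (intro mult_mono) auto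
        then show ?thesis by (simp add: abs_mult mult_ac)
      qed (use b(2) R C in simp)
      then show "ennreal \<bar>indicator {s..t} l * ((h (l *\<^sub>R x) \<bullet> x) * \<theta> x)\<bar> \<le> ennreal (R * C) * ennreal (norm (h (l *\<^sub>R x)))"
        using True R C by (simp add: ennreal_mult[symmetric] ennreal_leI)
    qed
    also have "\<dots> = ennreal (R * C) * (\<integral>\<^sup>+x. ennreal (norm (h (l *\<^sub>R x))) \<partial>lborel)"
      by (rule nn_integral_cmult) measurable
    also have "(\<integral>\<^sup>+x. ennreal (norm (h (l *\<^sub>R x))) \<partial>lborel) \<le> ennreal (1 / s ^ ?N * K)"
    proof -
      have "ennreal (s ^ ?N) * (\<integral>\<^sup>+x. ennreal (norm (h (l *\<^sub>R x))) \<partial>lborel)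
          \<le> ennreal (l ^ ?N) * (\<integral>\<^sup>+x. ennreal (norm (h (l *\<^sub>R x))) \<partial>lborel)"
        using True s by (intro mult_right_mono ennreal_leI power_mono) auto
      also have "\<dots> = ennreal K" using nn_integral_scaleR[of "\<lambda>x. ennreal (norm (h x))" l] K l by simp
      finally have "ennreal (1 / s ^ ?N) * (ennreal (s ^ ?N) * (\<integral>\<^sup>+x. ennreal (norm (h (l *\<^sub>R x))) \<partial>lborel))
          \<le> ennreal (1 / s ^ ?N) * ennreal K" by (intro mult_left_mono) auto
      then show ?thesis using s K by (simp add: mult.assoc[symmetric] ennreal_mult[symmetric])
    qed
    finally show ?thesis using True R C K s
      by (simp add: ennreal_mult[symmetric] mult_left_mono mult.assoc)
  qed simp
  then have "(\<integral>\<^sup>+l. \<integral>\<^sup>+x. ennreal \<bar>indicator {s..t} l * ((h (l *\<^sub>R x) \<bullet> x) * \<theta> x)\<bar> \<partial>lborel \<partial>lborel)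
     \<le> (\<integral>\<^sup>+l. ennreal (R * C * (1 / s ^ ?N) * K) * indicator {s..t} l \<partial>lborel)"
    by (intro nn_integral_mono)
  also have "\<dots> < \<infinity>" by (cases "s \<le> t"; subst nn_integral_cmult) (auto simp: ennreal_mult_less_top)
  finally show "(\<integral>\<^sup>+l. \<integral>\<^sup>+x. ennreal \<bar>indicator {s..t} l * ((h (l *\<^sub>R x) \<bullet> x) * \<theta> x)\<bar> \<partial>lborel \<partial>lborel) < \<infinity>" .
qed measurable

text \<open>The derivative in \<open>l\<close> of the integral of \<open>v (l x) * \<phi> x\<close>
  is taken on the test function, where it is classical; \<open>weak_dilation\<close> brings it back
  to \<open>h\<close>, and Fubini exchanges \<open>l\<close> and \<open>x\<close>.\<close>

lemma dilation_test:
  assumes \<phi>: "test_fun (ball 0 (1 / t)) \<phi>" and st: "0 < s" "s \<le> t"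
  shows "(LBINT x. v (t *\<^sub>R x) * \<phi> x) - (LBINT x. v (s *\<^sub>R x) * \<phi> x)
    = (LBINT x. (LBINT l. indicator {s..t} l * ((h (l *\<^sub>R x) \<bullet> x) * \<phi> x)))"
proof -
  let ?N = "DIM('n)"
  define \<Psi> where "\<Psi> l y = - (real ?N * \<phi> ((1 / l) *\<^sub>R y) / l ^ (?N + 1)
        + (\<Sum>i\<in>Basis. (y \<bullet> i) * partial_deriv i \<phi> ((1 / l) *\<^sub>R y)) / l ^ (?N + 2))" for l y
  have s\<phi>: "smooth_fun \<phi>" using \<phi> by (simp add: test_fun_def)
  have c\<phi>: "continuous_on UNIV \<phi>" by (rule smooth_fun_continuous[OF s\<phi>])
  have cd\<phi>: "continuous_on UNIV (partial_deriv i \<phi>)" if "i \<in> Basis" for i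
    by (rule smooth_fun_partial_continuous[OF s\<phi> that])
  have [measurable]: "\<phi> \<in> borel_measurable borel" by (rule borel_measurable_continuous_onI[OF c\<phi>])
  have [measurable]: "i \<in> Basis \<Longrightarrow> partial_deriv i \<phi> \<in> borel_measurable borel" for i
    by (rule borel_measurable_continuous_onI[OF cd\<phi>])
  have \<Psi>m [measurable]: "(\<lambda>(y, l). \<Psi> l y) \<in> borel_measurable (lborel \<Otimes>\<^sub>M lborel)"
    unfolding \<Psi>_def by measurable
  obtain C0 where C0: "C0 \<ge> 0" "\<And>x. \<bar>\<phi> x\<bar> \<le> C0" using test_fun_bounded[OF \<phi>] by metis
  have "\<forall>i\<in>Basis. \<exists>C\<ge>0. \<forall>x. \<bar>partial_deriv i \<phi> x\<bar> \<le> C"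
    using test_fun_partial_bounded[OF \<phi>] by metis
  then obtain C1 where C1: "\<And>i. i \<in> Basis \<Longrightarrow> 0 \<le> C1 i" "\<And>i x. i \<in> Basis \<Longrightarrow> \<bar>partial_deriv i \<phi> x\<bar> \<le> C1 i"
    by metis
  \<comment> \<open>A bound for \<open>\<Psi>\<close> when \<open>l \<ge> s\<close> and
    \<open>norm y \<le> 1\<close>; for larger \<open>y\<close> the factor \<open>v y\<close>
    vanishes.\<close>
  define C where "C = real ?N * C0 / s ^ (?N + 1) + (\<Sum>i\<in>Basis. C1 i) / s ^ (?N + 2)"
  have C: "C \<ge> 0" unfolding C_def using C0 C1 st by (intro add_nonneg_nonneg divide_nonneg_nonneg sum_nonneg) auto
  have \<Psi>b: "\<bar>\<Psi> l y\<bar> \<le> C" if l: "s \<le> l" and y: "norm y \<le> 1" for l y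
  proof -
    have "\<bar>\<Sum>i\<in>Basis. (y \<bullet> i) * partial_deriv i \<phi> ((1 / l) *\<^sub>R y)\<bar> \<le> (\<Sum>i\<in>Basis. C1 i)"
    proof (rule order_trans[OF sum_abs sum_mono])
      fix i :: 'n assume i: "i \<in> Basis"
      have "\<bar>y \<bullet> i\<bar> * \<bar>partial_deriv i \<phi> ((1 / l) *\<^sub>R y)\<bar> \<le> 1 * C1 i"
        using Basis_le_norm[OF i, of y] y C1(2)[OF i] by (intro mult_mono) auto
      then show "\<bar>(y \<bullet> i) * partial_deriv i \<phi> ((1 / l) *\<^sub>R y)\<bar> \<le> C1 i" by (simp add: abs_mult)
    qed
    then have "\<bar>(\<Sum>i\<in>Basis. (y \<bullet> i) * partial_deriv i \<phi> ((1 / l) *\<^sub>R y)) / l ^ (?N + 2)\<bar> \<le> (\<Sum>i\<in>Basis. C1 i) / s ^ (?N + 2)"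
      unfolding abs_divide using st l C1 by (intro frac_le sum_nonneg) (auto intro!: power_mono mult_mono)
    moreover have "\<bar>real ?N * \<phi> ((1 / l) *\<^sub>R y) / l ^ (?N + 1)\<bar> \<le> real ?N * C0 / s ^ (?N + 1)"
      unfolding abs_divide abs_mult using st l C0 by (intro frac_le mult_mono) (auto intro!: power_mono mult_mono)
    ultimately show ?thesis unfolding \<Psi>_def C_def by linarith
  qed
  have FTC: "\<phi> ((1 / t) *\<^sub>R y) / t ^ ?N - \<phi> ((1 / s) *\<^sub>R y) / s ^ ?N = (LBINT l. \<Psi> l y * indicator {s..t} l)" for y
  proof (rule integral_FTC_Icc_real[OF st(2), symmetric])
    fix l assume l: "s \<le> l" "l \<le> t"
    with st have l0: "l > 0" by simp
    show "((\<lambda>l. \<phi> ((1 / l) *\<^sub>R y) / l ^ ?N) has_real_derivative \<Psi> l y) (at l)"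
      unfolding \<Psi>_def by (rule dilation_derivative[OF s\<phi> l0])
    have "continuous_on {0<..} (\<lambda>l. \<Psi> l y)"
      unfolding \<Psi>_def
      by (auto intro!: continuous_intros continuous_on_compose2[OF c\<phi>] continuous_on_compose2[OF cd\<phi>])
    then show "isCont (\<lambda>l. \<Psi> l y) l" using l0 by (simp add: continuous_on_eq_continuous_at)
  qed
  have scale: "(LBINT x. v (l *\<^sub>R x) * \<phi> x) = (LBINT y. v y * (\<phi> ((1 / l) *\<^sub>R y) / l ^ ?N))" if l: "l > 0" for l
  proof -
    have "(LBINT y. v y * (\<phi> ((1 / l) *\<^sub>R y) / l ^ ?N))
        = l ^ ?N * (LBINT x. v (l *\<^sub>R x) * (\<phi> ((1 / l) *\<^sub>R (l *\<^sub>R x)) / l ^ ?N))"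
      by (rule integral_scaleR) (use l in measurable)
    also have "\<dots> = (LBINT x. v (l *\<^sub>R x) * \<phi> x)" using l by simp
    finally show ?thesis ..
  qed
  have iv: "integrable lborel (\<lambda>y. v y * (\<phi> ((1 / l) *\<^sub>R y) / l ^ ?N))" if "l > 0" for l
    using C0 that by (intro integrable_mult_bounded[OF v_int, of _ "C0 / l ^ ?N"]) (auto simp: abs_mult divide_right_mono)
  have ip: "integrable (lborel \<Otimes>\<^sub>M lborel) (\<lambda>(y, l). v y * (\<Psi> l y * indicator {s..t} l))"
  proof (rule integrable_pairI)
    have "(\<integral>\<^sup>+l. ennreal \<bar>v y * (\<Psi> l y * indicator {s..t} l)\<bar> \<partial>lborel) \<le> ennreal (C * (t - s)) * ennreal \<bar>v y\<bar>" for y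
    proof -
      have "(\<integral>\<^sup>+l. ennreal \<bar>v y * (\<Psi> l y * indicator {s..t} l)\<bar> \<partial>lborel)
        \<le> (\<integral>\<^sup>+l. ennreal (\<bar>v y\<bar> * C) * indicator {s..t} l \<partial>lborel)"
      proof (rule nn_integral_mono)
        fix l
        show "ennreal \<bar>v y * (\<Psi> l y * indicator {s..t} l)\<bar> \<le> ennreal (\<bar>v y\<bar> * C) * indicator {s..t} l"
        proof (cases "norm y \<le> 1 \<and> l \<in> {s..t}")
          case True
          then have "\<bar>v y\<bar> * \<bar>\<Psi> l y\<bar> \<le> \<bar>v y\<bar> * C" using \<Psi>b[of l y] by (intro mult_left_mono) auto
          then show ?thesis using True by (simp add: abs_mult ennreal_leI)
        next
          case False
          then consider "\<not> norm y \<le> 1" | "l \<notin> {s..t}" by blast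
          then show ?thesis using v_out[of y] by cases auto
        qed
      qed
      also have "\<dots> = ennreal (\<bar>v y\<bar> * C) * ennreal (t - s)"
        by (subst nn_integral_cmult_indicator) (use st in simp_all)
      also have "\<dots> = ennreal (C * (t - s)) * ennreal \<bar>v y\<bar>"
        using C st by (simp add: ennreal_mult[symmetric] mult_ac)
      finally show ?thesis .
    qed
    then have "(\<integral>\<^sup>+y. \<integral>\<^sup>+l. ennreal \<bar>v y * (\<Psi> l y * indicator {s..t} l)\<bar> \<partial>lborel \<partial>lborel)
       \<le> (\<integral>\<^sup>+y. ennreal (C * (t - s)) * ennreal \<bar>v y\<bar> \<partial>lborel)" by (rule nn_integral_mono)
    also have "\<dots> = ennreal (C * (t - s)) * (\<integral>\<^sup>+y. ennreal \<bar>v y\<bar> \<partial>lborel)" by (rule nn_integral_cmult) measurable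
    also have "\<dots> < \<infinity>" using v_int by (auto simp: integrable_iff_bounded ennreal_mult_less_top)
    finally show "(\<integral>\<^sup>+y. \<integral>\<^sup>+l. ennreal \<bar>v y * (\<Psi> l y * indicator {s..t} l)\<bar> \<partial>lborel \<partial>lborel) < \<infinity>" .
  qed measurable
  have "(LBINT x. v (t *\<^sub>R x) * \<phi> x) - (LBINT x. v (s *\<^sub>R x) * \<phi> x)
    = (LBINT y. v y * (\<phi> ((1 / t) *\<^sub>R y) / t ^ ?N) - v y * (\<phi> ((1 / s) *\<^sub>R y) / s ^ ?N))"
    using st iv by (simp add: scale Bochner_Integration.integral_diff)
  also have "\<dots> = (LBINT y. (LBINT l. v y * (\<Psi> l y * indicator {s..t} l)))"
    unfolding right_diff_distrib[symmetric] FTC integral_mult_right_zero ..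
  also have "\<dots> = (LBINT l. (LBINT y. v y * (\<Psi> l y * indicator {s..t} l)))"
    by (rule lborel_pair.Fubini_integral[symmetric]) (use ip in simp)
  also have "\<dots> = (LBINT l. (LBINT x. indicator {s..t} l * ((h (l *\<^sub>R x) \<bullet> x) * \<phi> x)))"
  proof (rule Bochner_Integration.integral_cong[OF refl])
    fix l
    show "(LBINT y. v y * (\<Psi> l y * indicator {s..t} l)) = (LBINT x. indicator {s..t} l * ((h (l *\<^sub>R x) \<bullet> x) * \<phi> x))"
    proof (cases "l \<in> {s..t}")
      case True
      then show ?thesis using weak_dilation[OF \<phi>, of l] st by (simp add: \<Psi>_def)
    qed simp
  qed
  also have "\<dots> = (LBINT x. (LBINT l. indicator {s..t} l * ((h (l *\<^sub>R x) \<bullet> x) * \<phi> x)))"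
  proof (rule lborel_pair.Fubini_integral[symmetric])
    show "integrable (lborel \<Otimes>\<^sub>M lborel) (\<lambda>(l, x). indicator {s..t} l * ((h (l *\<^sub>R x) \<bullet> x) * \<phi> x))"
    proof (rule pair_h_integrable[where R="1 / t" and C=C0])
      show "\<phi> x = 0" if "x \<notin> ball 0 (1 / t)" for x by (rule test_fun_outside[OF \<phi> that])
    qed (use st C0 in auto)
  qed
  finally show ?thesis .
qed

text \<open>The fundamental lemma strips \<open>\<phi>\<close> from \<open>dilation_test\<close>.
  The exceptional null set still depends on \<open>s\<close> and \<open>t\<close>.\<close>

lemma dilation_formula:
  assumes st: "0 < s" "s \<le> t"
  shows "AE x in lborel. x \<in> ball 0 (1 / t) \<longrightarrow>
    v (t *\<^sub>R x) - v (s *\<^sub>R x) = (LBINT l. indicator {s..t} l * (h (l *\<^sub>R x) \<bullet> x))"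
proof -
  let ?U = "ball (0::'n) (1 / t)"
  let ?I = "\<lambda>x. LBINT l. indicator {s..t} l * ((h (l *\<^sub>R x) \<bullet> x) * indicator ?U x)"
  define g where "g x = indicator ?U x * v (t *\<^sub>R x) - indicator ?U x * v (s *\<^sub>R x) - ?I x" for x
  have iv: "integrable lborel (\<lambda>x. v (l *\<^sub>R x))" if "l > 0" for l
    by (rule integrable_scaleR[OF v_int that])
  have ipair: "integrable (lborel \<Otimes>\<^sub>M lborel) (\<lambda>(l, x). indicator {s..t} l * ((h (l *\<^sub>R x) \<bullet> x) * indicator ?U x))"
    by (rule pair_h_integrable[of _ 1 "1 / t"]) (use st in \<open>auto simp: indicator_def\<close>)
  have iI: "integrable lborel ?I"
    using lborel_pair.integrable_snd[OF ipair] .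
  have [simp]: "(indicator ?U :: 'n \<Rightarrow> real) \<in> borel_measurable borel"
    by (rule borel_measurable_indicator) simp
  have ig: "integrable lborel g"
    unfolding g_def using iv st
    by (intro Bochner_Integration.integrable_diff iI integrable_mult_bounded[of "\<lambda>x. v (_ *\<^sub>R x)" "indicator ?U" 1, simplified mult.commute[of "v _"]])
       (simp_all add: indicator_le_1 abs_indicator)
  have "AE x in lborel. x \<in> ?U \<longrightarrow> g x = 0"
  proof (rule fundamental_lemma[OF ig _ open_ball])
    fix \<phi> assume \<phi>: "test_fun ?U \<phi>"
    have s\<phi>: "smooth_fun \<phi>" using \<phi> by (simp add: test_fun_def)
    have [measurable]: "\<phi> \<in> borel_measurable borel"
      by (intro borel_measurable_continuous_onI smooth_fun_continuous s\<phi>)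
    obtain C0 where C0: "\<And>x. \<bar>\<phi> x\<bar> \<le> C0" using test_fun_bounded[OF \<phi>] by metis
    have U\<phi>: "indicator ?U x * \<phi> x = \<phi> x" for x
      using test_fun_outside[OF \<phi>, of x] by (cases "x \<in> ?U") auto
    have "?I x * \<phi> x = (LBINT l. indicator {s..t} l * ((h (l *\<^sub>R x) \<bullet> x) * indicator ?U x) * \<phi> x)" for x
      by simp
    moreover have "indicator {s..t} l * ((h (l *\<^sub>R x) \<bullet> x) * indicator ?U x) * \<phi> x = indicator {s..t} l * ((h (l *\<^sub>R x) \<bullet> x) * \<phi> x)" for l x
      by (simp only: mult.assoc U\<phi>)
    ultimately have I\<phi>: "?I x * \<phi> x = (LBINT l. indicator {s..t} l * ((h (l *\<^sub>R x) \<bullet> x) * \<phi> x))" for x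
      by simp
    have "g x * \<phi> x = v (t *\<^sub>R x) * (indicator ?U x * \<phi> x) - v (s *\<^sub>R x) * (indicator ?U x * \<phi> x) - ?I x * \<phi> x" for x
      unfolding g_def by (simp add: algebra_simps)
    then have g\<phi>: "g x * \<phi> x = v (t *\<^sub>R x) * \<phi> x - v (s *\<^sub>R x) * \<phi> x - ?I x * \<phi> x" for x
      unfolding U\<phi> .
    have i1: "integrable lborel (\<lambda>x. v (l *\<^sub>R x) * \<phi> x)" if "l > 0" for l
      by (rule integrable_mult_bounded[OF iv[OF that] _ C0]) measurable
    have i2: "integrable lborel (\<lambda>x. ?I x * \<phi> x)"
      by (rule integrable_mult_bounded[OF iI _ C0]) measurable
    have "(LBINT x. g x * \<phi> x) = (LBINT x. v (t *\<^sub>R x) * \<phi> x) - (LBINT x. v (s *\<^sub>R x) * \<phi> x) - (LBINT x. ?I x * \<phi> x)"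
      unfolding g\<phi> using i1 i2 st by (simp add: Bochner_Integration.integral_diff)
    also have "\<dots> = 0" unfolding I\<phi> dilation_test[OF \<phi> st] by simp
    finally show "(LBINT x. g x * \<phi> x) = 0" .
  qed
  then show ?thesis
    by eventually_elim (auto simp: g_def)
qed

end

text \<open>The integral of \<open>ray_kernel m l * g l\<close> over \<open>l\<close> is the signed integral of \<open>g\<close> from 1 to \<open>m\<close>.\<close>

definition ray_kernel :: "real \<Rightarrow> real \<Rightarrow> real" where
  "ray_kernel m l = (if l \<le> m then 1 else 0) - (if l \<le> 1 then 1 else 0)"

lemma ray_kernel_measurable [measurable (raw)]:
  assumes [measurable]: "f \<in> borel_measurable M" "g \<in> borel_measurable M"
  shows "(\<lambda>x. ray_kernel (f x) (g x)) \<in> borel_measurable M"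
  unfolding ray_kernel_def by measurable

text \<open>Fubini, with the \<open>m\<close>-integral first. For \<open>0 < l \<le> 1\<close> the
  kernel lives on \<open>m < l\<close>, where \<open>\<kappa>\<close> has mass at most
  \<open>C * l ^ n\<close>. For \<open>l > 1\<close> the whole mass of \<open>\<kappa>\<close>, at
  most \<open>C * 2 ^ n\<close>, is absorbed by \<open>l ^ n \<ge> 1\<close>. Either way the weight
  left for \<open>\<eta>\<close> is a multiple of \<open>l ^ n\<close>.\<close>

lemma ray_kernel_bound:
  fixes \<kappa> \<eta> :: "real \<Rightarrow> real"
  assumes [measurable]: "\<kappa> \<in> borel_measurable borel" "\<eta> \<in> borel_measurable borel"
    and \<kappa>0: "\<And>m. m \<le> 0 \<or> 2 \<le> m \<Longrightarrow> \<kappa> m = 0" and C: "C \<ge> 0"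
    and bnd: "\<And>l. l > 0 \<Longrightarrow> (\<integral>\<^sup>+m. ennreal (\<bar>\<kappa> m\<bar> * indicator {..l} m) \<partial>lborel) \<le> ennreal (C * l ^ n)"
  shows "(\<integral>\<^sup>+m. \<integral>\<^sup>+l. ennreal \<bar>\<kappa> m * ray_kernel m l * \<eta> l\<bar> \<partial>lborel \<partial>lborel)
    \<le> ennreal (2 ^ n * C) * (\<integral>\<^sup>+l. ennreal (indicator {0<..} l * l ^ n * \<bar>\<eta> l\<bar>) \<partial>lborel)"
proof -
  have "(\<integral>\<^sup>+m. \<integral>\<^sup>+l. ennreal \<bar>\<kappa> m * ray_kernel m l * \<eta> l\<bar> \<partial>lborel \<partial>lborel)
      = (\<integral>\<^sup>+l. \<integral>\<^sup>+m. ennreal \<bar>\<kappa> m * ray_kernel m l * \<eta> l\<bar> \<partial>lborel \<partial>lborel)"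
    by (rule lborel_pair.Fubini'[symmetric]) measurable
  also have "\<dots> \<le> (\<integral>\<^sup>+l. ennreal (2 ^ n * C) * ennreal (indicator {0<..} l * l ^ n * \<bar>\<eta> l\<bar>) \<partial>lborel)"
  proof (rule nn_integral_mono)
    fix l :: real
    have K: "(\<integral>\<^sup>+m. ennreal (\<bar>\<kappa> m\<bar> * \<bar>ray_kernel m l\<bar>) \<partial>lborel) \<le> ennreal (2 ^ n * C * (indicator {0<..} l * l ^ n))"
    proof -
      consider "l \<le> 0" | "0 < l" "l \<le> 1" | "1 < l" by linarith
      then show ?thesis
      proof cases
        case 1
        then have "ennreal (\<bar>\<kappa> m\<bar> * \<bar>ray_kernel m l\<bar>) = 0" for m
          using \<kappa>0[of m] by (cases "m \<le> 0") (auto simp: ray_kernel_def)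
        then have z: "(\<lambda>m. ennreal (\<bar>\<kappa> m\<bar> * \<bar>ray_kernel m l\<bar>)) = (\<lambda>_. 0)" by (rule ext)
        show ?thesis unfolding z by simp
      next
        case 2
        have "(\<integral>\<^sup>+m. ennreal (\<bar>\<kappa> m\<bar> * \<bar>ray_kernel m l\<bar>) \<partial>lborel) \<le> (\<integral>\<^sup>+m. ennreal (\<bar>\<kappa> m\<bar> * indicator {..l} m) \<partial>lborel)"
          using 2 by (intro nn_integral_mono) (auto simp: ray_kernel_def indicator_def)
        also have "\<dots> \<le> ennreal (C * l ^ n)" by (rule bnd[OF 2(1)])
        also have "C * l ^ n \<le> 2 ^ n * C * l ^ n"
          using 2 C by (intro mult_right_mono) (auto simp: mult_le_cancel_right1)
        finally show ?thesis using 2 by (simp add: ennreal_leI)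
      next
        case 3
        have "(\<integral>\<^sup>+m. ennreal (\<bar>\<kappa> m\<bar> * \<bar>ray_kernel m l\<bar>) \<partial>lborel) \<le> (\<integral>\<^sup>+m. ennreal (\<bar>\<kappa> m\<bar> * indicator {..2} m) \<partial>lborel)"
        proof (rule nn_integral_mono)
          fix m
          show "ennreal (\<bar>\<kappa> m\<bar> * \<bar>ray_kernel m l\<bar>) \<le> ennreal (\<bar>\<kappa> m\<bar> * indicator {..2} m)"
            using 3 \<kappa>0[of m] by (cases "m \<le> 2") (auto simp: ray_kernel_def indicator_def)
        qed
        also have "\<dots> \<le> ennreal (C * 2 ^ n)" by (rule bnd) simp
        also have "C * 2 ^ n \<le> 2 ^ n * C * l ^ n"
          using 3 C one_le_power[of l n] mult_left_mono[of 1 "l ^ n" "2 ^ n * C"] by (simp add: mult_ac)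
        finally show ?thesis using 3 by (simp add: ennreal_leI)
      qed
    qed
    have "(\<integral>\<^sup>+m. ennreal \<bar>\<kappa> m * ray_kernel m l * \<eta> l\<bar> \<partial>lborel) = (\<integral>\<^sup>+m. ennreal \<bar>\<eta> l\<bar> * ennreal (\<bar>\<kappa> m\<bar> * \<bar>ray_kernel m l\<bar>) \<partial>lborel)"
      by (intro nn_integral_cong) (simp add: ennreal_mult[symmetric] abs_mult mult_ac)
    also have "\<dots> = ennreal \<bar>\<eta> l\<bar> * (\<integral>\<^sup>+m. ennreal (\<bar>\<kappa> m\<bar> * \<bar>ray_kernel m l\<bar>) \<partial>lborel)"
      by (rule nn_integral_cmult) measurable
    also have "\<dots> \<le> ennreal \<bar>\<eta> l\<bar> * ennreal (2 ^ n * C * (indicator {0<..} l * l ^ n))"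
      by (intro mult_left_mono K) simp
    also have "\<dots> = ennreal (2 ^ n * C) * ennreal (indicator {0<..} l * l ^ n * \<bar>\<eta> l\<bar>)"
    proof -
      have "0 \<le> indicator {0<..} l * l ^ n" by (auto simp: indicator_def)
      then show ?thesis by (subst (1 2) ennreal_mult'[symmetric]) (use C in \<open>simp_all add: mult_ac\<close>)
    qed
    finally show "(\<integral>\<^sup>+m. ennreal \<bar>\<kappa> m * ray_kernel m l * \<eta> l\<bar> \<partial>lborel) \<le> ennreal (2 ^ n * C) * ennreal (indicator {0<..} l * l ^ n * \<bar>\<eta> l\<bar>)" .
  qed
  also have "\<dots> = ennreal (2 ^ n * C) * (\<integral>\<^sup>+l. ennreal (indicator {0<..} l * l ^ n * \<bar>\<eta> l\<bar>) \<partial>lborel)"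
    by (rule nn_integral_cmult) measurable
  finally show ?thesis .
qed

text \<open>Integration by parts against the primitive of \<open>\<kappa>\<close>, carried out by
  Fubini because \<open>V\<close> is given only as an integral of \<open>\<eta>\<close>. The mean
  value zero of \<open>\<kappa>\<close> removes the constant \<open>c\<close> and the boundary term
  at the far end.\<close>

lemma ray_by_parts:
  fixes \<kappa> \<eta> V :: "real \<Rightarrow> real"
  assumes \<kappa>: "integrable lborel \<kappa>" "(LBINT m. \<kappa> m) = 0"
    and [measurable]: "\<eta> \<in> borel_measurable borel" "V \<in> borel_measurable borel"
    and \<kappa>0: "\<And>m. m \<le> 0 \<or> 2 \<le> m \<Longrightarrow> \<kappa> m = 0" and C: "C \<ge> 0"
    and bnd: "\<And>l. l > 0 \<Longrightarrow> (\<integral>\<^sup>+m. ennreal (\<bar>\<kappa> m\<bar> * indicator {..l} m) \<partial>lborel) \<le> ennreal (C * l ^ n)"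
    and fin: "integrable lborel (\<lambda>l. indicator {0<..} l * l ^ n * \<eta> l)"
    and V: "AE m in lborel. \<kappa> m \<noteq> 0 \<longrightarrow> V m = c + (LBINT l. ray_kernel m l * \<eta> l)"
  shows "(LBINT m. \<kappa> m * V m + \<eta> m * (LBINT s. \<kappa> s * indicator {..<m} s)) = 0"
proof -
  let ?O = "\<lambda>l. LBINT s. \<kappa> s * indicator {..<l} s"
  have [measurable]: "\<kappa> \<in> borel_measurable borel" using \<kappa> by auto
  have ip: "integrable (lborel \<Otimes>\<^sub>M lborel) (\<lambda>(m, l). \<kappa> m * ray_kernel m l * \<eta> l)"
  proof (rule integrable_pairI)
    have "(\<integral>\<^sup>+l. ennreal (indicator {0<..} l * l ^ n * \<bar>\<eta> l\<bar>) \<partial>lborel)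
        = (\<integral>\<^sup>+l. ennreal (norm (indicator {0<..} l * l ^ n * \<eta> l)) \<partial>lborel)"
      by (intro nn_integral_cong) (auto simp: abs_mult indicator_def)
    also have "\<dots> < \<infinity>" using fin by (simp add: integrable_iff_bounded)
    finally show "(\<integral>\<^sup>+m. \<integral>\<^sup>+l. ennreal \<bar>\<kappa> m * ray_kernel m l * \<eta> l\<bar> \<partial>lborel \<partial>lborel) < \<infinity>"
      using ray_kernel_bound[OF _ _ \<kappa>0 C bnd, of \<eta>]
      by (auto simp: ennreal_mult_less_top intro: order.strict_trans1)
  qed measurable
  have in_l: "(LBINT l. \<kappa> m * ray_kernel m l * \<eta> l) = \<kappa> m * (LBINT l. ray_kernel m l * \<eta> l)" for m
    by (simp add: mult.assoc)
  have in_m: "(LBINT m. \<kappa> m * ray_kernel m l * \<eta> l) = - (\<eta> l * ?O l)" for l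
  proof -
    have i: "integrable lborel (\<lambda>s. \<kappa> s * indicator {..<l} s)"
      using integrable_mult_indicator[of "{..<l}" lborel \<kappa>] \<kappa> by (simp add: mult.commute)
    \<comment> \<open>The part \<open>l \<le> m\<close> of the kernel is rewritten as one minus the
      indicator of \<open>m < l\<close>. What remains besides that indicator is constant in
      \<open>m\<close> and integrates to 0 against \<open>\<kappa>\<close>.\<close>
    have "\<kappa> m * ray_kernel m l * \<eta> l = \<eta> l * ((1 - (if l \<le> 1 then 1 else 0)) * \<kappa> m - \<kappa> m * indicator {..<l} m)" for m
      by (auto simp: ray_kernel_def indicator_def algebra_simps)
    then have "(LBINT m. \<kappa> m * ray_kernel m l * \<eta> l)
       = (LBINT m. \<eta> l * ((1 - (if l \<le> 1 then 1 else 0)) * \<kappa> m - \<kappa> m * indicator {..<l} m))"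
      by (simp only:)
    also have "\<dots> = \<eta> l * ((LBINT m. (1 - (if l \<le> 1 then 1 else 0)) * \<kappa> m) - ?O l)"
      unfolding integral_mult_right_zero
      by (subst Bochner_Integration.integral_diff[OF integrable_mult_right[OF \<kappa>(1)] i]) simp
    finally show ?thesis using \<kappa>(2) by simp
  qed
  have iO: "integrable lborel (\<lambda>l. \<eta> l * ?O l)"
    using lborel_pair.integrable_snd[OF ip] unfolding in_m by simp
  have iK: "integrable lborel (\<lambda>m. \<kappa> m * (LBINT l. ray_kernel m l * \<eta> l))"
    using lborel_pair.integrable_fst[OF ip] unfolding in_l .
  have eq: "AE m in lborel. \<kappa> m * V m = c * \<kappa> m + \<kappa> m * (LBINT l. ray_kernel m l * \<eta> l)"
    using V by eventually_elim (auto simp: algebra_simps)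
  have iR: "integrable lborel (\<lambda>m. c * \<kappa> m + \<kappa> m * (LBINT l. ray_kernel m l * \<eta> l))"
    using \<kappa>(1) iK by simp
  have iV: "integrable lborel (\<lambda>m. \<kappa> m * V m)"
    by (rule integrable_cong_AE[THEN iffD1, OF _ _ _ iR]) (use eq in \<open>auto elim: eventually_mono\<close>)
  have "(LBINT m. \<kappa> m * V m) = (LBINT m. c * \<kappa> m + \<kappa> m * (LBINT l. ray_kernel m l * \<eta> l))"
    by (rule integral_cong_AE) (use eq in auto)
  also have "\<dots> = (LBINT m. \<kappa> m * (LBINT l. ray_kernel m l * \<eta> l))"
    using \<kappa> iK by (simp add: Bochner_Integration.integral_add)
  also have "\<dots> = - (LBINT l. \<eta> l * ?O l)"
    using lborel_pair.Fubini_integral[OF ip] unfolding in_l in_m by simp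
  finally show ?thesis using iV iO by (simp add: Bochner_Integration.integral_add)
qed

context weak_pair
begin

text \<open>In \<open>dilation_formula\<close>, anchored at \<open>l = 1\<close>, the null set
  depends on \<open>m\<close>. Exchanging the two almost-everywhere quantifiers fixes the ray first:
  on almost every ray the formula holds for almost all \<open>m\<close>, which is enough under an
  integral over \<open>m\<close>.\<close>

lemma ray_difference:
  "AE x in lborel. AE m in lborel. x \<in> shell \<longrightarrow> 0 < m \<longrightarrow> m * norm x < 1 \<longrightarrow>
    v (m *\<^sub>R x) = v x + (LBINT l. ray_kernel m l * (h (l *\<^sub>R x) \<bullet> x))"
proof (rule lborel_pair.AE_commute[THEN iffD2])
  show "{z \<in> space (lborel \<Otimes>\<^sub>M lborel). fst z \<in> shell \<longrightarrow> 0 < snd z \<longrightarrow> snd z * norm (fst z) < 1 \<longrightarrow>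
     v (snd z *\<^sub>R fst z) = v (fst z) + (LBINT l. ray_kernel (snd z) l * (h (l *\<^sub>R fst z) \<bullet> fst z))}
     \<in> sets (lborel \<Otimes>\<^sub>M lborel)"
    by measurable
  show "AE m in lborel. AE x in lborel. x \<in> shell \<longrightarrow> 0 < m \<longrightarrow> m * norm x < 1 \<longrightarrow>
    v (m *\<^sub>R x) = v x + (LBINT l. ray_kernel m l * (h (l *\<^sub>R x) \<bullet> x))"
  proof (rule AE_I2)
    fix m :: real
    consider "m \<le> 0" | "0 < m" "m \<le> 1" | "1 \<le> m" by linarith
    then show "AE x in lborel. x \<in> shell \<longrightarrow> 0 < m \<longrightarrow> m * norm x < 1 \<longrightarrow>
      v (m *\<^sub>R x) = v x + (LBINT l. ray_kernel m l * (h (l *\<^sub>R x) \<bullet> x))"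
    proof cases
      case 2
      have "(LBINT l. ray_kernel m l * (h (l *\<^sub>R x) \<bullet> x)) = - (LBINT l. indicator {m..1} l * (h (l *\<^sub>R x) \<bullet> x))" for x
      proof -
        have "(LBINT l. ray_kernel m l * (h (l *\<^sub>R x) \<bullet> x)) = (LBINT l. - (indicator {m..1} l * (h (l *\<^sub>R x) \<bullet> x)))"
        proof (rule integral_discrete_difference[where X="{m}"])
          fix l assume "l \<notin> {m}"
          then show "ray_kernel m l * (h (l *\<^sub>R x) \<bullet> x) = - (indicator {m..1} l * (h (l *\<^sub>R x) \<bullet> x))"
            using 2 by (auto simp: ray_kernel_def indicator_def)
        qed auto
        then show ?thesis by simp
      qed
      with dilation_formula[OF 2] show ?thesis
        by (auto simp: shell_def elim: eventually_mono)
    next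
      case 3
      have "(LBINT l. ray_kernel m l * (h (l *\<^sub>R x) \<bullet> x)) = (LBINT l. indicator {1..m} l * (h (l *\<^sub>R x) \<bullet> x))" for x
      proof (rule integral_discrete_difference[where X="{1}"])
        fix l assume "l \<notin> {1::real}"
        then show "ray_kernel m l * (h (l *\<^sub>R x) \<bullet> x) = indicator {1..m} l * (h (l *\<^sub>R x) \<bullet> x)"
          using 3 by (auto simp: ray_kernel_def indicator_def)
      qed auto
      with dilation_formula[of 1 m] 3 show ?thesis
        by (auto simp: field_simps elim!: eventually_mono)
    qed simp
  qed
qed


text \<open>On the ray through \<open>x\<close> the weight \<open>q\<close> becomes \<open>l^n q(l|x|)\<close>, \<open>n\<close> being the dimension
  minus one.\<close>

definition ray_weight :: "(real \<Rightarrow> real) \<Rightarrow> 'n \<Rightarrow> real \<Rightarrow> real" where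
  "ray_weight q x m = indicator {0<..} m * m ^ (DIM('n) - 1) * q (m * norm x)"

lemma ray_weight_measurable:
  assumes [measurable]: "q \<in> borel_measurable borel"
  shows "ray_weight q x \<in> borel_measurable borel"
  unfolding ray_weight_def[abs_def] by measurable

lemma ray_weight_zero:
  assumes "\<And>s. s \<notin> {0<..<1} \<Longrightarrow> q s = 0" "x \<in> shell" "m \<le> 0 \<or> 2 \<le> m"
  shows "ray_weight q x m = 0"
proof (cases "m \<le> 0")
  case False
  \<comment> \<open>Points of the shell have norm above 1/2, so from \<open>m = 2\<close> on the ray
    has left the unit ball.\<close>
  with assms(3) have "2 * (1 / 2) \<le> m * norm x"
    using assms(2) by (intro mult_mono) (auto simp: shell_def)
  then show ?thesis using assms(1)[of "m * norm x"] by (simp add: ray_weight_def)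
qed (simp add: ray_weight_def)

text \<open>Below \<open>l\<close> the power of \<open>m\<close> is at most that of
  \<open>l\<close>, and the substitution \<open>s = m * norm x\<close> costs a factor less than 2.
  Here the integrability of \<open>q\<close> without a power of \<open>s\<close> enters.\<close>

lemma ray_weight_bound:
  assumes q: "integrable lborel q" and x: "x \<in> shell" and l: "l > 0"
  shows "(\<integral>\<^sup>+m. ennreal (\<bar>ray_weight q x m\<bar> * indicator {..l} m) \<partial>lborel)
    \<le> ennreal (2 * (LBINT s. \<bar>q s\<bar>) * l ^ (DIM('n) - 1))"
proof -
  have [measurable]: "q \<in> borel_measurable borel" using q by auto
  have x0: "norm x > 1 / 2" using x by (simp add: shell_def)
  have Q: "(\<integral>\<^sup>+s. ennreal \<bar>q s\<bar> \<partial>lborel) = ennreal (LBINT s. \<bar>q s\<bar>)"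
    using q by (intro nn_integral_eq_integral) auto
  have "(\<integral>\<^sup>+m. ennreal (\<bar>ray_weight q x m\<bar> * indicator {..l} m) \<partial>lborel)
     \<le> (\<integral>\<^sup>+m. ennreal (l ^ (DIM('n) - 1)) * ennreal \<bar>q (0 + norm x * m)\<bar> \<partial>lborel)"
  proof (rule nn_integral_mono)
    fix m
    show "ennreal (\<bar>ray_weight q x m\<bar> * indicator {..l} m) \<le> ennreal (l ^ (DIM('n) - 1)) * ennreal \<bar>q (0 + norm x * m)\<bar>"
    proof (cases "0 < m \<and> m \<le> l")
      case True
      then have "m ^ (DIM('n) - 1) * \<bar>q (m * norm x)\<bar> \<le> l ^ (DIM('n) - 1) * \<bar>q (m * norm x)\<bar>"
        by (intro mult_right_mono power_mono) auto
      then show ?thesis using True l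
        by (simp add: ray_weight_def abs_mult ennreal_mult[symmetric] ennreal_leI mult.commute[of "norm x"])
    next
      case False
      then show ?thesis by (auto simp: ray_weight_def)
    qed
  qed
  also have "\<dots> = ennreal (l ^ (DIM('n) - 1)) * (\<integral>\<^sup>+m. ennreal \<bar>q (0 + norm x * m)\<bar> \<partial>lborel)"
    by (rule nn_integral_cmult) measurable
  also have "\<dots> \<le> ennreal (l ^ (DIM('n) - 1)) * ennreal (2 * (LBINT s. \<bar>q s\<bar>))"
  proof (rule mult_left_mono)
    let ?I = "\<integral>\<^sup>+m. ennreal \<bar>q (0 + norm x * m)\<bar> \<partial>lborel"
    have "ennreal (1 / 2) * ?I \<le> ennreal (norm x) * ?I"
      using x0 by (intro mult_right_mono ennreal_leI) auto
    also have "\<dots> = ennreal (LBINT s. \<bar>q s\<bar>)"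
      using nn_integral_real_affine[of "\<lambda>s. ennreal \<bar>q s\<bar>" "norm x" 0] x0 Q by (cases "x = 0") simp_all
    finally have "ennreal 2 * (ennreal (1 / 2) * ?I) \<le> ennreal 2 * ennreal (LBINT s. \<bar>q s\<bar>)"
      by (intro mult_left_mono) auto
    moreover have "ennreal 2 * ennreal (1 / 2) = 1" by (subst ennreal_mult[symmetric]) simp_all
    moreover have "ennreal 2 * ennreal (LBINT s. \<bar>q s\<bar>) = ennreal (2 * (LBINT s. \<bar>q s\<bar>))"
      by (subst ennreal_mult') simp_all
    ultimately show "?I \<le> ennreal (2 * (LBINT s. \<bar>q s\<bar>))"
      by (simp only: mult.assoc[symmetric] mult_1_left)
  qed simp
  also have "\<dots> = ennreal (2 * (LBINT s. \<bar>q s\<bar>) * l ^ (DIM('n) - 1))"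
    by (subst ennreal_mult'[symmetric]) (use l in \<open>simp_all add: mult.commute\<close>)
  finally show ?thesis .
qed

text \<open>Neither factor need be bounded, so \<open>v\<close> is estimated on rays: by its value
  at the anchor in the shell plus the integral of \<open>h\<close> from there. The weighted double
  integral is then controlled by \<open>ray_kernel_bound\<close>, and integration over the shell
  returns the L^1 norms of \<open>v\<close> and \<open>h\<close>.\<close>

lemma radial_weight_integrable:
  assumes q: "integrable lborel q" and q0: "\<And>s. s \<notin> {0<..<1} \<Longrightarrow> q s = 0"
  shows "integrable lborel (\<lambda>y. q (norm y) * v y)"
proof (rule integrableI_bounded)
  let ?n = "DIM('n) - 1"
  have [measurable]: "q \<in> borel_measurable borel" using q by auto
  define C where "C = 2 * (LBINT s. \<bar>q s\<bar>)"
  have C: "C \<ge> 0" unfolding C_def by simp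
  have \<kappa>m [measurable]: "ray_weight q x \<in> borel_measurable borel" for x by (rule ray_weight_measurable) measurable
  let ?H = "\<lambda>x::'n. \<integral>\<^sup>+l. ennreal (indicator {0<..} l * l ^ ?n) * ennreal (norm (h (l *\<^sub>R x))) \<partial>lborel"
  have "AE x in lborel. indicator shell x * (\<integral>\<^sup>+l. ennreal (indicator {0<..} l * l ^ ?n) * ennreal \<bar>q (norm (l *\<^sub>R x)) * v (l *\<^sub>R x)\<bar> \<partial>lborel)
      \<le> ennreal (C * 2 ^ ?n) * ennreal \<bar>v x\<bar> + ennreal (2 ^ ?n * C) * (indicator shell x * ?H x)"
    using ray_difference
  proof eventually_elim
    case (elim x)
    show ?case
    proof (cases "x \<in> shell")
      case x: True
      let ?k = "ray_weight q x" and ?e = "\<lambda>l. h (l *\<^sub>R x) \<bullet> x"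
      have k0: "?k m = 0" if "m \<le> 0 \<or> 2 \<le> m" for m by (rule ray_weight_zero[OF q0 x that])
      have kb: "(\<integral>\<^sup>+m. ennreal (\<bar>?k m\<bar> * indicator {..l} m) \<partial>lborel) \<le> ennreal (C * l ^ ?n)" if "l > 0" for l
        unfolding C_def by (rule ray_weight_bound[OF q x that])
      have "(\<integral>\<^sup>+l. ennreal (indicator {0<..} l * l ^ ?n) * ennreal \<bar>q (norm (l *\<^sub>R x)) * v (l *\<^sub>R x)\<bar> \<partial>lborel)
        \<le> (\<integral>\<^sup>+m. ennreal \<bar>v x\<bar> * ennreal (\<bar>?k m\<bar> * indicator {..2} m) + (\<integral>\<^sup>+l. ennreal \<bar>?k m * ray_kernel m l * ?e l\<bar> \<partial>lborel) \<partial>lborel)"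
      proof (rule nn_integral_mono_AE)
        show "AE m in lborel. ennreal (indicator {0<..} m * m ^ ?n) * ennreal \<bar>q (norm (m *\<^sub>R x)) * v (m *\<^sub>R x)\<bar>
           \<le> ennreal \<bar>v x\<bar> * ennreal (\<bar>?k m\<bar> * indicator {..2} m) + (\<integral>\<^sup>+l. ennreal \<bar>?k m * ray_kernel m l * ?e l\<bar> \<partial>lborel)"
          using elim
        proof eventually_elim
          case (elim m)
          have "0 \<le> indicator {0<..} m * m ^ ?n" by (auto simp: indicator_def)
          then have e: "ennreal (indicator {0<..} m * m ^ ?n) * ennreal \<bar>q (norm (m *\<^sub>R x)) * v (m *\<^sub>R x)\<bar> = ennreal \<bar>?k m * v (m *\<^sub>R x)\<bar>"
            by (subst ennreal_mult[symmetric]) (auto simp: ray_weight_def abs_mult indicator_def)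
          show ?case
          proof (cases "?k m = 0")
            case True
            then show ?thesis unfolding e by simp
          next
            case False
            then have m: "0 < m" "m \<le> 2" using k0[of m] by linarith+
            have "q (m * norm x) \<noteq> 0" using False by (auto simp: ray_weight_def)
            then have m1: "m * norm x < 1" using q0[of "m * norm x"] by auto
            let ?J = "LBINT l. ray_kernel m l * ?e l"
            have "?k m * v (m *\<^sub>R x) = ?k m * v x + (LBINT l. ?k m * ray_kernel m l * ?e l)"
              using elim x m m1 by (simp add: mult.assoc distrib_left)
            then have "\<bar>?k m * v (m *\<^sub>R x)\<bar> \<le> \<bar>v x\<bar> * \<bar>?k m\<bar> + \<bar>LBINT l. ?k m * ray_kernel m l * ?e l\<bar>"
              by (simp add: abs_mult[symmetric] mult.commute abs_triangle_ineq)
            then have "ennreal \<bar>?k m * v (m *\<^sub>R x)\<bar> \<le> ennreal (\<bar>v x\<bar> * \<bar>?k m\<bar>) + ennreal \<bar>LBINT l. ?k m * ray_kernel m l * ?e l\<bar>"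
              by (simp add: ennreal_plus[symmetric] ennreal_leI del: ennreal_plus)
            also have "ennreal \<bar>LBINT l. ?k m * ray_kernel m l * ?e l\<bar> \<le> (\<integral>\<^sup>+l. ennreal \<bar>?k m * ray_kernel m l * ?e l\<bar> \<partial>lborel)"
            proof (cases "integrable lborel (\<lambda>l. ?k m * ray_kernel m l * ?e l)")
              case True
              from integral_norm_bound_ennreal[OF this] show ?thesis by simp
            next
              \<comment> \<open>A non-integrable integrand has Bochner integral 0 by convention, so
                the bound is trivial.\<close>
              case False
              then have "(LBINT l. ?k m * ray_kernel m l * ?e l) = 0" by (rule not_integrable_integral_eq)
              then show ?thesis by simp
            qed
            finally show ?thesis unfolding e using m(2) by (simp add: ennreal_mult add_left_mono)
          qed
        qed
      qed
      also have "\<dots> = ennreal \<bar>v x\<bar> * (\<integral>\<^sup>+m. ennreal (\<bar>?k m\<bar> * indicator {..2} m) \<partial>lborel) + (\<integral>\<^sup>+m. \<integral>\<^sup>+l. ennreal \<bar>?k m * ray_kernel m l * ?e l\<bar> \<partial>lborel \<partial>lborel)"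
      proof -
        have 1: "(\<lambda>m. ennreal (\<bar>?k m\<bar> * indicator {..2} m)) \<in> borel_measurable lborel" by measurable
        have 2: "(\<lambda>m. \<integral>\<^sup>+l. ennreal \<bar>?k m * ray_kernel m l * ?e l\<bar> \<partial>lborel) \<in> borel_measurable lborel" by measurable
        show ?thesis
          by (subst nn_integral_add[OF _ 2]) (simp_all add: nn_integral_cmult[OF 1])
      qed
      also have "\<dots> \<le> ennreal \<bar>v x\<bar> * ennreal (C * 2 ^ ?n) + ennreal (2 ^ ?n * C) * (\<integral>\<^sup>+l. ennreal (indicator {0<..} l * l ^ ?n * \<bar>?e l\<bar>) \<partial>lborel)"
        by (intro add_mono mult_left_mono kb ray_kernel_bound k0 C) auto
      also have "\<dots> \<le> ennreal \<bar>v x\<bar> * ennreal (C * 2 ^ ?n) + ennreal (2 ^ ?n * C) * ?H x"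
      proof (rule add_left_mono[OF mult_left_mono[OF nn_integral_mono]])
        fix l :: real
        have "\<bar>?e l\<bar> \<le> norm (h (l *\<^sub>R x)) * norm x" by (rule Cauchy_Schwarz_ineq2)
        also have "\<dots> \<le> norm (h (l *\<^sub>R x)) * 1" using x by (intro mult_left_mono) (auto simp: shell_def)
        finally have b: "\<bar>?e l\<bar> \<le> norm (h (l *\<^sub>R x))" by simp
        have nn: "0 \<le> indicator {0<..} l * l ^ ?n" by (auto simp: indicator_def)
        show "ennreal (indicator {0<..} l * l ^ ?n * \<bar>?e l\<bar>) \<le> ennreal (indicator {0<..} l * l ^ ?n) * ennreal (norm (h (l *\<^sub>R x)))"
          unfolding ennreal_mult[OF nn norm_ge_zero, symmetric] by (intro ennreal_leI mult_left_mono b nn)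
      qed simp
      finally show ?thesis using x by (simp add: mult.commute[of "ennreal \<bar>v x\<bar>"])
    qed simp
  qed
  then have "(\<integral>\<^sup>+x. indicator (shell :: 'n set) x * (\<integral>\<^sup>+l. ennreal (indicator {0<..} l * l ^ ?n) * ennreal \<bar>q (norm (l *\<^sub>R x)) * v (l *\<^sub>R x)\<bar> \<partial>lborel) \<partial>lborel)
    \<le> (\<integral>\<^sup>+x. ennreal (C * 2 ^ ?n) * ennreal \<bar>v x\<bar> + ennreal (2 ^ ?n * C) * (indicator shell x * ?H x) \<partial>lborel)"
    by (rule nn_integral_mono_AE)
  also have "\<dots> = ennreal (C * 2 ^ ?n) * (\<integral>\<^sup>+x. ennreal \<bar>v x\<bar> \<partial>lborel) + ennreal (2 ^ ?n * C) * (\<integral>\<^sup>+x. indicator shell x * ?H x \<partial>lborel)"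
  proof -
    have 1: "(\<lambda>x. ennreal \<bar>v x\<bar>) \<in> borel_measurable lborel" by measurable
    have 2: "(\<lambda>x. indicator (shell :: 'n set) x * ?H x) \<in> borel_measurable lborel" by measurable
    have 3: "(\<lambda>x. ennreal (C * 2 ^ ?n) * ennreal \<bar>v x\<bar>) \<in> borel_measurable lborel" by measurable
    have 4: "(\<lambda>x. ennreal (2 ^ ?n * C) * (indicator (shell :: 'n set) x * ?H x)) \<in> borel_measurable lborel"
      using 2 by (rule borel_measurable_times_ennreal[OF borel_measurable_const])
    show ?thesis unfolding nn_integral_add[OF 3 4] nn_integral_cmult[OF 1] nn_integral_cmult[OF 2] ..
  qed
  also have "\<dots> < \<infinity>"
    using v_int h_int nn_integral_shell_rays[of "\<lambda>y. ennreal (norm (h y))"]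
    by (auto simp: integrable_iff_bounded ennreal_mult_less_top)
  finally have "ennreal (ln 2) * (\<integral>\<^sup>+y. ennreal \<bar>q (norm y) * v y\<bar> \<partial>lborel) < \<infinity>"
    using nn_integral_shell_rays[of "\<lambda>y. ennreal \<bar>q (norm y) * v y\<bar>"] by simp
  then show "(\<integral>\<^sup>+y. ennreal (norm (q (norm y) * v y)) \<partial>lborel) < \<infinity>"
    by (auto simp: ennreal_mult_less_top)
qed (use q in measurable)

text \<open>The divergence theorem for \<open>v\<close> times the radial field
  \<open>W(r) / r^n\<close> in direction \<open>y / norm y\<close>: its divergence is
  \<open>q\<close> because \<open>W' = r^n q\<close>, and its flux through the unit sphere is zero
  because \<open>W 1 = 0\<close>, which is the hypothesis \<open>mean\<close>.\<close>

lemma radial_identity: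
  fixes q :: "real \<Rightarrow> real"
  defines "W \<equiv> \<lambda>r. LBINT s:{0..<r}. s ^ (DIM('n) - 1) * q s"
  assumes q: "integrable lborel q" and q0: "\<And>s. s \<notin> {0<..<1} \<Longrightarrow> q s = 0"
    and mean: "(LBINT s. s ^ (DIM('n) - 1) * q s) = 0"
  shows "integrable lborel (\<lambda>y. W (norm y) / norm y ^ (DIM('n) - 1) * ((h y \<bullet> y) / norm y))"
    and "(LBINT y. q (norm y) * v y + W (norm y) / norm y ^ (DIM('n) - 1) * ((h y \<bullet> y) / norm y)) = 0"
proof -
  let ?n = "DIM('n) - 1"
  have [measurable]: "q \<in> borel_measurable borel" using q by auto
  define Q where "Q = (LBINT s. \<bar>q s\<bar>)"
  have Q: "Q \<ge> 0" unfolding Q_def by simp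
  have pow_q: "\<bar>s ^ ?n * q s\<bar> \<le> \<bar>q s\<bar>" for s
  proof (cases "s \<in> {0<..<1}")
    case True
    then show ?thesis using power_le_one[of s ?n] by (simp add: abs_mult mult_left_le_one_le)
  qed (use q0 in simp)
  have iq: "integrable lborel (\<lambda>s. s ^ ?n * q s)"
    by (rule Bochner_Integration.integrable_bound[OF q]) (use pow_q in auto)
  have "continuous_on UNIV W"
    unfolding W_def by (rule continuous_on_indefinite[OF iq])
  then have [measurable]: "W \<in> borel_measurable borel" by (rule borel_measurable_continuous_onI)
  \<comment> \<open>The field \<open>W(r) / r^n\<close> is bounded by the L^1 norm of
    \<open>q\<close> in spite of the singular factor, so its product with \<open>h\<close> is
    integrable.\<close>
  have Wb: "\<bar>W r\<bar> \<le> Q * r ^ ?n" if r: "r \<ge> 0" for r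
  proof -
    have "\<bar>W r\<bar> \<le> (LBINT s. \<bar>indicator {0..<r} s *\<^sub>R (s ^ ?n * q s)\<bar>)"
      unfolding W_def set_lebesgue_integral_def by (rule integral_abs_bound)
    also have "\<dots> \<le> (LBINT s. r ^ ?n * \<bar>q s\<bar>)"
    proof (rule integral_mono)
      show "integrable lborel (\<lambda>s. \<bar>indicator {0..<r} s *\<^sub>R (s ^ ?n * q s)\<bar>)"
        using integrable_mult_indicator[OF _ iq, of "{0..<r}"] by simp
      show "integrable lborel (\<lambda>s. r ^ ?n * \<bar>q s\<bar>)" using q by simp
      show "\<bar>indicator {0..<r} s *\<^sub>R (s ^ ?n * q s)\<bar> \<le> r ^ ?n * \<bar>q s\<bar>" for s
      proof (cases "s \<in> {0..<r}")
        case True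
        then show ?thesis by (simp add: abs_mult mult_right_mono power_mono)
      qed (use r in simp)
    qed
    finally show ?thesis by (simp add: Q_def mult.commute)
  qed
  define R where "R y = W (norm y) / norm y ^ ?n * ((h y \<bullet> y) / norm y)" for y
  have [measurable]: "R \<in> borel_measurable borel" unfolding R_def by measurable
  have Rb: "\<bar>R y\<bar> \<le> Q * norm (h y)" for y
  proof (cases "y = 0")
    case False
    have "\<bar>W (norm y) / norm y ^ ?n\<bar> \<le> Q" using Wb[of "norm y"] False by (simp add: pos_divide_le_eq)
    moreover have "\<bar>(h y \<bullet> y) / norm y\<bar> \<le> norm (h y)"
      using Cauchy_Schwarz_ineq2[of "h y" y] False by (simp add: pos_divide_le_eq)
    ultimately show ?thesis unfolding R_def abs_mult using Q by (intro mult_mono) auto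
  qed (simp add: R_def Q)
  have iR: "integrable lborel R"
  proof (rule Bochner_Integration.integrable_bound)
    show "integrable lborel (\<lambda>y. Q * norm (h y))" using h_int by simp
  qed (use Rb Q in auto)
  then show "integrable lborel (\<lambda>y. W (norm y) / norm y ^ ?n * ((h y \<bullet> y) / norm y))" by (simp add: R_def[abs_def])
  have iV: "integrable lborel (\<lambda>y. q (norm y) * v y)" by (rule radial_weight_integrable[OF q q0])
  have "(LBINT y. q (norm y) * v y + R y) = 0"
  proof (rule integral_zero_if_rays_zero)
    show "integrable lborel (\<lambda>y. q (norm y) * v y + R y)" using iV iR by simp
    show "AE x in lborel. x \<in> shell \<longrightarrow> (LBINT l. indicator {0<..} l * l ^ ?n * (q (norm (l *\<^sub>R x)) * v (l *\<^sub>R x) + R (l *\<^sub>R x))) = 0"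
      using ray_difference AE_integrable_rays[of "\<lambda>y. norm (h y)", OF integrable_norm[OF h_int]]
    proof eventually_elim
      case (elim x)
      show ?case
      proof
        assume x: "x \<in> shell"
        then have x0: "norm x > 0" unfolding shell_def mem_Collect_eq by linarith
        let ?k = "ray_weight q x" and ?e = "\<lambda>l. h (l *\<^sub>R x) \<bullet> x"
        have [measurable]: "?k \<in> borel_measurable borel" by (rule ray_weight_measurable) measurable
        have k0: "?k m = 0" if "m \<le> 0 \<or> 2 \<le> m" for m by (rule ray_weight_zero[OF q0 x that])
        have kb: "(\<integral>\<^sup>+m. ennreal (\<bar>?k m\<bar> * indicator {..l} m) \<partial>lborel) \<le> ennreal (2 * Q * l ^ ?n)" if "l > 0" for l
          unfolding Q_def by (rule ray_weight_bound[OF q x that])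
        have scale: "norm x ^ ?n * ?k m = (0 + norm x * m) ^ ?n * q (0 + norm x * m)" for m
          using q0[of "norm x * m"] x0 by (cases "m > 0") (auto simp: ray_weight_def power_mult_distrib mult_ac zero_less_mult_iff)
        have "integrable lborel (\<lambda>m. norm x ^ ?n * ?k m)"
          unfolding scale using iq x0 by (intro lborel_integrable_real_affine) auto
        then have ik: "integrable lborel ?k" using x0 by simp
        have "(LBINT m. norm x ^ ?n * ?k m) = 0"
          unfolding scale using lborel_integral_real_affine[of "norm x" "\<lambda>s. s ^ ?n * q s" 0] mean x0 by simp
        then have mk: "(LBINT m. ?k m) = 0" using x0 by simp
        \<comment> \<open>\<open>n\<close> powers of \<open>norm x\<close> come from
          \<open>s ^ n\<close> and one more from the substitution \<open>s = norm x * m\<close>.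
          They cancel against the denominators of \<open>R\<close> on the ray.\<close>
        have OW: "W (l * norm x) = norm x ^ Suc ?n * (LBINT m. ?k m * indicator {..<l} m)" for l
        proof -
          have "W (l * norm x) = norm x * (LBINT m. indicator {0..<l * norm x} (0 + norm x * m) *\<^sub>R ((0 + norm x * m) ^ ?n * q (0 + norm x * m)))"
            unfolding W_def set_lebesgue_integral_def
            using lborel_integral_real_affine[of "norm x" "\<lambda>s. indicator {0..<l * norm x} s *\<^sub>R (s ^ ?n * q s)" 0] x0 by simp
          also have "(\<lambda>m. indicator {0..<l * norm x} (0 + norm x * m) *\<^sub>R ((0 + norm x * m) ^ ?n * q (0 + norm x * m)))
            = (\<lambda>m. norm x ^ ?n * (?k m * indicator {..<l} m))"
          proof
            fix m
            show "indicator {0..<l * norm x} (0 + norm x * m) *\<^sub>R ((0 + norm x * m) ^ ?n * q (0 + norm x * m))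
              = norm x ^ ?n * (?k m * indicator {..<l} m)"
            proof (cases "0 < m")
              case True
              have "(indicator {0..<l * norm x} (0 + norm x * m) :: real) = indicator {..<l} m"
                using x0 True by (auto simp: indicator_def mult.commute)
              then show ?thesis unfolding mult.assoc[symmetric] scale by simp
            next
              case False
              then have "q (norm x * m) = 0" using x0 q0 by (auto simp: zero_less_mult_iff)
              then show ?thesis using False by (simp add: ray_weight_def)
            qed
          qed
          finally show ?thesis by (simp only: integral_mult_right_zero power_Suc mult.assoc)
        qed
        have "integrable lborel (\<lambda>l. indicator {0<..} l * l ^ ?n * ?e l)"
        proof (rule Bochner_Integration.integrable_bound)
          show "integrable lborel (\<lambda>l. indicator {0<..} l * l ^ ?n * norm (h (l *\<^sub>R x)))" using elim x by blast
          show "AE l in lborel. norm (indicator {0<..} l * l ^ ?n * ?e l) \<le> norm (indicator {0<..} l * l ^ ?n * norm (h (l *\<^sub>R x)))"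
          proof (rule AE_I2)
            fix l
            have "\<bar>?e l\<bar> \<le> norm (h (l *\<^sub>R x)) * norm x" by (rule Cauchy_Schwarz_ineq2)
            also have "\<dots> \<le> norm (h (l *\<^sub>R x)) * 1" using x by (intro mult_left_mono) (auto simp: shell_def)
            finally have "\<bar>?e l\<bar> \<le> norm (h (l *\<^sub>R x))" by simp
            then show "norm (indicator {0<..} l * l ^ ?n * ?e l) \<le> norm (indicator {0<..} l * l ^ ?n * norm (h (l *\<^sub>R x)))"
              by (simp add: abs_mult mult_left_mono)
          qed
        qed measurable
        moreover have "AE m in lborel. ?k m \<noteq> 0 \<longrightarrow> v (m *\<^sub>R x) = v x + (LBINT l. ray_kernel m l * ?e l)"
          using elim(1)
        proof eventually_elim
          case (elim m)
          show ?case
          proof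
            assume k: "?k m \<noteq> 0"
            then have "0 < m" using k0[of m] by linarith
            moreover have "q (m * norm x) \<noteq> 0" using k by (auto simp: ray_weight_def)
            then have "m * norm x < 1" using q0[of "m * norm x"] by auto
            ultimately show "v (m *\<^sub>R x) = v x + (LBINT l. ray_kernel m l * ?e l)" using elim x by blast
          qed
        qed
        ultimately have Z: "(LBINT m. ?k m * v (m *\<^sub>R x) + ?e m * (LBINT s. ?k s * indicator {..<m} s)) = 0"
          by (intro ray_by_parts[OF ik mk _ _ k0 _ kb]) (use Q in auto)
        have "indicator {0<..} l * l ^ ?n * (q (norm (l *\<^sub>R x)) * v (l *\<^sub>R x) + R (l *\<^sub>R x))
            = ?k l * v (l *\<^sub>R x) + ?e l * (LBINT s. ?k s * indicator {..<l} s)" for l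
        proof (cases "l > 0")
          case True
          have "l ^ ?n * R (l *\<^sub>R x) = ?e l * (LBINT s. ?k s * indicator {..<l} s)"
            using True x0 OW[of l, unfolded power_Suc] unfolding R_def by (simp add: field_simps power_mult_distrib)
          then show ?thesis using True by (simp add: ray_weight_def distrib_left mult_ac)
        next
          case False
          then have "?k s * indicator {..<l} s = 0" for s using k0[of s] by (cases "s < l") auto
          then have z: "(\<lambda>s. ?k s * indicator {..<l} s) = (\<lambda>_. 0)" by (rule ext)
          show ?thesis unfolding z using False by (simp add: ray_weight_def)
        qed
        then show "(LBINT l. indicator {0<..} l * l ^ ?n * (q (norm (l *\<^sub>R x)) * v (l *\<^sub>R x) + R (l *\<^sub>R x))) = 0"
          using Z by (simp only:)
      qed
    qed
  qed
  then show "(LBINT y. q (norm y) * v y + W (norm y) / norm y ^ ?n * ((h y \<bullet> y) / norm y)) = 0"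
    by (simp add: R_def)
qed

end

section \<open>The radial solution in the ball\<close>

text \<open>The hypothesis \<open>AR\<close> makes \<open>F t * t powr (- \<gamma>)\<close>
  nondecreasing for \<open>t \<ge> 1\<close>, so \<open>F\<close> grows at least like
  \<open>t powr \<gamma>\<close>. A second use of \<open>AR\<close> bounds the quotient below by a
  multiple of \<open>t powr (\<gamma> - p)\<close>.\<close>

lemma superlinear_quotient:
  fixes f :: "real \<Rightarrow> real"
  assumes f: "continuous_on {0..} f" and pos: "\<And>t. t > 0 \<Longrightarrow> 0 < f t"
    and AR: "\<And>t. t > 0 \<Longrightarrow> \<gamma> * integral {0..t} f \<le> f t * t" and \<gamma>: "\<gamma> > p" "p > 1"
  shows "filterlim (\<lambda>t. f t / t powr (p - 1)) at_top at_top"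
proof -
  define F where "F t = integral {0..t} f" for t
  have dF: "(F has_real_derivative f t) (at t)" if "t > 0" for t
  proof -
    have "(F has_real_derivative f t) (at t within {0..t + 1})"
      unfolding F_def by (rule integral_has_real_derivative) (use f that in \<open>auto intro: continuous_on_subset\<close>)
    then show ?thesis using that by (simp add: at_within_Icc_at)
  qed
  \<comment> \<open>The mean value theorem is applied on the interval from 1/2 to 1, where
    \<open>dF\<close> is available; the rest of the integral is nonnegative, with
    \<open>f 0 \<ge> 0\<close> by continuity.\<close>
  have F1: "F 1 > 0"
  proof -
    have "\<exists>z>1 / 2. z < 1 \<and> F 1 - F (1 / 2) = (1 - 1 / 2) * f z"
      by (rule MVT2) (auto intro!: dF)
    then obtain z where z: "1 / 2 < z" "F 1 - F (1 / 2) = (1 - 1 / 2) * f z" by blast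
    then have "F 1 > F (1 / 2)" using pos[of z] by simp
    moreover have "F (1 / 2) \<ge> 0"
      unfolding F_def
    proof (rule integral_nonneg)
      show "f integrable_on {0..1 / 2}" by (rule integrable_continuous_real[OF continuous_on_subset[OF f]]) auto
      have "f 0 \<ge> 0"
      proof (rule tendsto_lowerbound)
        have "(f \<longlongrightarrow> f 0) (at 0 within {0..})" using f by (auto simp: continuous_on_def)
        then show "(f \<longlongrightarrow> f 0) (at_right 0)" by (rule tendsto_within_subset) auto
        show "\<forall>\<^sub>F x in at_right 0. 0 \<le> f x"
          using eventually_at_right_less[of 0] by eventually_elim (auto intro!: less_imp_le pos)
      next
        show "at_right (0::real) \<noteq> bot" by (rule trivial_limit_at_right_real)
      qed
      then show "0 \<le> f x" if "x \<in> {0..1 / 2}" for x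
        using that pos[of x] by (cases "x = 0") auto
    qed
    ultimately show ?thesis by linarith
  qed
  have grow: "F 1 \<le> F t * t powr (- \<gamma>)" if t: "t \<ge> 1" for t
  proof -
    have "F 1 * 1 powr (- \<gamma>) \<le> F t * t powr (- \<gamma>)"
    proof (rule DERIV_nonneg_imp_nondecreasing[OF t])
      fix x :: real assume x: "1 \<le> x" "x \<le> t"
      have "((\<lambda>t. F t * t powr (- \<gamma>)) has_real_derivative f x * x powr (- \<gamma>) + F x * (- \<gamma> * x powr (- \<gamma> - 1))) (at x)"
        using x by (auto intro!: derivative_eq_intros dF)
      moreover have "f x * x powr (- \<gamma>) + F x * (- \<gamma> * x powr (- \<gamma> - 1)) = (f x * x - \<gamma> * F x) * x powr (- \<gamma> - 1)"
      proof -
        have "x powr (- \<gamma>) = x * x powr (- \<gamma> - 1)"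
          using x powr_mult_base[of x "- \<gamma> - 1"] by simp
        then show ?thesis by (simp add: algebra_simps)
      qed
      ultimately show "\<exists>y. ((\<lambda>t. F t * t powr (- \<gamma>)) has_real_derivative y) (at x) \<and> 0 \<le> y"
        using AR[of x] x by (intro exI[of _ "(f x * x - \<gamma> * F x) * x powr (- \<gamma> - 1)"]) (simp add: F_def)
    qed
    then show ?thesis by simp
  qed
  have low: "\<gamma> * F 1 * t powr (\<gamma> - p) \<le> f t / t powr (p - 1)" if t: "t \<ge> 1" for t
  proof -
    have "F 1 * t powr \<gamma> \<le> F t * t powr (- \<gamma>) * t powr \<gamma>" using grow[OF t] by (intro mult_right_mono) auto
    also have "\<dots> = F t" using t by (simp add: mult.assoc powr_add[symmetric])
    finally have "\<gamma> * (F 1 * t powr \<gamma>) \<le> \<gamma> * F t" using \<gamma> by (intro mult_left_mono) auto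
    also have "\<dots> \<le> f t * t" using AR[of t] t by (simp add: F_def)
    finally have *: "\<gamma> * F 1 * t powr \<gamma> \<le> f t * t" by (simp add: mult.assoc)
    have "\<gamma> * F 1 * t powr (\<gamma> - p) = \<gamma> * F 1 * t powr \<gamma> / t powr p" by (simp add: powr_diff)
    also have "\<dots> \<le> f t * t / t powr p" by (intro divide_right_mono *) simp
    also have "\<dots> = f t / t powr (p - 1)" using t by (simp add: powr_diff)
    finally show ?thesis .
  qed
  have "filterlim (\<lambda>t. \<gamma> * F 1 * t powr (\<gamma> - p)) at_top at_top"
  proof (rule filterlim_tendsto_pos_mult_at_top[OF tendsto_const])
    show "0 < \<gamma> * F 1" using \<gamma> F1 by simp
    show "filterlim (\<lambda>t::real. t powr (\<gamma> - p)) at_top at_top"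
    proof (rule filterlim_cong[THEN iffD1, OF refl refl])
      show "filterlim (\<lambda>t::real. exp ((\<gamma> - p) * ln t)) at_top at_top"
        using \<gamma> by (intro filterlim_compose[OF exp_at_top] filterlim_tendsto_pos_mult_at_top[OF tendsto_const _ ln_at_top]) auto
      show "\<forall>\<^sub>F t in at_top. exp ((\<gamma> - p) * ln t) = t powr (\<gamma> - p)"
        using eventually_gt_at_top[of 0] by eventually_elim (simp add: powr_def)
    qed
  qed
  then show ?thesis
    by (rule filterlim_at_top_mono) (rule eventually_mono[OF eventually_ge_at_top[of 1] low])
qed

text \<open>Difference quotients of an integrable function have integral zero by translation
  invariance. By the mean value theorem they are bounded by \<open>C\<close>, and they converge to
  \<open>D\<close>. No continuity of \<open>D\<close> is required.\<close>

lemma integral_directional_derivative_zero: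
  fixes F D :: "'n::euclidean_space \<Rightarrow> real"
  assumes deriv: "\<And>x. \<exists>F'. (F has_derivative F') (at x) \<and> F' i = D x"
    and D: "\<And>x. \<bar>D x\<bar> \<le> C" and supp: "\<And>x. x \<notin> ball 0 R \<Longrightarrow> F x = 0" and i: "norm i \<le> 1"
  shows "(LBINT x. D x) = 0"
proof -
  have C: "C \<ge> 0" using D[of 0] by linarith
  have cF: "continuous_on UNIV F"
    using deriv has_derivative_continuous by (auto simp: continuous_on_eq_continuous_at) blast
  have [measurable]: "F \<in> borel_measurable borel" by (rule borel_measurable_continuous_onI[OF cF])
  define t where "t k = inverse (real (Suc k))" for k
  have t: "0 < t k" "t k \<le> 1" for k by (simp_all add: t_def inverse_le_1_iff)
  have line: "((\<lambda>s. F (x + s *\<^sub>R i)) has_real_derivative D (x + s *\<^sub>R i)) (at s)" for x s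
  proof -
    obtain F' where F': "(F has_derivative F') (at (x + s *\<^sub>R i))" "F' i = D (x + s *\<^sub>R i)" using deriv by blast
    have "((\<lambda>s. x + s *\<^sub>R i) has_derivative (\<lambda>k. k *\<^sub>R i)) (at s)" by (auto intro!: derivative_eq_intros)
    from has_derivative_compose[OF this F'(1)] show ?thesis
      using linear_cmul[OF has_derivative_linear[OF F'(1)]] F'(2)
      by (simp add: has_field_derivative_def mult_commute_abs)
  qed
  define G where "G k x = (F (x + t k *\<^sub>R i) - F x) / t k" for k x
  have [measurable]: "G k \<in> borel_measurable borel" for k unfolding G_def by measurable
  \<comment> \<open>The shift has length at most 1, so \<open>G k\<close> vanishes outside radius
    \<open>R + 1\<close>.\<close>
  have Gb: "\<bar>G k x\<bar> \<le> C * indicator (cball 0 (R + 1)) x" for k x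
  proof (cases "x \<in> cball 0 (R + 1)")
    case True
    have "\<exists>z. 0 < z \<and> z < t k \<and> F (x + t k *\<^sub>R i) - F (x + 0 *\<^sub>R i) = (t k - 0) * D (x + z *\<^sub>R i)"
      by (rule MVT2[OF t(1) line])
    then obtain z where "F (x + t k *\<^sub>R i) - F x = t k * D (x + z *\<^sub>R i)" by auto
    then have "G k x = D (x + z *\<^sub>R i)" using t(1)[of k] by (simp add: G_def)
    then show ?thesis using True D by simp
  next
    case False
    have "norm (t k *\<^sub>R i) \<le> 1 * 1" unfolding norm_scaleR using t[of k] i by (intro mult_mono) auto
    then have "norm (x + t k *\<^sub>R i) \<ge> R"
      using False norm_triangle_ineq4[of "x + t k *\<^sub>R i" "t k *\<^sub>R i"] by simp
    then show ?thesis using False supp[of x] supp[of "x + t k *\<^sub>R i"] by (simp add: G_def)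
  qed
  have lim: "(\<lambda>k. G k x) \<longlonglongrightarrow> D x" for x
  proof -
    have "((\<lambda>s. (F (x + (0 + s) *\<^sub>R i) - F (x + 0 *\<^sub>R i)) / s) \<longlongrightarrow> D (x + 0 *\<^sub>R i)) (at 0)"
      using line[of x 0] by (simp only: DERIV_def)
    moreover have "filterlim t (at 0) sequentially"
      unfolding filterlim_at t_def using LIMSEQ_inverse_real_of_nat by (auto intro: always_eventually)
    ultimately show ?thesis unfolding G_def by (drule_tac filterlim_compose) auto
  qed
  have iF: "integrable lborel F"
  proof -
    have "compact (F ` cball 0 R)" by (rule compact_continuous_image[OF continuous_on_subset[OF cF]]) auto
    then have "bounded (F ` cball 0 R)" by (rule compact_imp_bounded)
    then obtain B where B: "\<forall>y\<in>F ` cball 0 R. norm y \<le> B" by (auto simp: bounded_iff)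
    show ?thesis
    proof (rule integrableI_bounded_set)
      show "emeasure lborel (cball (0::'n) R) < \<infinity>" by (rule emeasure_bounded_finite[OF bounded_cball])
      show "AE x in lborel. x \<in> cball 0 R \<longrightarrow> norm (F x) \<le> B" using B by (intro AE_I2) blast
      show "AE x in lborel. x \<notin> cball 0 R \<longrightarrow> F x = 0" using supp by auto
    qed auto
  qed
  have "(LBINT x. G k x) = 0" for k
  proof -
    have "lborel = distr lborel borel ((+) (t k *\<^sub>R i))" by (rule lborel_distr_plus[symmetric])
    then have "(LBINT x. F x) = (LINT x|distr lborel borel ((+) (t k *\<^sub>R i)). F x)" by simp
    also have "\<dots> = (LBINT x. F (x + t k *\<^sub>R i))" by (subst integral_distr) (auto simp: add.commute)
    finally have e: "(LBINT x. F (x + t k *\<^sub>R i)) = (LBINT x. F x)" ..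
    have "integrable (distr lborel borel ((+) (t k *\<^sub>R i))) F" using iF by (simp add: lborel_distr_plus)
    then have "integrable lborel (\<lambda>x. F (x + t k *\<^sub>R i))"
      by (subst (asm) integrable_distr_eq) (auto simp: add.commute)
    then show ?thesis unfolding G_def using iF e by (simp add: Bochner_Integration.integral_diff)
  qed
  moreover have "(\<lambda>k. LBINT x. G k x) \<longlonglongrightarrow> (LBINT x. D x)"
  proof (rule integral_dominated_convergence)
    show "D \<in> borel_measurable lborel" by (rule borel_measurable_LIMSEQ_real[OF lim]) measurable
    show "integrable lborel (\<lambda>x::'n. C * indicator (cball 0 (R + 1)) x)"
      using emeasure_bounded_finite[OF bounded_cball[of "0::'n" "R + 1"]] by (simp add: integrable_indicator_iff)
  qed (use lim Gb in auto)
  ultimately show ?thesis by (simp add: LIMSEQ_const_iff)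
qed

section \<open>Sobolev functions on the ball: Borel versions and radial examples\<close>

lemma completion_ex_borel_measurable_euclidean:
  fixes g :: "'a \<Rightarrow> 'b::euclidean_space"
  assumes g: "g \<in> borel_measurable (completion M)"
  shows "\<exists>g'\<in>borel_measurable M. (AE x in M. g x = g' x)"
proof -
  have "\<exists>g'\<in>borel_measurable M. (AE x in M. g x \<bullet> i = g' x)" for i
    by (rule completion_ex_borel_measurable_real) (rule borel_measurable_inner[OF g borel_measurable_const])
  then have "\<forall>i. \<exists>g'. g' \<in> borel_measurable M \<and> (AE x in M. g x \<bullet> i = g' x)"
    unfolding Bex_def by (rule allI)
  from choice[OF this] obtain c where "\<forall>i. c i \<in> borel_measurable M \<and> (AE x in M. g x \<bullet> i = c i x)" ..
  then have c: "c i \<in> borel_measurable M" "AE x in M. g x \<bullet> i = c i x" for i by simp_all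
  have "AE x in M. \<forall>i\<in>Basis. g x \<bullet> i = c i x"
    by (rule AE_finite_allI[OF finite_Basis c(2)])
  then have "AE x in M. g x = (\<Sum>i\<in>Basis. c i x *\<^sub>R i)"
  proof eventually_elim
    case (elim x)
    have "g x = (\<Sum>i\<in>Basis. (g x \<bullet> i) *\<^sub>R i)" by (rule euclidean_representation[symmetric])
    also have "\<dots> = (\<Sum>i\<in>Basis. c i x *\<^sub>R i)" by (rule sum.cong) (use elim in simp_all)
    finally show ?case .
  qed
  moreover have "(\<lambda>x. \<Sum>i\<in>Basis. c i x *\<^sub>R i) \<in> borel_measurable M"
    by (intro borel_measurable_sum borel_measurable_scaleR borel_measurable_const c)
  ultimately show ?thesis by (rule bexI)
qed

lemma le_one_plus_powr: "\<bar>t\<bar> \<le> 1 + \<bar>t\<bar> powr p" if "p \<ge> 1" for t p :: real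
proof (cases "\<bar>t\<bar> \<le> 1")
  case False
  then have "\<bar>t\<bar> powr 1 \<le> \<bar>t\<bar> powr p" using that by (intro powr_mono) auto
  then show ?thesis using False by simp
next
  case True
  then show ?thesis using powr_ge_zero[of "\<bar>t\<bar>" p] by linarith
qed

text \<open>Dilations and Fubini on product spaces call for Borel functions, whereas the Sobolev
  definition is about Lebesgue measurable ones. Integrability comes from
  \<open>t \<le> 1 + t powr p\<close> on a set of finite measure.\<close>

lemma sobolev_borel_version:
  fixes v0 :: "'n::euclidean_space \<Rightarrow> real" and h0 :: "'n \<Rightarrow> 'n"
  assumes p: "p \<ge> 1" and S: "sobolev_W1p_grad p (ball 0 1) v0 h0"
  obtains v h where "weak_pair v h"
    "AE x in lebesgue. v x = indicator (ball 0 1) x *\<^sub>R v0 x" "AE x in lebesgue. h x = indicator (ball 0 1) x *\<^sub>R h0 x"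
proof -
  let ?B = "ball (0::'n) 1"
  let ?V = "\<lambda>x. indicator ?B x *\<^sub>R v0 x" and ?H = "\<lambda>x. indicator ?B x *\<^sub>R h0 x"
  have V: "?V \<in> borel_measurable lebesgue" and H: "?H \<in> borel_measurable lebesgue"
    and Vp: "integrable lebesgue (\<lambda>x. indicator ?B x *\<^sub>R \<bar>v0 x\<bar> powr p)"
    and Hp: "integrable lebesgue (\<lambda>x. indicator ?B x *\<^sub>R norm (h0 x) powr p)"
    and W: "\<And>\<phi> i. test_fun ?B \<phi> \<Longrightarrow> i \<in> Basis \<Longrightarrow> (LINT x:?B|lebesgue. v0 x * partial_deriv i \<phi> x) = - (LINT x:?B|lebesgue. (h0 x \<bullet> i) * \<phi> x)"
    using S by (simp_all only: sobolev_W1p_grad_def set_borel_measurable_def set_integrable_def)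
  obtain v' where v' [measurable]: "v' \<in> borel_measurable lborel" and v'e: "AE x in lborel. ?V x = v' x"
    using completion_ex_borel_measurable_real[OF V] by auto
  obtain h' where h' [measurable]: "h' \<in> borel_measurable lborel" and h'e: "AE x in lborel. ?H x = h' x"
    using completion_ex_borel_measurable_euclidean[OF H] by auto
  define v where "v x = indicator ?B x * v' x" for x
  define h where "h x = indicator ?B x *\<^sub>R h' x" for x
  have [measurable]: "(indicator ?B :: 'n \<Rightarrow> real) \<in> borel_measurable borel"
    by (rule borel_measurable_indicator) simp
  have [measurable]: "v \<in> borel_measurable borel" "h \<in> borel_measurable borel"
    unfolding v_def[abs_def] h_def[abs_def] by measurable
  have ve: "AE x in lebesgue. v x = ?V x"
    using AE_completion[OF v'e] by eventually_elim (auto simp: v_def indicator_def)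
  have he: "AE x in lebesgue. h x = ?H x"
    using AE_completion[OF h'e] by eventually_elim (auto simp: h_def indicator_def)
  have iB: "integrable lebesgue (indicator ?B :: 'n \<Rightarrow> real)"
    using emeasure_bounded_finite[OF bounded_ball[of "0::'n" 1]] by (simp add: integrable_indicator_iff)
  have iv: "integrable lborel v"
  proof -
    have "integrable lebesgue v"
    proof (rule Bochner_Integration.integrable_bound[OF Bochner_Integration.integrable_add[OF iB Vp]])
      show "AE x in lebesgue. norm (v x) \<le> norm (indicator ?B x + indicator ?B x *\<^sub>R \<bar>v0 x\<bar> powr p)"
        using ve by eventually_elim (use le_one_plus_powr[OF p] in \<open>auto simp: indicator_def\<close>)
    qed (intro measurable_completion, measurable)
    then show ?thesis by (subst (asm) integrable_completion) measurable
  qed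
  have ih: "integrable lborel h"
  proof -
    have "integrable lebesgue h"
    proof (rule Bochner_Integration.integrable_bound[OF Bochner_Integration.integrable_add[OF iB Hp]])
      show "AE x in lebesgue. norm (h x) \<le> norm (indicator ?B x + indicator ?B x *\<^sub>R norm (h0 x) powr p)"
        using he by eventually_elim (use le_one_plus_powr[OF p, of "norm _"] in \<open>auto simp: indicator_def\<close>)
    qed (intro measurable_completion, measurable)
    then show ?thesis by (subst (asm) integrable_completion) measurable
  qed
  have "weak_pair v h"
  proof
    fix \<phi> i assume \<phi>: "test_fun ?B \<phi>" and i: "i \<in> (Basis :: 'n set)"
    have [measurable]: "\<phi> \<in> borel_measurable borel"
      using \<phi> by (intro borel_measurable_continuous_onI smooth_fun_continuous) (simp add: test_fun_def)
    have [measurable]: "partial_deriv i \<phi> \<in> borel_measurable borel"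
      using \<phi> i by (intro borel_measurable_continuous_onI smooth_fun_partial_continuous) (simp_all add: test_fun_def)
    have "(LBINT x. v x * partial_deriv i \<phi> x) = (LINT x|lebesgue. v x * partial_deriv i \<phi> x)"
      by (rule integral_completion[symmetric]) measurable
    also have "\<dots> = (LINT x|lebesgue. ?V x * partial_deriv i \<phi> x)"
    proof (rule integral_cong_AE)
      show "AE x in lebesgue. v x * partial_deriv i \<phi> x = ?V x * partial_deriv i \<phi> x"
        using ve by eventually_elim simp
    qed (intro borel_measurable_times V measurable_completion; measurable)+
    also have "\<dots> = (LINT x:?B|lebesgue. v0 x * partial_deriv i \<phi> x)"
      by (simp add: set_lebesgue_integral_def mult.assoc)
    also have "\<dots> = - (LINT x:?B|lebesgue. (h0 x \<bullet> i) * \<phi> x)" by (rule W[OF \<phi> i])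
    also have "(LINT x:?B|lebesgue. (h0 x \<bullet> i) * \<phi> x) = (LINT x|lebesgue. (?H x \<bullet> i) * \<phi> x)"
      by (simp add: set_lebesgue_integral_def mult.assoc)
    also have "\<dots> = (LINT x|lebesgue. (h x \<bullet> i) * \<phi> x)"
    proof (rule integral_cong_AE)
      show "AE x in lebesgue. (?H x \<bullet> i) * \<phi> x = (h x \<bullet> i) * \<phi> x"
        using he by eventually_elim simp
    qed (intro borel_measurable_times borel_measurable_inner H measurable_completion; measurable)+
    also have "\<dots> = (LBINT x. (h x \<bullet> i) * \<phi> x)"
      by (rule integral_completion) measurable
    finally show "(LBINT x. v x * partial_deriv i \<phi> x) = - (LBINT x. (h x \<bullet> i) * \<phi> x)" .
  qed (use iv ih in \<open>auto simp: v_def h_def\<close>)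
  then show thesis using ve he by (rule that)
qed

lemma bounded_set_integrable:
  fixes F :: "'n::euclidean_space \<Rightarrow> real"
  assumes "F \<in> borel_measurable borel" "\<And>x. x \<in> ball 0 1 \<Longrightarrow> \<bar>F x\<bar> \<le> C"
  shows "set_integrable lebesgue (ball 0 1) F"
proof -
  have "integrable lborel (\<lambda>x. indicator (ball 0 1) x *\<^sub>R F x)"
  proof (rule integrableI_bounded_set)
    show "emeasure lborel (ball (0::'n) 1) < \<infinity>" by (rule emeasure_bounded_finite[OF bounded_ball])
    show "AE x in lborel. x \<in> ball 0 1 \<longrightarrow> norm (indicator (ball 0 1) x *\<^sub>R F x) \<le> C" using assms(2) by simp
    show "(\<lambda>x. indicator (ball 0 1) x *\<^sub>R F x) \<in> borel_measurable lborel"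
      by (intro borel_measurable_scaleR borel_measurable_indicator) (use assms(1) in auto)
  qed auto
  then show ?thesis unfolding set_integrable_def
    by (subst integrable_completion) auto
qed

text \<open>The norm has no derivative at the origin; there \<open>\<psi> 0 = 0\<close> forces the
  difference quotient of \<open>u (norm x)\<close> to tend to 0, in agreement with
  \<open>sgn 0 = 0\<close>.\<close>

lemma radial_has_derivative:
  fixes x :: "'n::euclidean_space"
  assumes u': "\<And>r. r \<in> {0..1} \<Longrightarrow> (u has_real_derivative \<psi> r) (at r within {0..1})"
    and \<psi>0: "\<psi> 0 = 0" and x: "norm x < 1"
  shows "((\<lambda>x. u (norm x)) has_derivative (\<lambda>k. (\<psi> (norm x) *\<^sub>R sgn x) \<bullet> k)) (at x)"
proof (cases "x = 0")
  case False
  have "(u has_real_derivative \<psi> (norm x)) (at (norm x))"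
    using u'[of "norm x"] False x by (simp add: at_within_Icc_at)
  then have 1: "(u has_derivative (*) (\<psi> (norm x))) (at (norm x))" by (simp add: has_field_derivative_def)
  have 2: "(norm has_derivative (\<lambda>k. k \<bullet> sgn x)) (at x)"
    using False by (rule has_derivative_norm)
  from has_derivative_compose[OF 2 1] show ?thesis by (simp add: inner_commute)
next
  case True
  have "((\<lambda>r. (u r - u 0) / (r - 0)) \<longlongrightarrow> 0) (at 0 within {0..1})"
    using u'[of 0] \<psi>0 by (simp add: has_field_derivative_iff)
  moreover have "filterlim (\<lambda>y::'n. norm y) (at 0 within {0..1}) (at 0)"
    unfolding filterlim_at
  proof
    show "\<forall>\<^sub>F y::'n in at 0. norm y \<in> {0..1} \<and> norm y \<noteq> 0"
      by (rule eventually_at_ball'[of 1 0 UNIV, THEN eventually_mono]) auto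
    show "((\<lambda>y::'n. norm y) \<longlongrightarrow> 0) (at 0)" by (rule tendsto_norm_zero) (rule tendsto_ident_at)
  qed
  ultimately have lim: "((\<lambda>y::'n. (u (norm y) - u 0) / norm y) \<longlongrightarrow> 0) (at 0)"
    by (drule_tac filterlim_compose) auto
  have "((\<lambda>y::'n. u (norm y)) has_derivative (\<lambda>k. 0)) (at 0)"
    unfolding has_derivative_within
  proof (intro conjI)
    show "bounded_linear (\<lambda>k::'n. 0::real)" by (rule bounded_linear_zero)
    show "((\<lambda>y::'n. (1 / norm (y - 0)) *\<^sub>R (u (norm y) - (u (norm (0::'n)) + 0))) \<longlongrightarrow> 0) (at 0)"
      using lim by (simp add: divide_inverse mult.commute)
  qed
  then show ?thesis using True by simp
qed

text \<open>The product of \<open>u (norm x)\<close> with a test function is differentiable on the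
  whole space: by the product rule in the ball, and because it vanishes nearby elsewhere. The
  integral of its directional derivative is therefore zero, which is the weak gradient
  identity.\<close>

lemma radial_sobolev:
  assumes u: "continuous_on UNIV u" and u': "\<And>r. r \<in> {0..1} \<Longrightarrow> (u has_real_derivative \<psi> r) (at r within {0..1})"
    and \<psi>0: "\<psi> 0 = 0" and \<psi>m [measurable]: "\<psi> \<in> borel_measurable borel"
    and \<psi>b: "\<And>r. r \<in> {0..1} \<Longrightarrow> \<bar>\<psi> r\<bar> \<le> M" and p: "p > 0"
  shows "sobolev_W1p_grad p (ball (0::'n::euclidean_space) 1) (\<lambda>x. u (norm x)) (\<lambda>x. \<psi> (norm x) *\<^sub>R sgn x)"
proof -
  let ?B = "ball (0::'n) 1" and ?U = "\<lambda>x::'n. u (norm x)" and ?g = "\<lambda>x::'n. \<psi> (norm x) *\<^sub>R sgn x"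
  have M: "M \<ge> 0" using \<psi>b[of 0] by auto
  have [measurable]: "u \<in> borel_measurable borel" by (rule borel_measurable_continuous_onI[OF u])
  have [measurable]: "(indicator ?B :: 'n \<Rightarrow> real) \<in> borel_measurable borel"
    by (rule borel_measurable_indicator) simp
  have [measurable]: "(sgn :: 'n \<Rightarrow> 'n) \<in> borel_measurable borel"
    unfolding sgn_div_norm[abs_def] by measurable
  have "compact (u ` {0..1})" by (rule compact_continuous_image[OF continuous_on_subset[OF u]]) auto
  then have "bounded (u ` {0..1})" by (rule compact_imp_bounded)
  then obtain K where "\<forall>y\<in>u ` {0..1}. norm y \<le> K" by (auto simp: bounded_iff)
  then have K: "\<bar>u r\<bar> \<le> K" if "r \<in> {0..1}" for r using that by auto
  have gb: "norm (?g x) \<le> M" if "x \<in> ?B" for x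
    using \<psi>b[of "norm x"] that M by (simp add: norm_sgn)
  show ?thesis
    unfolding sobolev_W1p_grad_def
  proof (intro conjI allI impI ballI)
    show "set_borel_measurable lebesgue ?B ?U" "set_borel_measurable lebesgue ?B ?g"
      unfolding set_borel_measurable_def by (rule measurable_completion, measurable)+
    show "set_integrable lebesgue ?B (\<lambda>x. \<bar>?U x\<bar> powr p)"
    proof (rule bounded_set_integrable)
      fix x assume "x \<in> ?B"
      then have "\<bar>?U x\<bar> powr p \<le> K powr p" using K[of "norm x"] p by (intro powr_mono2) auto
      then show "\<bar>\<bar>?U x\<bar> powr p\<bar> \<le> K powr p" by simp
    qed measurable
    show "set_integrable lebesgue ?B (\<lambda>x. norm (?g x) powr p)"
    proof (rule bounded_set_integrable)
      fix x assume "x \<in> ?B"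
      then have "norm (?g x) powr p \<le> M powr p" using gb[of x] p by (intro powr_mono2) auto
      then show "\<bar>norm (?g x) powr p\<bar> \<le> M powr p" by simp
    qed measurable
  next
    fix \<phi> i assume \<phi>: "test_fun ?B \<phi>" and i: "i \<in> (Basis :: 'n set)"
    have s\<phi>: "smooth_fun \<phi>" using \<phi> by (simp add: test_fun_def)
    have [measurable]: "\<phi> \<in> borel_measurable borel"
      by (intro borel_measurable_continuous_onI smooth_fun_continuous s\<phi>)
    have [measurable]: "partial_deriv i \<phi> \<in> borel_measurable borel"
      by (intro borel_measurable_continuous_onI smooth_fun_partial_continuous s\<phi> i)
    obtain C0 where C0: "C0 \<ge> 0" "\<And>x. \<bar>\<phi> x\<bar> \<le> C0" using test_fun_bounded[OF \<phi>] by blast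
    obtain C1 where C1: "C1 \<ge> 0" "\<And>x. \<bar>partial_deriv i \<phi> x\<bar> \<le> C1" using test_fun_partial_bounded[OF \<phi> i] by blast
    define D where "D x = indicator ?B x * (?U x * partial_deriv i \<phi> x + (?g x \<bullet> i) * \<phi> x)" for x
    have b1: "\<bar>?U x * partial_deriv i \<phi> x\<bar> \<le> K * C1" if "x \<in> ?B" for x
      unfolding abs_mult using K[of "norm x"] C1 that by (intro mult_mono) auto
    have b2: "\<bar>(?g x \<bullet> i) * \<phi> x\<bar> \<le> M * C0" if "x \<in> ?B" for x
    proof -
      have "\<bar>?g x \<bullet> i\<bar> \<le> M" using Basis_le_norm[OF i, of "?g x"] gb[OF that] by linarith
      then show ?thesis unfolding abs_mult using C0 M by (intro mult_mono) auto
    qed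
    have "0 \<le> K" using K[of 0] by simp
    then have KC: "0 \<le> K * C1 + M * C0" using M C0 C1 by simp
    have "(LBINT x. D x) = 0"
    proof (rule integral_directional_derivative_zero[where F="\<lambda>x. ?U x * \<phi> x" and i=i and R=1 and C="K * C1 + M * C0"])
      show "\<bar>D x\<bar> \<le> K * C1 + M * C0" for x
      proof (cases "x \<in> ?B")
        case True
        then show ?thesis using b1[of x] b2[of x] by (simp add: D_def)
      qed (use KC in \<open>simp add: D_def\<close>)
      show "?U x * \<phi> x = 0" if "x \<notin> ball 0 1" for x using test_fun_outside[OF \<phi> that] by simp
      show "norm i \<le> 1" using i by simp
      show "\<exists>F'. ((\<lambda>x. ?U x * \<phi> x) has_derivative F') (at x) \<and> F' i = D x" for x
      proof (cases "x \<in> ?B")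
        case True
        then have "norm x < 1" by simp
        note d = has_derivative_mult[OF radial_has_derivative[OF u' \<psi>0 this] has_derivative_partial[OF smooth_fun_differentiable[OF s\<phi>]]]
        show ?thesis
          by (rule exI, rule conjI, rule d) (use True in \<open>simp_all add: D_def partial_deriv_def\<close>)
      next
        case False
        have "((\<lambda>x. ?U x * \<phi> x) has_derivative (\<lambda>k. 0)) (at x)"
        proof (rule has_derivative_transform_within_open[where f="\<lambda>x. 0" and s="- closure {x. \<phi> x \<noteq> 0}"])
          show "x \<in> - closure {x. \<phi> x \<noteq> 0}" using False \<phi> by (auto simp: test_fun_def)
          show "0 = ?U y * \<phi> y" if "y \<in> - closure {x. \<phi> x \<noteq> 0}" for y
            using that closure_subset[of "{x. \<phi> x \<noteq> 0}"] by auto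
        qed auto
        then show ?thesis using False by (intro exI[of _ "\<lambda>k. 0"]) (simp add: D_def)
      qed
    qed
    moreover have "(LINT x|lebesgue. D x) = (LBINT x. D x)"
      by (rule integral_completion) (unfold D_def[abs_def], measurable)
    moreover have "(LINT x|lebesgue. D x) = (LINT x:?B|lebesgue. ?U x * partial_deriv i \<phi> x) + (LINT x:?B|lebesgue. (?g x \<bullet> i) * \<phi> x)"
    proof -
      have "(LINT x|lebesgue. D x) = (LINT x:?B|lebesgue. ?U x * partial_deriv i \<phi> x + (?g x \<bullet> i) * \<phi> x)"
        by (simp add: set_lebesgue_integral_def D_def)
      also have "\<dots> = (LINT x:?B|lebesgue. ?U x * partial_deriv i \<phi> x) + (LINT x:?B|lebesgue. (?g x \<bullet> i) * \<phi> x)"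
        by (intro set_integral_add bounded_set_integrable[OF _ b1] bounded_set_integrable[OF _ b2]) measurable
      finally show ?thesis .
    qed
    ultimately show "(LINT x:?B|lebesgue. ?U x * partial_deriv i \<phi> x) = - (LINT x:?B|lebesgue. (?g x \<bullet> i) * \<phi> x)"
      by linarith
  qed
qed

text \<open>One good ray gives integrability of \<open>s ^ n * \<alpha> s\<close>. The power is then
  removed: on the outer half it is at least \<open>(1 / 2) ^ n\<close>, and on the inner half
  monotonicity bounds \<open>\<alpha>\<close> by \<open>\<alpha> (1 / 2)\<close>.\<close>

lemma radial_L1_imp_integrable:
  fixes \<alpha> :: "real \<Rightarrow> real"
  assumes L1: "integrable lborel (\<lambda>y::'n::euclidean_space. \<alpha> (norm y))"
    and out: "\<And>s. s \<notin> {0<..<1} \<Longrightarrow> \<alpha> s = 0" and nonneg: "\<And>s. 0 \<le> \<alpha> s"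
    and mono: "mono_on {0<..<1} \<alpha>" and [measurable]: "\<alpha> \<in> borel_measurable borel"
  shows "integrable lborel \<alpha>"
proof -
  let ?n = "DIM('n) - 1"
  have "AE x in lborel. (x::'n) \<in> shell \<longrightarrow> integrable lborel (\<lambda>l. indicator {0<..} l * l ^ ?n * \<alpha> (norm (l *\<^sub>R x)))"
    by (rule AE_integrable_rays[OF L1])
  \<comment> \<open>The shell is open and nonempty, so an almost-everywhere statement holds at one
    of its points.\<close>
  moreover have "\<not> (AE x in lborel. (x::'n) \<notin> shell)"
  proof
    assume "AE x in lborel. (x::'n) \<notin> shell"
    then have "(shell :: 'n set) \<in> null_sets lborel" using AE_iff_null_sets[of "shell :: 'n set" lborel] by simp
    then have "negligible (shell :: 'n set)" unfolding negligible_iff_null_sets by (rule null_sets_completionI)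
    moreover have "open (shell :: 'n set)" unfolding shell_def
      by (intro open_Collect_conj open_Collect_less continuous_intros)
    moreover obtain b :: 'n where "b \<in> Basis" using nonempty_Basis by blast
    then have "(3 / 4) *\<^sub>R b \<in> shell" by (simp add: shell_def)
    ultimately show False using open_not_negligible by blast
  qed
  ultimately obtain x :: 'n where x: "x \<in> shell" "integrable lborel (\<lambda>l. indicator {0<..} l * l ^ ?n * \<alpha> (norm (l *\<^sub>R x)))"
    by (smt (verit, best) eventually_mono)
  have x0: "norm x > 0" using x(1) unfolding shell_def mem_Collect_eq by linarith
  have "(\<lambda>l. indicator {0<..} l * l ^ ?n * \<alpha> (norm (l *\<^sub>R x))) = (\<lambda>l. (1 / norm x ^ ?n) * ((0 + norm x * l) ^ ?n * \<alpha> (0 + norm x * l)))"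
  proof
    fix l
    show "indicator {0<..} l * l ^ ?n * \<alpha> (norm (l *\<^sub>R x)) = (1 / norm x ^ ?n) * ((0 + norm x * l) ^ ?n * \<alpha> (0 + norm x * l))"
    proof (cases "l > 0")
      case True
      then show ?thesis using x0 by (simp add: power_mult_distrib mult.commute[of "norm x" l])
    next
      case False
      then have "\<alpha> (norm x * l) = 0" using x0 by (intro out) (auto simp: zero_less_mult_iff)
      then show ?thesis using False by simp
    qed
  qed
  then have "integrable lborel (\<lambda>l. (1 / norm x ^ ?n) * ((0 + norm x * l) ^ ?n * \<alpha> (0 + norm x * l)))"
    using x(2) by simp
  from integrable_mult_right[OF this, of "norm x ^ ?n"]
  have "integrable lborel (\<lambda>l. (0 + norm x * l) ^ ?n * \<alpha> (0 + norm x * l))"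
    unfolding mult.assoc[symmetric] using x0 by simp
  then have I: "integrable lborel (\<lambda>s. s ^ ?n * \<alpha> s)"
    using lborel_integrable_real_affine_iff[of "norm x" "\<lambda>s. s ^ ?n * \<alpha> s" 0] x0 by simp
  show ?thesis
  proof (rule Bochner_Integration.integrable_bound)
    show "integrable lborel (\<lambda>s. 2 ^ ?n * (s ^ ?n * \<alpha> s) + \<alpha> (1 / 2) * indicator {0<..<1} s)"
      using I by (intro Bochner_Integration.integrable_add integrable_mult_right) (auto simp: integrable_indicator_iff)
    show "AE s in lborel. norm (\<alpha> s) \<le> norm (2 ^ ?n * (s ^ ?n * \<alpha> s) + \<alpha> (1 / 2) * indicator {0<..<1} s)"
    proof (rule AE_I2)
      fix s :: real
      show "norm (\<alpha> s) \<le> norm (2 ^ ?n * (s ^ ?n * \<alpha> s) + \<alpha> (1 / 2) * indicator {0<..<1} s)"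
      proof (cases "s \<in> {0<..<1}")
        case True
        have "\<alpha> s \<le> 2 ^ ?n * (s ^ ?n * \<alpha> s) + \<alpha> (1 / 2)"
        proof (cases "s \<le> 1 / 2")
          case le: True
          have "\<alpha> s \<le> \<alpha> (1 / 2)" using mono True le by (auto simp: mono_on_def)
          moreover have "0 \<le> 2 ^ ?n * (s ^ ?n * \<alpha> s)" using True nonneg[of s] by simp
          ultimately show ?thesis by linarith
        next
          case False
          then have "1 \<le> (2 * s) ^ ?n" by (intro one_le_power) simp
          then have "1 * \<alpha> s \<le> (2 * s) ^ ?n * \<alpha> s" by (intro mult_right_mono nonneg)
          then show ?thesis using nonneg[of "1 / 2"] by (simp add: power_mult_distrib mult.assoc)
        qed
        then show ?thesis using True nonneg[of s] by simp
      qed (simp add: out)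
    qed
  qed measurable
qed

lemma radial_data_intro:
  fixes p :: real and a f :: "real \<Rightarrow> real"
  defines "\<alpha> \<equiv> \<lambda>s. if s \<in> {0<..<1} then a s else 0"
  assumes p: "1 < p"
    and a_L1: "set_integrable lebesgue (ball (0::'n::euclidean_space) 1) (\<lambda>x. a (norm x))"
    and a_incr: "mono_on {0..<1} a"
    and a_pos: "AE r in lborel. r \<in> {0..1} \<longrightarrow> a r > 0"
    and f_cont: "continuous_on {0..} f"
    and f_small: "((\<lambda>t. f t / t powr (p - 1)) \<longlongrightarrow> 0) (at_right 0)"
    and f_AR: "\<exists>\<gamma>>p. \<forall>t>0. f t * t \<ge> \<gamma> * integral {0..t} f"
    and f_mono: "strict_mono_on {0<..} (\<lambda>t. f t / t powr (p - 1))"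
  shows "radial_data p \<alpha> f"
proof -
  \<comment> \<open>Positivity almost everywhere provides a positive value somewhere before
    \<open>s\<close>, and monotonicity carries it to \<open>s\<close>.\<close>
  have pos: "a s > 0" if s: "s \<in> {0<..<1}" for s
  proof -
    have "\<exists>r\<in>{0<..<s}. a r > 0"
    proof (rule ccontr)
      assume "\<not> (\<exists>r\<in>{0<..<s}. a r > 0)"
      then have "AE r in lborel. r \<notin> {0<..<s}"
        using a_pos by (auto elim!: eventually_mono) (use s in auto)
      then have "{0<..<s} \<in> null_sets lborel" using AE_iff_null_sets[of "{0<..<s}" lborel] by simp
      then show False using s by (simp add: null_sets_def)
    qed
    then obtain r where r: "0 < r" "r < s" "a r > 0" by auto
    have "a r \<le> a s" using a_incr r s by (auto simp: mono_on_def)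
    with r show ?thesis by linarith
  qed
  have out: "\<alpha> s = 0" if "s \<notin> {0<..<1}" for s using that by (auto simp: \<alpha>_def)
  have nonneg: "0 \<le> \<alpha> s" for s using pos[of s] by (simp add: \<alpha>_def less_imp_le)
  have mono: "mono_on {0<..<1} \<alpha>" using a_incr by (auto simp: \<alpha>_def mono_on_def)
  have meas [measurable]: "\<alpha> \<in> borel_measurable borel"
  proof -
    have "mono_on {0<..<1} a" using a_incr by (auto simp: mono_on_def)
    then have "a \<in> borel_measurable (restrict_space borel {0<..<1})" by (rule borel_measurable_mono_on_fnc)
    then have "(\<lambda>s. indicator {0<..<1} s *\<^sub>R a s) \<in> borel_measurable borel"
      by (subst (asm) borel_measurable_restrict_space_iff) auto
    moreover have "(\<lambda>s. indicator {0<..<1} s *\<^sub>R a s) = \<alpha>" by (auto simp: \<alpha>_def indicator_def)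
    ultimately show ?thesis by simp
  qed
  have L1: "integrable lborel (\<lambda>y::'n. \<alpha> (norm y))"
  proof -
    have "integrable lebesgue (\<lambda>y::'n. \<alpha> (norm y))"
    proof (rule integrable_cong_AE[THEN iffD1])
      show "integrable lebesgue (\<lambda>x::'n. indicator (ball 0 1) x *\<^sub>R a (norm x))"
        using a_L1 by (simp add: set_integrable_def)
      then show "(\<lambda>x::'n. indicator (ball 0 1) x *\<^sub>R a (norm x)) \<in> borel_measurable lebesgue" by auto
      show "(\<lambda>y::'n. \<alpha> (norm y)) \<in> borel_measurable lebesgue" by (rule measurable_completion) measurable
      have "AE x in lborel. x \<noteq> (0::'n)" by (rule AE_lborel_singleton)
      from AE_completion[OF this]
      show "AE x in lebesgue. indicator (ball 0 1) x *\<^sub>R a (norm x) = \<alpha> (norm (x::'n))"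
        by eventually_elim (auto simp: \<alpha>_def indicator_def)
    qed
    then show ?thesis by (subst (asm) integrable_completion) measurable
  qed
  define g where "g t = f t / t powr (p - 1)" for t
  have g_mono: "g s \<le> g t" if "0 < s" "s \<le> t" for s t
    using f_mono that by (cases "s = t") (auto simp: strict_mono_on_def g_def less_imp_le)
  \<comment> \<open>The sign of \<open>f\<close> comes from its quotient, which increases strictly
    from the limit 0 at the origin.\<close>
  have g_pos: "0 < g t" if t: "t > 0" for t
  proof -
    have "0 \<le> g (t / 2)"
    proof (rule tendsto_upperbound)
      show "(g \<longlongrightarrow> 0) (at_right 0)" using f_small by (simp add: g_def[abs_def])
      show "\<forall>\<^sub>F s in at_right 0. g s \<le> g (t / 2)"
        unfolding eventually_at_right_field using t by (intro exI[of _ "t / 2"]) (auto intro!: g_mono)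
    qed simp
    moreover have "g (t / 2) < g t" using f_mono t by (auto simp: strict_mono_on_def g_def)
    ultimately show ?thesis by linarith
  qed
  have f_pos: "0 < f t" if "t > 0" for t
    using g_pos[OF that] that by (simp add: g_def zero_less_divide_iff)
  obtain \<gamma> where \<gamma>: "\<gamma> > p" "\<And>t. t > 0 \<Longrightarrow> \<gamma> * integral {0..t} f \<le> f t * t" using f_AR by blast
  show ?thesis
  proof
    show "1 < p" by (rule p)
    show "integrable lborel \<alpha>" by (rule radial_L1_imp_integrable[OF L1 out nonneg mono meas])
    show "\<alpha> s = 0" if "s \<notin> {0<..<1}" for s by (rule out[OF that])
    show "0 < \<alpha> s" if "s \<in> {0<..<1}" for s using pos[OF that] that by (simp add: \<alpha>_def)
    show "mono_on {0<..<1} \<alpha>" by (rule mono)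
    show "continuous_on {0<..} f" by (rule continuous_on_subset[OF f_cont]) auto
    show "0 < f t" if "t > 0" for t by (rule f_pos[OF that])
    show "f s / s powr (p - 1) \<le> f t / t powr (p - 1)" if "0 < s" "s \<le> t" for s t
      using g_mono[OF that] by (simp add: g_def)
    show "((\<lambda>t. f t / t powr (p - 1)) \<longlongrightarrow> 0) (at_right 0)" by (rule f_small)
    show "filterlim (\<lambda>t. f t / t powr (p - 1)) at_top at_top"
      by (rule superlinear_quotient[OF f_cont f_pos \<gamma>(2) \<gamma>(1) p])
  qed
qed

theorem theorem3p1:
  fixes p :: real and a :: "real \<Rightarrow> real" and f :: "real \<Rightarrow> real"
  assumes N3: "DIM('n::euclidean_space) \<ge> 3"
    and p: "1 < p"
    \<comment> \<open>(A)\<close>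
    and a_L1: "set_integrable lebesgue (ball (0::'n) 1) (\<lambda>x. a (norm x))"
    and a_nonconst: "\<not> (\<exists>c. \<forall>r\<in>{0..<1}. a r = c)"
    and a_incr: "mono_on {0..<1} a"
    and a_pos: "AE r in lborel. r \<in> {0..1} \<longrightarrow> a r > 0"
    \<comment> \<open>(F')\<close>
    and f_C1: "\<exists>f'. (\<forall>t\<ge>0. (f has_real_derivative f' t) (at t within {0..}))
                  \<and> continuous_on {0..} f'
                  \<and> (\<forall>t>0. f' t * t - (p - 1) * f t > 0)"
    and f_small: "((\<lambda>t. f t / t powr (p - 1)) \<longlongrightarrow> 0) (at_right 0)"
    and f_AR: "\<exists>\<gamma>>p. \<forall>t>0. f t * t \<ge> \<gamma> * integral {0..t} f"
    \<comment> \<open>(F'')\<close>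
    and f_mono: "strict_mono_on {0<..} (\<lambda>t. f t / t powr (p - 1))"
  shows "\<exists>u :: 'n \<Rightarrow> real.
           weak_solution_neumann p (ball 0 1) a f u
         \<and> (\<forall>x\<in>ball 0 1. u x > 0)
         \<and> (\<exists>\<psi>. (\<forall>x\<in>ball 0 1. u x = \<psi> (norm x)) \<and> mono_on {0..<1} \<psi>)"
proof -
  let ?n = "DIM('n) - 1" and ?B = "ball (0::'n) 1"
  define \<alpha> where "\<alpha> = (\<lambda>s. if s \<in> {0<..<1} then a s else 0)"
  have f_cont: "continuous_on {0..} f"
  proof -
    obtain f' where "\<forall>t\<ge>0. (f has_real_derivative f' t) (at t within {0..})" using f_C1 by blast
    then show ?thesis by (intro DERIV_continuous_on) auto
  qed
  interpret radial_data p "DIM('n) - 1" \<alpha> f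
    unfolding \<alpha>_def by (rule radial_data_intro[OF p a_L1 a_incr a_pos f_cont f_small f_AR f_mono])
  obtain u w :: "real \<Rightarrow> real" and C :: real where
    u_pos: "\<And>r. r \<in> {0..1} \<Longrightarrow> 0 < u r" and u_mono: "mono_on {0..1} u" and u_cont: "continuous_on UNIV u"
    and w_eq: "\<And>r. r \<in> {0..1} \<Longrightarrow> w r = (LBINT s:{0..<r}. s ^ ?n * (u s powr (p - 1) - \<alpha> s * f (u s)))"
    and w1: "w 1 = 0" and w_cont: "continuous_on UNIV w"
    and w_ge: "\<And>r. r \<in> {0..1} \<Longrightarrow> 0 \<le> w r" and w_le: "\<And>r. r \<in> {0..1} \<Longrightarrow> w r \<le> C * r ^ Suc ?n"
    and u_eq: "\<And>r. r \<in> {0..1} \<Longrightarrow> u r = u 0 + (LBINT s:{0..<r}. (w s / s ^ ?n) powr (1 / (p - 1)))"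
    by (fact radial_profile)
  have n: "?n > 0" using N3 by simp
  \<comment> \<open>The radial component of the flux: \<open>\<psi>\<close> will be
    \<open>u'\<close>, and \<open>\<Omega>\<close> is its power \<open>p - 1\<close>.\<close>
  define \<Omega> where "\<Omega> r = w r / r ^ ?n" for r
  define \<psi> where "\<psi> r = \<Omega> r powr (1 / (p - 1))" for r
  \<comment> \<open>A default value of division by zero, valid because \<open>0 ^ n = 0\<close> for
    \<open>n > 0\<close>. It is also the limit at 0 by \<open>\<Omega>_le\<close>, so
    \<open>\<Omega>\<close> is continuous on the closed interval.\<close>
  have \<Omega>0: "\<Omega> 0 = 0" using n by (simp add: \<Omega>_def)
  have \<Omega>_ge: "0 \<le> \<Omega> r" if "r \<in> {0..1}" for r using w_ge[OF that] that by (simp add: \<Omega>_def)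
  have \<Omega>_le: "\<Omega> r \<le> C * r" if "r \<in> {0..1}" for r
  proof (cases "r = 0")
    case False
    then have "0 < r ^ ?n" using that by simp
    then show ?thesis using w_le[OF that] unfolding \<Omega>_def power_Suc by (simp add: pos_divide_le_eq mult.assoc)
  qed (simp add: \<Omega>0)
  have \<Omega>_cont: "continuous_on {0..1} \<Omega>"
    unfolding continuous_on_def
  proof
    fix t :: real assume t: "t \<in> {0..1}"
    show "(\<Omega> \<longlongrightarrow> \<Omega> t) (at t within {0..1})"
    proof (cases "t = 0")
      case True
      have "(\<Omega> \<longlongrightarrow> 0) (at 0 within {0..1})"
      proof (rule tendsto_sandwich[where f="\<lambda>_. 0" and h="\<lambda>r. C * r"])
        show "\<forall>\<^sub>F r in at 0 within {0..1}. 0 \<le> \<Omega> r" "\<forall>\<^sub>F r in at 0 within {0..1}. \<Omega> r \<le> C * r"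
          unfolding eventually_at_filter using \<Omega>_ge \<Omega>_le by (auto intro!: always_eventually)
        have "((\<lambda>r. C * r) \<longlongrightarrow> C * 0) (at 0 within {0..1})" by (intro tendsto_intros)
        then show "((\<lambda>r. C * r) \<longlongrightarrow> 0) (at 0 within {0..1})" by simp
      qed simp
      then show ?thesis using True \<Omega>0 by simp
    next
      case False
      have "isCont w t" using w_cont by (simp add: continuous_on_eq_continuous_at)
      then have "isCont \<Omega> t" unfolding \<Omega>_def[abs_def] using False by (intro continuous_intros) auto
      then have "continuous (at t within {0..1}) \<Omega>" by (rule continuous_at_imp_continuous_at_within)
      then show ?thesis by (simp only: continuous_within)
    qed
  qed
  have \<psi>_cont: "continuous_on {0..1} \<psi>"
    unfolding \<psi>_def[abs_def] using \<Omega>_ge p by (intro continuous_on_powr' \<Omega>_cont continuous_on_const) auto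
  have \<psi>0: "\<psi> 0 = 0" by (simp add: \<psi>_def \<Omega>0)
  have [measurable]: "u \<in> borel_measurable borel" "w \<in> borel_measurable borel"
    by (rule borel_measurable_continuous_onI[OF u_cont], rule borel_measurable_continuous_onI[OF w_cont])
  have \<psi>m [measurable]: "\<psi> \<in> borel_measurable borel" unfolding \<psi>_def[abs_def] \<Omega>_def[abs_def] by measurable
  have u': "(u has_real_derivative \<psi> t) (at t within {0..1})" if t: "t \<in> {0..1}" for t
  proof -
    have I: "u r = u 0 + integral {0..r} \<psi>" if r: "r \<in> {0..1}" for r
    proof -
      have "u r = u 0 + (LBINT s:{0..<r}. \<psi> s)" using u_eq[OF r] by (simp only: \<psi>_def \<Omega>_def)
      also have "(LBINT s:{0..<r}. \<psi> s) = (LBINT s:{0..r}. \<psi> s)"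
        unfolding set_lebesgue_integral_def
        by (rule integral_discrete_difference[where X="{r}"]) (auto simp: indicator_def)
      also have "\<dots> = integral {0..r} \<psi>"
        by (rule set_borel_integral_eq_integral(2), rule borel_integrable_atLeastAtMost')
           (use r in \<open>auto intro: continuous_on_subset[OF \<psi>_cont]\<close>)
      finally show ?thesis .
    qed
    have "((\<lambda>r. u 0 + integral {0..r} \<psi>) has_real_derivative \<psi> t) (at t within {0..1})"
      using integral_has_real_derivative[OF \<psi>_cont t] by (auto intro!: derivative_eq_intros)
    then show ?thesis
      by (rule has_field_derivative_transform_within[OF _ zero_less_one t]) (rule I[symmetric])
  qed
  have "compact (\<psi> ` {0..1})" by (rule compact_continuous_image[OF \<psi>_cont]) simp
  then have "bounded (\<psi> ` {0..1})" by (rule compact_imp_bounded)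
  then obtain M where "\<forall>y\<in>\<psi> ` {0..1}. norm y \<le> M" by (auto simp: bounded_iff)
  then have \<psi>b: "\<bar>\<psi> r\<bar> \<le> M" if "r \<in> {0..1}" for r using that by auto
  let ?U = "\<lambda>x::'n. u (norm x)" and ?g = "\<lambda>x::'n. \<psi> (norm x) *\<^sub>R sgn x"
  have sob: "sobolev_W1p_grad p ?B ?U ?g"
    by (rule radial_sobolev[OF u_cont u' \<psi>0 \<psi>m \<psi>b]) (use p in auto)
  \<comment> \<open>\<open>q\<close> is the radial derivative of \<open>w\<close> divided by
    \<open>r^n\<close>. The part \<open>q1\<close> is kept apart because the integrability of
    \<open>q1 (norm x) * v x\<close> is itself one of the claims of a weak solution.\<close>
  define q1 where "q1 s = \<alpha> s * f (u s)" for s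
  define q where "q s = indicator {0<..<1} s * u s powr (p - 1) - q1 s" for s
  have u_bd: "u s \<in> {u 0..u 1}" if "s \<in> {0..1}" for s
    using u_mono that by (auto simp: mono_on_def)
  \<comment> \<open>Outside the unit interval \<open>u\<close> is arbitrary, so \<open>f\<close> is
    evaluated at \<open>max (u 0) (u s)\<close>; in the unit interval the maximum is
    \<open>u s\<close>.\<close>
  have fu_meas: "(\<lambda>s. f (max (u 0) (u s))) \<in> borel_measurable borel"
    by (intro borel_measurable_continuous_onI continuous_on_compose2[OF f_cont, of UNIV "\<lambda>s. max (u 0) (u s)"] continuous_intros u_cont)
       (use u_pos[of 0] in auto)
  have q1_eq: "q1 s = \<alpha> s * f (max (u 0) (u s))" for s
  proof (cases "s \<in> {0<..<1}")
    case True
    then show ?thesis using u_bd[of s] by (simp add: q1_def max_def)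
  qed (simp add: q1_def \<alpha>_out)
  have q1_out: "q1 s = 0" if "s \<notin> {0<..<1}" for s using that by (simp add: q1_def \<alpha>_out)
  have q1_int: "integrable lborel q1"
  proof (rule Bochner_Integration.integrable_bound)
    show "integrable lborel (\<lambda>s. f (u 1) * \<alpha> s)" using \<alpha>_int by simp
    show "q1 \<in> borel_measurable lborel" unfolding q1_eq[abs_def] using fu_meas by measurable
    show "AE s in lborel. norm (q1 s) \<le> norm (f (u 1) * \<alpha> s)"
    proof (rule AE_I2)
      fix s
      show "norm (q1 s) \<le> norm (f (u 1) * \<alpha> s)"
      proof (cases "s \<in> {0<..<1}")
        case True
        then have "0 < u s" "u s \<le> u 1" using u_pos[of s] u_bd[of s] by auto
        then have "0 < f (u s)" "f (u s) \<le> f (u 1)" by (auto intro: f_pos f_mono)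
        then show ?thesis using \<alpha>_nonneg[of s] by (simp add: q1_def abs_mult mult_left_mono mult.commute[of "f (u 1)"])
      qed (simp add: q1_out)
    qed
  qed
  have q_out: "q s = 0" if "s \<notin> {0<..<1}" for s using that by (simp add: q_def q1_out)
  have q_int: "integrable lborel q"
    unfolding q_def[abs_def]
  proof (rule Bochner_Integration.integrable_diff[OF _ q1_int])
    show "integrable lborel (\<lambda>s. indicator {0<..<1} s * u s powr (p - 1))"
    proof (rule Bochner_Integration.integrable_bound)
      show "integrable lborel (\<lambda>s. u 1 powr (p - 1) * indicator {0<..<1::real} s)"
        by (intro integrable_mult_right) (simp add: integrable_indicator_iff)
      show "AE s in lborel. norm (indicator {0<..<1} s * u s powr (p - 1)) \<le> norm (u 1 powr (p - 1) * indicator {0<..<1::real} s)"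
      proof (rule AE_I2)
        fix s :: real
        show "norm (indicator {0<..<1} s * u s powr (p - 1)) \<le> norm (u 1 powr (p - 1) * indicator {0<..<1::real} s)"
        proof (cases "s \<in> {0<..<1}")
          case True
          then have "u s powr (p - 1) \<le> u 1 powr (p - 1)" using u_pos[of s] u_bd[of s] p by (intro powr_mono2) auto
          then show ?thesis using True by simp
        qed simp
      qed
    qed measurable
  qed
  have W: "(LBINT s:{0..<r}. s ^ ?n * q s) = w r" if r: "r \<in> {0..1}" for r
    unfolding w_eq[OF r] set_lebesgue_integral_def
  proof (rule integral_discrete_difference[where X="{0}"])
    fix s assume "s \<notin> {0::real}"
    then show "indicator {0..<r} s *\<^sub>R (s ^ ?n * q s) = indicator {0..<r} s *\<^sub>R (s ^ ?n * (u s powr (p - 1) - \<alpha> s * f (u s)))"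
      using r by (auto simp: indicator_def q_def q1_def)
  qed auto
  have mean: "(LBINT s. s ^ ?n * q s) = 0"
  proof -
    have "(LBINT s. s ^ ?n * q s) = (LBINT s:{0..<1}. s ^ ?n * q s)"
      unfolding set_lebesgue_integral_def
    proof (rule Bochner_Integration.integral_cong[OF refl])
      show "s ^ ?n * q s = indicator {0..<1} s *\<^sub>R (s ^ ?n * q s)" for s
        using q_out[of s] by (cases "s \<in> {0<..<1}") auto
    qed
    then show ?thesis using W[of 1] w1 by simp
  qed
  have weak: "set_integrable lebesgue ?B (\<lambda>x. a (norm x) * f (?U x) * v0 x) \<and>
      (LINT x:?B|lebesgue. norm (?g x) powr (p - 2) * (?g x \<bullet> h0 x) + \<bar>?U x\<bar> powr (p - 2) * ?U x * v0 x)
        = (LINT x:?B|lebesgue. a (norm x) * f (?U x) * v0 x)"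
    if S: "sobolev_W1p_grad p ?B v0 h0" for v0 h0
  proof -
    obtain v h where vh: "weak_pair v h"
      and ve: "AE x in lebesgue. v x = indicator ?B x *\<^sub>R v0 x" and he: "AE x in lebesgue. h x = indicator ?B x *\<^sub>R h0 x"
      using sobolev_borel_version[OF less_imp_le[OF p] S] by blast
    interpret weak_pair v h by (rule vh)
    have V: "(\<lambda>x. indicator ?B x *\<^sub>R v0 x) \<in> borel_measurable lebesgue" and H: "(\<lambda>x. indicator ?B x *\<^sub>R h0 x) \<in> borel_measurable lebesgue"
      using S by (simp_all only: sobolev_W1p_grad_def set_borel_measurable_def)
    have sgnm [measurable]: "(sgn :: 'n \<Rightarrow> 'n) \<in> borel_measurable borel"
      unfolding sgn_div_norm[abs_def] by measurable
    have n0: "AE x in lebesgue. x \<noteq> (0::'n)" by (rule AE_completion[OF AE_lborel_singleton])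
    have R_int: "integrable lborel (\<lambda>x. q1 (norm x) * v x)" by (rule radial_weight_integrable[OF q1_int q1_out])
    have R_ae: "AE x in lebesgue. q1 (norm x) * v x = indicator ?B x *\<^sub>R (a (norm x) * f (?U x) * v0 x)"
      using ve n0 by eventually_elim (auto simp: q1_def \<alpha>_def indicator_def)
    have q1_bor [measurable]: "q1 \<in> borel_measurable borel" using q1_int by auto
    have R_meas: "(\<lambda>x. indicator ?B x *\<^sub>R (a (norm x) * f (?U x) * v0 x)) \<in> borel_measurable lebesgue"
    proof -
      have A: "(\<lambda>x::'n. indicator ?B x *\<^sub>R a (norm x)) \<in> borel_measurable lebesgue"
        using a_L1 by (auto simp: set_integrable_def)
      have F: "(\<lambda>x::'n. f (max (u 0) (u (norm x)))) \<in> borel_measurable lebesgue"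
        by (intro measurable_completion measurable_compose[OF _ fu_meas]) measurable
      have "(\<lambda>x. indicator ?B x *\<^sub>R (a (norm x) * f (?U x) * v0 x))
         = (\<lambda>x. (indicator ?B x *\<^sub>R a (norm x)) * f (max (u 0) (u (norm x))) * (indicator ?B x *\<^sub>R v0 x))"
      proof
        fix x :: 'n
        show "indicator ?B x *\<^sub>R (a (norm x) * f (?U x) * v0 x) = (indicator ?B x *\<^sub>R a (norm x)) * f (max (u 0) (u (norm x))) * (indicator ?B x *\<^sub>R v0 x)"
          using u_bd[of "norm x"] by (auto simp: indicator_def max_def)
      qed
      then show ?thesis using borel_measurable_times[OF borel_measurable_times[OF A F] V] by simp
    qed
    have Rc: "(\<lambda>x. q1 (norm x) * v x) \<in> borel_measurable lebesgue" by (rule measurable_completion) measurable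
    have R_leb: "integrable lebesgue (\<lambda>x. q1 (norm x) * v x)"
      using R_int by (subst integrable_completion) measurable
    have int: "set_integrable lebesgue ?B (\<lambda>x. a (norm x) * f (?U x) * v0 x)"
      unfolding set_integrable_def by (rule integrable_cong_AE[THEN iffD1, OF Rc R_meas R_ae R_leb])
    have rhs: "(LINT x:?B|lebesgue. a (norm x) * f (?U x) * v0 x) = (LBINT x. q1 (norm x) * v x)"
    proof -
      have "(LINT x:?B|lebesgue. a (norm x) * f (?U x) * v0 x) = (LINT x|lebesgue. q1 (norm x) * v x)"
        unfolding set_lebesgue_integral_def by (rule integral_cong_AE[OF Rc R_meas R_ae, symmetric])
      then show ?thesis by (subst (asm) integral_completion) measurable
    qed
    define E where "E x = norm (?g x) powr (p - 2) * (?g x \<bullet> h x) + \<bar>?U x\<bar> powr (p - 2) * ?U x * v x" for x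
    have E_meas [measurable]: "E \<in> borel_measurable borel" unfolding E_def[abs_def] by measurable
    have lhs: "(LINT x:?B|lebesgue. norm (?g x) powr (p - 2) * (?g x \<bullet> h0 x) + \<bar>?U x\<bar> powr (p - 2) * ?U x * v0 x) = (LBINT x. E x)"
    proof -
      have "(LINT x:?B|lebesgue. norm (?g x) powr (p - 2) * (?g x \<bullet> h0 x) + \<bar>?U x\<bar> powr (p - 2) * ?U x * v0 x)
        = (LINT x|lebesgue. norm (?g x) powr (p - 2) * (?g x \<bullet> (indicator ?B x *\<^sub>R h0 x)) + \<bar>?U x\<bar> powr (p - 2) * ?U x * (indicator ?B x *\<^sub>R v0 x))"
        unfolding set_lebesgue_integral_def
        by (intro Bochner_Integration.integral_cong refl) (auto simp: indicator_def)
      also have "\<dots> = (LINT x|lebesgue. E x)"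
      proof (rule integral_cong_AE)
        have c1: "?g \<in> borel_measurable lebesgue" and c2: "(\<lambda>x. norm (?g x) powr (p - 2)) \<in> borel_measurable lebesgue"
          and c3: "(\<lambda>x. \<bar>?U x\<bar> powr (p - 2) * ?U x) \<in> borel_measurable lebesgue"
          by (rule measurable_completion, measurable)+
        show "(\<lambda>x. norm (?g x) powr (p - 2) * (?g x \<bullet> (indicator ?B x *\<^sub>R h0 x)) + \<bar>?U x\<bar> powr (p - 2) * ?U x * (indicator ?B x *\<^sub>R v0 x)) \<in> borel_measurable lebesgue"
          by (intro borel_measurable_add borel_measurable_times[OF c2 borel_measurable_inner[OF c1 H]] borel_measurable_times[OF c3 V])
        show "E \<in> borel_measurable lebesgue" by (rule measurable_completion) measurable
        show "AE x in lebesgue. norm (?g x) powr (p - 2) * (?g x \<bullet> (indicator ?B x *\<^sub>R h0 x)) + \<bar>?U x\<bar> powr (p - 2) * ?U x * (indicator ?B x *\<^sub>R v0 x) = E x"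
          using ve he by eventually_elim (simp add: E_def)
      qed
      also have "\<dots> = (LBINT x. E x)" by (rule integral_completion) measurable
      finally show ?thesis .
    qed
    let ?Z = "\<lambda>y. (LBINT s:{0..<norm y}. s ^ ?n * q s) / norm y ^ ?n * ((h y \<bullet> y) / norm y)"
    have Z_int: "integrable lborel ?Z" and Z0: "(LBINT y. q (norm y) * v y + ?Z y) = 0"
      using radial_identity[OF q_int q_out mean] by auto
    have qv_int: "integrable lborel (\<lambda>y. q (norm y) * v y)" by (rule radial_weight_integrable[OF q_int q_out])
    \<comment> \<open>Away from the origin the vector \<open>|grad u|^(p-2) grad u\<close> equals
      \<open>\<Omega>(r)\<close> times \<open>y / norm y\<close>, and the zeroth-order term is
      \<open>q + q1\<close>. So \<open>E\<close> is the integrand of \<open>radial_identity\<close>,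
      with integral 0, plus the right-hand side \<open>q1 * v\<close>.\<close>
    have E_eq: "E y = (q (norm y) * v y + ?Z y) + q1 (norm y) * v y" if y: "y \<noteq> 0" for y
    proof (cases "y \<in> ?B")
      case True
      define r where "r = norm y"
      have r: "0 < r" "r < 1" using True y by (auto simp: r_def)
      have \<psi>r: "0 \<le> \<psi> r" by (simp add: \<psi>_def)
      have "norm (?g y) = \<psi> r" using y \<psi>r by (simp add: norm_sgn r_def)
      moreover have "?g y \<bullet> h y = \<psi> r * ((h y \<bullet> y) / r)"
        by (simp add: sgn_div_norm r_def inner_commute divide_inverse)
      \<comment> \<open>This includes \<open>\<psi> r = 0\<close>: every power of 0, also a negative
        one for \<open>p < 2\<close>, is 0 by convention, and then \<open>\<Omega> r = 0\<close>
        too.\<close>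
      moreover have "\<psi> r powr (p - 2) * \<psi> r = \<Omega> r"
      proof -
        have "\<psi> r powr (p - 2) * \<psi> r = \<psi> r powr (p - 1)"
          using powr_mult_base[OF \<psi>r, of "p - 2"] by (simp add: mult.commute)
        also have "\<dots> = \<Omega> r" using \<Omega>_ge[of r] r p by (simp add: \<psi>_def powr_powr)
        finally show ?thesis .
      qed
      ultimately have 1: "norm (?g y) powr (p - 2) * (?g y \<bullet> h y) = ?Z y"
        using W[of r] r by (simp add: \<Omega>_def r_def mult.assoc[symmetric])
      have "\<bar>u r\<bar> powr (p - 2) * u r = u r powr (p - 1)"
        using u_pos[of r] r powr_mult_base[of "u r" "p - 2"] by (simp add: mult.commute)
      moreover have "u r powr (p - 1) = q r + q1 r" using r by (simp add: q_def)
      ultimately have 2: "\<bar>?U y\<bar> powr (p - 2) * ?U y * v y = q (norm y) * v y + q1 (norm y) * v y"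
        by (simp add: r_def distrib_right)
      show ?thesis unfolding E_def 1 2 by simp
    next
      case False
      then show ?thesis using v_out[of y] h_out[of y] by (simp add: E_def)
    qed
    have "(LBINT x. E x) = (LBINT y. (q (norm y) * v y + ?Z y) + q1 (norm y) * v y)"
      by (rule integral_discrete_difference[where X="{0}"]) (use E_eq in auto)
    also have "\<dots> = (LBINT y. q (norm y) * v y + ?Z y) + (LBINT y. q1 (norm y) * v y)"
      by (intro Bochner_Integration.integral_add Bochner_Integration.integrable_add qv_int Z_int R_int)
    finally show ?thesis using int lhs rhs Z0 by simp
  qed
  have "weak_solution_neumann p ?B a f ?U"
    unfolding weak_solution_neumann_def using sob weak by blast
  moreover have "\<forall>x\<in>?B. ?U x > 0" using u_pos by auto
  moreover have "\<exists>\<psi>. (\<forall>x\<in>?B. ?U x = \<psi> (norm x)) \<and> mono_on {0..<1} \<psi>"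
    using u_mono by (intro exI[of _ u]) (auto simp: mono_on_def)
  ultimately show ?thesis by blast
qed

end
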